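(* Let $\psi\in PMCG(T_2)$ and let $K_\psi$ be the associated $(1,1)$-knot in the lens space $L(p,q)$, where $p$ and $q=q'+q''$ are determined by the relation $\psi(\beta)=p\,\alpha+q'\,\beta+q''\,\gamma$ in $H_1(\partial T-\partial A)$ (free abelian with basis $\alpha,\beta,\gamma$). Let $n$ be a positive integer and let $d=\gcd(p,n)$. Then $K_\psi$ admits an $n$-fold strongly-cyclic branched covering if and only if $d$ divides $q''$. In this case there exist exactly $d$ such coverings, up to equivalence.
   Context: Setup. Let $T$ be a solid torus with $\partial T$ identified with $\mathbb R^2/\mathbb Z^2$ (coordinates $(x,y)$, standard orientation) so that the circles $\{x=\text{const}\}$ bound discs in $T$. Let $A\subset T$ be the trivial properly embedded arc obtained from the segment $\{(x,1/2): 1/4\le x\le 3/4\}\subset\partial T$ by pushing its interior into the interior of $T$. $T_2$ denotes $\partial T$ with the two punctures $\partial A=\{(1/4,1/2),(3/4,1/2)\}$. Let $\alpha=\{y=0\}$ (oriented in direction $+x$), $\beta=\{x=0\}$, $\gamma=\{x=1/2\}$ (both oriented in direction $+y$). So $\beta$ bounds a disc in $T$ disjoint from $A$, and $\gamma$ bounds a disc meeting $A$ once (a meridian of $A$). Let $d_\alpha,d_\beta,d_\gamma$ be the right-hand Dehn twists about these curves (an arc approaching the curve turns right). $PMCG(T_2)$ is the group of isotopy classes of orientation-preserving homeomorphisms of $\partial T$ fixing each of the two punctures; it is generated by $d_\alpha,d_\beta,d_\gamma$. The knot $K_\psi$. Let $(T',A')$ be a copy of $(T,A)$ with opposite orientation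 and $\tau:(T,A)\to(T',A')$ the identification. For $\psi\in PMCG(T_2)$ set $\varphi=\psi\circ\tau^{-1}|_{\partial T'}:(\partial T',\partial A')\to(\partial T,\partial A)$. The result of gluing $(T,A)\cup_\varphi(T',A')$ is a pair $(L(p,q),K_\psi)$, where $K_\psi=A\cup A'$; it is a $(1,1)$-knot, and every $(1,1)$-knot arises in this way up to equivalence. If $\psi(\beta)=p\alpha+q'\beta+q''\gamma$ in $H_1(\partial T-\partial A)$ then the ambient space is the lens space $L(p,q)=L(|p|,q)$, $q=q'+q''$ ($p=0$ gives $S^1\times S^2$, $p=\pm1$ gives $S^3$). Coverings. An $n$-fold cyclic covering $f$ of a closed orientable manifold $N$ branched over $L$ is given by an epimorphism (monodromy) $\omega_f:H_1(N-L)\to\mathbb Z_n$. Two such coverings with monodromies $\omega_{f'},\omega_{f''}$ are equivalent iff $\omega_{f''}=u\,\omega_{f'}$ for some $u\in\mathbb Z_n$ with $\gcd(u,n)=1$. An $n$-fold cyclic covering of $L(p,q)$ branched over a $(1,1)$-knot $K$ is strongly-cyclic if the branching index of $K$ is $n$, i.e. the fiber over each point of $K$ is a single point; equivalently, $\omega_f$ sends the class of a meridian of $K$ to a generator of $\mathbb Z_n$. *)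

theory Defs
  imports "HOL-Analysis.Analysis" "HOL-Homology.Homology"
begin

section \<open>The solid torus, the trivial arc, and the curves on the boundary\<close>

text \<open>The solid torus is the product of the unit circle with the closed unit disc in
  the complex plane. The point with coordinates \<open>(x, y)\<close> of the boundary is
  \<open>(cis (2 \<pi> x), cis (2 \<pi> y))\<close>, so the circles with constant \<open>x\<close> bound discs.\<close>

definition solid_torus :: "(complex \<times> complex) set" where
  "solid_torus = sphere 0 1 \<times> cball 0 1"

definition torus :: "(complex \<times> complex) set" where
  "torus = sphere 0 1 \<times> sphere 0 1"

definition torus_pt :: "real \<Rightarrow> real \<Rightarrow> complex \<times> complex" where
  "torus_pt x y = (cis (2 * pi * x), cis (2 * pi * y))"

definition punctures :: "(complex \<times> complex) set" where
  "punctures = {torus_pt (1/4) (1/2), torus_pt (3/4) (1/2)}"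

text \<open>The segment \<open>y = 1/2\<close>, \<open>1/4 \<le> x \<le> 3/4\<close> has second complex coordinate \<open>-1\<close>. It is
  pushed radially into the interior, to radius \<open>1 + cos (2 \<pi> x) / 2\<close>, which is \<open>1\<close> at
  the two endpoints and lies in \<open>{1/2..<1}\<close> in between.\<close>

definition trivial_arc :: "(complex \<times> complex) set" where
  "trivial_arc = (\<lambda>x. (cis (2 * pi * x), - complex_of_real (1 + cos (2 * pi * x) / 2))) ` {1/4..3/4}"

definition alpha :: "real \<Rightarrow> complex \<times> complex" where
  "alpha t = torus_pt t 0"

definition beta :: "real \<Rightarrow> complex \<times> complex" where
  "beta t = torus_pt 0 t"

definition gamma :: "real \<Rightarrow> complex \<times> complex" where
  "gamma t = torus_pt (1/2) t"

definition punctured_torus :: "(complex \<times> complex) topology" where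
  "punctured_torus = top_of_set (torus - punctures)"

text \<open>Checks of the model: the arc is properly embedded with boundary the punctures, the
  disc bounded by \<open>beta\<close> misses the arc, and the disc bounded by \<open>gamma\<close> meets it once.\<close>

lemma arc_param_bounds:
  assumes "x \<in> {1/4..3/4::real}"
  shows "pi / 2 \<le> 2 * pi * x" "2 * pi * x \<le> 3 * pi / 2"
proof -
  have "2 * pi * (1/4) \<le> 2 * pi * x" "2 * pi * x \<le> 2 * pi * (3/4)"
    using assms by (auto intro!: mult_left_mono simp del: mult_le_cancel_left)
  then show "pi / 2 \<le> 2 * pi * x" "2 * pi * x \<le> 3 * pi / 2" by linarith+
qed

lemma cos_minus_pi_eq: "cos (y - pi) = - cos (y::real)"
  by (simp add: cos_diff)

lemma cos_arc_param_nonpos: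
  assumes "x \<in> {1/4..3/4::real}"
  shows "cos (2 * pi * x) \<le> 0"
proof -
  have "0 \<le> cos (2 * pi * x - pi)"
    using arc_param_bounds[OF assms] by (intro cos_ge_zero) linarith+
  then show ?thesis unfolding cos_minus_pi_eq by linarith
qed

lemma cmod_minus_of_real: "cmod (- complex_of_real r) = \<bar>r\<bar>"
  by (metis norm_minus_cancel norm_of_real)

lemma trivial_arcE:
  assumes "z \<in> trivial_arc"
  obtains x where "x \<in> {1/4..3/4}"
    "z = (cis (2 * pi * x), - complex_of_real (1 + cos (2 * pi * x) / 2))"
  using assms unfolding trivial_arc_def by blast

lemma trivial_arc_subset: "trivial_arc \<subseteq> solid_torus"
proof
  fix z assume "z \<in> trivial_arc"
  then obtain x where x: "x \<in> {1/4..3/4}"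
    and z: "z = (cis (2 * pi * x), - complex_of_real (1 + cos (2 * pi * x) / 2))"
    by (rule trivial_arcE)
  have "\<bar>1 + cos (2 * pi * x) / 2\<bar> \<le> 1"
    using cos_arc_param_nonpos[OF x] cos_ge_minus_one[of "2 * pi * x"] by linarith
  then show "z \<in> solid_torus"
    unfolding z solid_torus_def mem_Times_iff fst_conv snd_conv mem_sphere_0
      mem_cball_0 cmod_minus_of_real norm_cis by blast
qed

lemma trivial_arc_boundary: "trivial_arc \<inter> torus = punctures"
proof (intro equalityI subsetI)
  fix z assume "z \<in> trivial_arc \<inter> torus"
  then have "z \<in> trivial_arc" and t: "z \<in> torus" by blast+
  from this(1) obtain x where x: "x \<in> {1/4..3/4}"
    and z: "z = (cis (2 * pi * x), - complex_of_real (1 + cos (2 * pi * x) / 2))"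
    by (rule trivial_arcE)
  from t have "\<bar>1 + cos (2 * pi * x) / 2\<bar> = 1"
    unfolding z torus_def mem_Times_iff fst_conv snd_conv mem_sphere_0 cmod_minus_of_real by blast
  then have c: "cos (2 * pi * x) = 0"
    using cos_arc_param_nonpos[OF x] cos_ge_minus_one[of "2 * pi * x"] by linarith
  have "\<not> (pi / 2 < 2 * pi * x \<and> 2 * pi * x < 3 * pi / 2)"
  proof
    assume "pi / 2 < 2 * pi * x \<and> 2 * pi * x < 3 * pi / 2"
    then have "0 < cos (2 * pi * x - pi)" by (intro cos_gt_zero_pi) linarith+
    then show False using c unfolding cos_minus_pi_eq by linarith
  qed
  then have "2 * pi * x = pi / 2 \<or> 2 * pi * x = 3 * pi / 2"
    using arc_param_bounds[OF x] by linarith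
  then have "2 * pi * x = 2 * pi * (1/4) \<or> 2 * pi * x = 2 * pi * (3/4)" by linarith
  then have "x = 1/4 \<or> x = 3/4"
    by (metis mult_cancel_left mult_eq_0_iff pi_neq_zero zero_neq_numeral)
  moreover have "z = torus_pt x (1/2)"
    unfolding z c torus_pt_def by simp
  ultimately show "z \<in> punctures" unfolding punctures_def by blast
next
  have 1: "torus_pt x (1/2) \<in> trivial_arc \<inter> torus"
    if x: "x \<in> {1/4..3/4}" and c: "cos (2 * pi * x) = 0" for x
  proof
    have "torus_pt x (1/2) = (cis (2 * pi * x), - complex_of_real (1 + cos (2 * pi * x) / 2))"
      unfolding c torus_pt_def by simp
    then show "torus_pt x (1/2) \<in> trivial_arc"
      unfolding trivial_arc_def using x by (rule image_eqI)
    show "torus_pt x (1/2) \<in> torus" by (simp add: torus_pt_def torus_def)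
  qed
  have "2 * pi * (1/4) = pi / 2" "2 * pi * (3/4) = 3 * pi / 2" by simp_all
  then have "cos (2 * pi * (1/4)) = 0" "cos (2 * pi * (3/4)) = 0"
    using cos_pi_half cos_3over2_pi by (metis times_divide_eq_left)+
  moreover fix z assume "z \<in> punctures"
  ultimately show "z \<in> trivial_arc \<inter> torus"
    using 1[of "1/4"] 1[of "3/4"] unfolding punctures_def by auto
qed

lemma beta_disc_trivial_arc: "({1} \<times> cball 0 1) \<inter> trivial_arc = {}"
proof -
  have False if z: "z \<in> trivial_arc" "fst z = 1" for z
  proof -
    obtain x where x: "x \<in> {1/4..3/4}"
      and "z = (cis (2 * pi * x), - complex_of_real (1 + cos (2 * pi * x) / 2))"
      using z(1) by (rule trivial_arcE)
    then have "cos (2 * pi * x) = 1" using z(2) by (metis cis.sel(1) fst_conv one_complex.sel(1))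
    then show False using cos_arc_param_nonpos[OF x] by linarith
  qed
  then show ?thesis by force
qed

lemma gamma_disc_trivial_arc: "({-1} \<times> cball 0 1) \<inter> trivial_arc = {(-1, -1/2)}"
proof -
  have 1: "z = (-1, -1/2)" if z: "z \<in> trivial_arc" "fst z = -1" for z
  proof -
    obtain x where x: "x \<in> {1/4..3/4}"
      and zx: "z = (cis (2 * pi * x), - complex_of_real (1 + cos (2 * pi * x) / 2))"
      using z(1) by (rule trivial_arcE)
    then have c: "cos (2 * pi * x) = -1"
      using z(2) by (metis cis.sel(1) fst_conv one_complex.sel(1) uminus_complex.sel(1))
    show ?thesis using z(2) unfolding zx c by simp
  qed
  have 2: "(-1, -1/2) \<in> trivial_arc"
    unfolding trivial_arc_def by (rule image_eqI[of _ _ "1/2"]) auto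
  have 3: "(-1/2 :: complex) \<in> cball 0 1" by simp
  show ?thesis
  proof (intro equalityI subsetI)
    fix z assume "z \<in> ({-1} \<times> cball 0 1) \<inter> trivial_arc"
    then have "z \<in> trivial_arc" "fst z = -1" by (blast, simp add: mem_Times_iff)
    then show "z \<in> {(-1, -1/2)}" using 1 by blast
  qed (use 2 3 in blast)
qed


section \<open>Homology classes of loops\<close>

text \<open>The standard 1-simplex is parametrised by its barycentric coordinate \<open>s 1\<close>; a loop
  \<open>g\<close> on \<open>[0, 1]\<close> then runs from vertex 0 to vertex 1.\<close>

definition loop_class :: "'a topology \<Rightarrow> (real \<Rightarrow> 'a) \<Rightarrow> 'a chain set" where
  "loop_class X g =
     homologous_rel_set 1 X {} (frag_of (restrict (\<lambda>s. g (s 1)) (standard_simplex 1)))"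


section \<open>The pure mapping class group of the twice punctured torus\<close>

text \<open>A homeomorphism of the (closed, connected, oriented) torus preserves the orientation
  iff it fixes the fundamental class, i.e. acts trivially on the second homology group.\<close>

definition orientation_preserving_on_torus ::
    "(complex \<times> complex \<Rightarrow> complex \<times> complex) \<Rightarrow> bool" where
  "orientation_preserving_on_torus h \<longleftrightarrow>
     (\<forall>c \<in> carrier (homology_group 2 (top_of_set torus)).
        hom_induced 2 (top_of_set torus) {} (top_of_set torus) {} h c = c)"

definition pure_homeos :: "(complex \<times> complex \<Rightarrow> complex \<times> complex) set" where
  "pure_homeos =
     {h. homeomorphic_map (top_of_set torus) (top_of_set torus) h \<and>
         orientation_preserving_on_torus h \<and> (\<forall>z \<in> punctures. h z = z)}"

text \<open>Only values on the torus matter: maps agreeing there are isotopic.\<close>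

definition pure_isotopy ::
    "((complex \<times> complex \<Rightarrow> complex \<times> complex) \<times> (complex \<times> complex \<Rightarrow> complex \<times> complex)) set" where
  "pure_isotopy =
     {(h, g). h \<in> pure_homeos \<and> g \<in> pure_homeos \<and>
        (\<exists>H. continuous_map (prod_topology (top_of_set {0..1::real}) (top_of_set torus))
               (top_of_set torus) H \<and>
             (\<forall>t \<in> {0..1}. (\<lambda>z. H (t, z)) \<in> pure_homeos) \<and>
             (\<forall>z \<in> torus. H (0, z) = h z \<and> H (1, z) = g z))}"

definition PMCG :: "(complex \<times> complex \<Rightarrow> complex \<times> complex) set set" where
  "PMCG = pure_homeos // pure_isotopy"


section \<open>The knot obtained by gluing two copies of the solid torus\<close>

definition quotient_topology :: "'a topology \<Rightarrow> ('a \<Rightarrow> 'b) \<Rightarrow> 'b topology" where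
  "quotient_topology X f =
     topology (\<lambda>U. U \<subseteq> f ` topspace X \<and> openin X {x \<in> topspace X. f x \<in> U})"

lemma openin_quotient_topology:
  "openin (quotient_topology X f) U \<longleftrightarrow>
     U \<subseteq> f ` topspace X \<and> openin X {x \<in> topspace X. f x \<in> U}"
proof -
  have "istopology (\<lambda>U. U \<subseteq> f ` topspace X \<and> openin X {x \<in> topspace X. f x \<in> U})"
    unfolding istopology_def
  proof (intro conjI allI impI)
    fix S T
    assume "S \<subseteq> f ` topspace X \<and> openin X {x \<in> topspace X. f x \<in> S}"
      and "T \<subseteq> f ` topspace X \<and> openin X {x \<in> topspace X. f x \<in> T}"
    moreover have "{x \<in> topspace X. f x \<in> S \<inter> T} =
        {x \<in> topspace X. f x \<in> S} \<inter> {x \<in> topspace X. f x \<in> T}" by auto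
    ultimately show "S \<inter> T \<subseteq> f ` topspace X" "openin X {x \<in> topspace X. f x \<in> S \<inter> T}"
      by (auto simp del: Int_iff)
  next
    fix \<K>
    assume K: "\<forall>K\<in>\<K>. K \<subseteq> f ` topspace X \<and> openin X {x \<in> topspace X. f x \<in> K}"
    have "{x \<in> topspace X. f x \<in> \<Union>\<K>} = (\<Union>K\<in>\<K>. {x \<in> topspace X. f x \<in> K})" by auto
    then show "openin X {x \<in> topspace X. f x \<in> \<Union>\<K>}" using K by auto
    show "\<Union>\<K> \<subseteq> f ` topspace X" using K by auto
  qed
  then show ?thesis by (simp add: quotient_topology_def)
qed

lemma topspace_quotient_topology [simp]:
  "topspace (quotient_topology X f) = f ` topspace X"
proof
  have "openin (quotient_topology X f) (topspace (quotient_topology X f))"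
    by (rule openin_topspace)
  then show "topspace (quotient_topology X f) \<subseteq> f ` topspace X"
    unfolding openin_quotient_topology by (rule conjunct1)
  have "{x \<in> topspace X. f x \<in> f ` topspace X} = topspace X" by auto
  then have "openin (quotient_topology X f) (f ` topspace X)"
    by (simp add: openin_quotient_topology)
  then show "f ` topspace X \<subseteq> topspace (quotient_topology X f)"
    by (rule openin_subset)
qed

lemma quotient_map_quotient_topology: "quotient_map X (quotient_topology X f) f"
  unfolding quotient_map_def openin_quotient_topology topspace_quotient_topology by blast

text \<open>The two copies of the solid torus carry the tags \<open>False\<close> (for \<open>T\<close>) and \<open>True\<close>
  (for \<open>T'\<close>). The boundary point \<open>(True, z)\<close> of \<open>T'\<close> is glued to the boundary point
  \<open>(False, h z)\<close> of \<open>T\<close>; the latter serves as canonical representative, so the quotient by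
  the gluing is the quotient along \<open>glue h\<close>. The opposite orientation of \<open>T'\<close> does not
  affect the underlying space.\<close>

definition glue ::
    "(complex \<times> complex \<Rightarrow> complex \<times> complex) \<Rightarrow> bool \<times> complex \<times> complex \<Rightarrow> bool \<times> complex \<times> complex" where
  "glue h = (\<lambda>(i, z). if i \<and> z \<in> torus then (False, h z) else (i, z))"

definition ambient ::
    "(complex \<times> complex \<Rightarrow> complex \<times> complex) \<Rightarrow> (bool \<times> complex \<times> complex) topology" where
  "ambient h = quotient_topology (sum_topology (\<lambda>i. top_of_set solid_torus) UNIV) (glue h)"

definition knot ::
    "(complex \<times> complex \<Rightarrow> complex \<times> complex) \<Rightarrow> (bool \<times> complex \<times> complex) set" where
  "knot h = glue h ` (UNIV \<times> trivial_arc)"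


section \<open>Strongly-cyclic branched coverings\<close>

text \<open>Coverings are represented by their monodromies.\<close>

definition link_complement :: "'a topology \<Rightarrow> 'a set \<Rightarrow> 'a topology" where
  "link_complement N L = subtopology N (topspace N - L)"

definition cyclic_coverings :: "nat \<Rightarrow> 'a topology \<Rightarrow> 'a set \<Rightarrow> ('a chain set \<Rightarrow> int) set" where
  "cyclic_coverings n N L =
     epi (homology_group 1 (link_complement N L)) (integer_mod_group n)"

definition covering_equiv ::
    "nat \<Rightarrow> 'a topology \<Rightarrow> 'a set \<Rightarrow> (('a chain set \<Rightarrow> int) \<times> ('a chain set \<Rightarrow> int)) set" where
  "covering_equiv n N L =
     {(\<omega>', \<omega>''). \<omega>' \<in> cyclic_coverings n N L \<and> \<omega>'' \<in> cyclic_coverings n N L \<and>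
        (\<exists>u \<in> carrier (integer_mod_group n). gcd u (int n) = 1 \<and>
           (\<forall>c \<in> carrier (homology_group 1 (link_complement N L)).
              \<omega>'' c = (u * \<omega>' c) mod int n))}"

text \<open>The curve \<open>gamma\<close>, placed in the first copy of the solid torus, bounds there a disc
  that meets the knot in a single interior point of the arc.\<close>

definition meridian_class ::
    "(complex \<times> complex \<Rightarrow> complex \<times> complex) \<Rightarrow> (bool \<times> complex \<times> complex) chain set" where
  "meridian_class h =
     loop_class (link_complement (ambient h) (knot h)) (\<lambda>t. glue h (False, gamma t))"

definition strongly_cyclic_coverings ::
    "nat \<Rightarrow> (complex \<times> complex \<Rightarrow> complex \<times> complex) \<Rightarrow>
       ((bool \<times> complex \<times> complex) chain set \<Rightarrow> int) set" where
  "strongly_cyclic_coverings n h =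
     {\<omega> \<in> cyclic_coverings n (ambient h) (knot h).
        generate (integer_mod_group n) {\<omega> (meridian_class h)} = carrier (integer_mod_group n)}"

end

(*  The complement of the knot is the union of two copies of the arc complement S = T - A, glued along the
    twice punctured torus by psi. The first homology of the punctured torus is generated by alpha, beta,
    gamma; including it into S is onto on first homology and kills exactly the multiples of beta, since the
    winding numbers of the first coordinate and of the vector pointing away from the centre of A
    detect alpha and gamma. By Mayer-Vietoris, the first homology of the knot complement is therefore
    that of the first copy of S modulo psi(beta): it is generated by alpha and the meridian gamma with the
    single relation p alpha + q'' gamma = 0. A strongly-cyclic covering can be normalised, by a unit, to
    send gamma to 1; it is then determined by the image x of alpha, which is any solution of
    p x + q'' = 0 (mod n), and there are gcd(p, n) or no such solutions. *)

theory Submission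
  imports Defs "HOL-Number_Theory.Cong"
begin

section \<open>One-dimensional singular homology, handled on chains\<close>

section \<open>One-dimensional cycles\<close>

text \<open>The two solid tori overlap only in a surface, while subdivision arguments need open
  sets, so each arc complement is thickened by a collar inside the other copy. The gluing map is an
  arbitrary homeomorphism, and every map on the collars must be compatible with it; this is arranged
  by a radial flow that fixes the boundary torus pointwise at all times. No single centre serves
  both purposes. The flow away from \<open>arc_center\<close> is defined on the whole arc complement
  but moves some boundary points where that centre lies outside the disc; the flow away from
  \<open>core_center\<close> fixes the boundary but is defined only off a closed curve containing
  the arc. The former moves every cycle of the arc complement into the punctured torus, the latter
  provides the collars. Mayer-Vietoris is carried out on cycles modulo boundaries, since the
  conclusions concern the explicit loops \<open>alpha\<close>, \<open>beta\<close>,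
  \<open>gamma\<close> and not just groups up to isomorphism; for the same reason it is checked by
  hand that the standard loop generates the homology of the circle.\<close>

definition one_cycle :: "'a topology \<Rightarrow> 'a chain \<Rightarrow> bool" where
  "one_cycle X z \<longleftrightarrow> singular_relcycle 1 X {} z"

definition one_boundary :: "'a topology \<Rightarrow> 'a chain \<Rightarrow> bool" where
  "one_boundary X z \<longleftrightarrow> singular_relboundary 1 X {} z"

definition push :: "('a \<Rightarrow> 'b) \<Rightarrow> 'a chain \<Rightarrow> 'b chain" where
  "push f = chain_map 1 f"

definition path_chain :: "(real \<Rightarrow> 'a) \<Rightarrow> 'a chain" where
  "path_chain g = frag_of (restrict (\<lambda>s. g (s 1)) (standard_simplex 1))"

definition point_chain :: "'a \<Rightarrow> 'a chain" where
  "point_chain a = frag_of (restrict (\<lambda>_. a) (standard_simplex 0))"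

lemma one_cycle_iff: "one_cycle X z \<longleftrightarrow> singular_chain 1 X z \<and> chain_boundary 1 z = 0"
  by (simp add: one_cycle_def singular_cycle)

lemma one_boundary_0 [simp]: "one_boundary X 0"
  by (simp add: one_boundary_def)

lemma one_cycle_add: "one_cycle X a \<Longrightarrow> one_cycle X b \<Longrightarrow> one_cycle X (a + b)"
  unfolding one_cycle_def by (rule singular_relcycle_add)

lemma one_cycle_diff: "one_cycle X a \<Longrightarrow> one_cycle X b \<Longrightarrow> one_cycle X (a - b)"
  unfolding one_cycle_def by (rule singular_relcycle_diff)

lemma one_cycle_cmul: "one_cycle X a \<Longrightarrow> one_cycle X (frag_cmul k a)"
  unfolding one_cycle_def by (rule singular_relcycle_cmul)

lemma one_boundary_add: "one_boundary X a \<Longrightarrow> one_boundary X b \<Longrightarrow> one_boundary X (a + b)"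
  unfolding one_boundary_def by (rule singular_relboundary_add)

lemma one_boundary_diff: "one_boundary X a \<Longrightarrow> one_boundary X b \<Longrightarrow> one_boundary X (a - b)"
  unfolding one_boundary_def by (rule singular_relboundary_diff)

lemma one_boundary_minus: "one_boundary X (- a) \<longleftrightarrow> one_boundary X a"
  unfolding one_boundary_def by (rule singular_relboundary_minus)

lemma one_boundary_cmul: "one_boundary X a \<Longrightarrow> one_boundary X (frag_cmul k a)"
  unfolding one_boundary_def by (rule singular_relboundary_cmul)

lemma one_boundary_imp_cycle: "one_boundary X a \<Longrightarrow> one_cycle X a"
  unfolding one_boundary_def one_cycle_def by (rule singular_relboundary_imp_relcycle)

lemma one_boundary_swap: "one_boundary X (a - b) \<Longrightarrow> one_boundary X (b - a)"
  using one_boundary_minus[of X "a - b"] by simp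

lemma one_boundary_trans:
  "one_boundary X (a - b) \<Longrightarrow> one_boundary X (b - c) \<Longrightarrow> one_boundary X (a - c)"
  using one_boundary_add[of X "a - b" "b - c"] by simp

lemma one_boundary_cong: "one_boundary X (a - b) \<Longrightarrow> one_boundary X a \<longleftrightarrow> one_boundary X b"
  using one_boundary_diff[of X a "a - b"] one_boundary_add[of X "a - b" b] by auto

lemma push_add: "push f (a + b) = push f a + push f b"
  by (simp add: push_def chain_map_add)

lemma push_diff: "push f (a - b) = push f a - push f b"
  by (simp add: push_def chain_map_diff)

lemma push_cmul: "push f (frag_cmul k a) = frag_cmul k (push f a)"
  by (simp add: push_def)

lemma push_push: "push g (push f a) = push (g \<circ> f) a"
  by (simp add: push_def chain_map_compose)

lemma push_cong:
  assumes "one_cycle X z" "\<And>x. x \<in> topspace X \<Longrightarrow> f x = g x"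
  shows "push f z = push g z"
  unfolding push_def using assms by (intro chain_map_eq[of 1 X]) (auto simp: one_cycle_iff)

lemma push_ident:
  assumes "one_cycle X z" "\<And>x. x \<in> topspace X \<Longrightarrow> f x = x"
  shows "push f z = z"
  unfolding push_def using assms by (intro chain_map_id_gen[of 1 X]) (auto simp: one_cycle_iff)

lemma one_cycle_push: "one_cycle X z \<Longrightarrow> continuous_map X Y f \<Longrightarrow> one_cycle Y (push f z)"
  unfolding one_cycle_def push_def by (rule singular_relcycle_chain_map) auto

lemma one_boundary_push:
  "one_boundary X z \<Longrightarrow> continuous_map X Y f \<Longrightarrow> one_boundary Y (push f z)"
  unfolding one_boundary_def push_def by (rule singular_relboundary_chain_map) auto

lemma one_cycle_mono:
  assumes "one_cycle (subtopology X S) z" "S \<subseteq> T" shows "one_cycle (subtopology X T) z"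
  using assms unfolding one_cycle_def by (rule singular_cycle_mono)

lemma one_boundary_mono:
  assumes "one_boundary (subtopology X S) z" "S \<subseteq> T" shows "one_boundary (subtopology X T) z"
  using singular_boundary_mono[OF assms(2)] assms(1) unfolding one_boundary_def by blast

lemma one_boundary_subtopology: "one_boundary (subtopology X S) z \<Longrightarrow> one_boundary X z"
  unfolding one_boundary_def singular_boundary by (auto simp: singular_chain_subtopology)

lemma one_boundary_homotopic:
  assumes "homotopic_with (\<lambda>_. True) X Y f g" "one_cycle X z"
  shows "one_boundary Y (push f z - push g z)"
  using homotopic_imp_homologous_rel_chain_maps[of "{}" "{}" X Y f g 1 z] assms
  by (simp add: one_boundary_def one_cycle_def push_def homologous_rel_def)

lemma one_boundary_singleton:
  assumes "topspace X = {a}" "one_cycle X z" shows "one_boundary X z"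
  using assms singular_boundary_eq_cycle_singleton[of X a 1 z]
  by (simp add: one_boundary_def one_cycle_def)

text \<open>The constant map factors through the one-point subspace \<open>{b}\<close>, in which
  every 1-cycle bounds.\<close>

lemma one_boundary_push_const:
  assumes "one_cycle X z" "b \<in> topspace Y" shows "one_boundary Y (push (\<lambda>_. b) z)"
proof -
  have "topspace (subtopology Y {b}) = {b}" using assms(2) by auto
  moreover have "continuous_map X (subtopology Y {b}) (\<lambda>_. b)"
    using assms(2) by (auto simp: continuous_map_in_subtopology)
  ultimately show ?thesis
    using one_boundary_singleton one_cycle_push[OF assms(1)] one_boundary_subtopology by metis
qed

lemma one_boundary_contractible:
  assumes "contractible_space X" "one_cycle X z" shows "one_boundary X z"
proof -
  obtain a where h: "homotopic_with (\<lambda>_. True) X X id (\<lambda>_. a)"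
    using assms(1) by (auto simp: contractible_space_def)
  have *: "one_boundary X (z - push (\<lambda>_. a) z)"
    using one_boundary_homotopic[OF h assms(2)] push_ident[OF assms(2), of id] by simp
  show ?thesis
  \<comment> \<open>The empty space is contractible as well, and there \<open>a\<close> is not a
    point of \<open>X\<close>; but its only 1-chain is zero.\<close>
  proof (cases "topspace X = {}")
    case True
    then have "z = 0"
      using assms(2) singular_chain_empty[of X 1 z] by (simp add: one_cycle_iff)
    then show ?thesis by simp
  next
    case False
    have "continuous_map X X (\<lambda>_. a)" using homotopic_with_imp_continuous_maps[OF h] by simp
    then have "a \<in> topspace X" using False by auto
    then show ?thesis using one_boundary_push_const[OF assms(2), of a X] one_boundary_cong[OF *] by blast
  qed
qed

section \<open>Paths as chains\<close>

lemma continuous_map_simplex_coordinate: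
  assumes "j \<le> p"
  shows "continuous_map (subtopology (powertop_real UNIV) (standard_simplex p))
           (top_of_set {0..1}) (\<lambda>s. s j)"
proof -
  have "continuous_map (subtopology (powertop_real UNIV) (standard_simplex p)) euclideanreal (\<lambda>s. s j)"
    by (metis UNIV_I continuous_map_from_subtopology continuous_map_product_projection)
  then show ?thesis
    by (auto simp: continuous_map_in_subtopology standard_simplex_def)
qed

lemma singular_simplex_path:
  assumes "continuous_map (top_of_set {0..1}) X g"
  shows "singular_simplex 1 X (restrict (\<lambda>s. g (s 1)) (standard_simplex 1))"
  using continuous_map_compose[OF continuous_map_simplex_coordinate[of 1 1] assms]
  by (simp add: singular_simplex_def o_def)

lemma singular_chain_path_chain:
  assumes "continuous_map (top_of_set {0..1}) X g"
  shows "singular_chain 1 X (path_chain g)"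
  unfolding path_chain_def singular_chain_of using assms by (rule singular_simplex_path)

lemma chain_boundary_path_chain:
  "chain_boundary 1 (path_chain g) = point_chain (g 1) - point_chain (g 0)"
proof -
  have "singular_face (Suc 0) 0 (\<lambda>s. g (s (Suc 0))) = restrict (\<lambda>_. g 1) (standard_simplex 0)"
    "singular_face (Suc 0) (Suc 0) (\<lambda>s. g (s (Suc 0))) = restrict (\<lambda>_. g 0) (standard_simplex 0)"
    by (auto simp: singular_face_def simplical_face_def standard_simplex_0 restrict_def fun_eq_iff)
  then show ?thesis
    by (simp add: path_chain_def point_chain_def chain_boundary_of)
qed

lemma one_cycle_path_chain:
  assumes "continuous_map (top_of_set {0..1}) X g" "g 0 = g 1"
  shows "one_cycle X (path_chain g)"
  using singular_chain_path_chain[OF assms(1)] chain_boundary_path_chain[of g] assms(2)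
  by (simp add: one_cycle_iff)

lemma push_path_chain: "push f (path_chain g) = path_chain (f \<circ> g)"
  by (auto simp: push_def path_chain_def simplex_map_def intro!: arg_cong[where f=frag_of])

lemma loop_class_path_chain: "loop_class X g = homologous_rel_set 1 X {} (path_chain g)"
  by (simp add: loop_class_def path_chain_def)

text \<open>The 2-simplex \<open>f\<close> is \<open>g\<close> after the affine map that sends the
  vertices 0, 1, 2 to 0, 1/2, 1. Its faces opposite to these vertices are the second half, the whole
  path and the first half, so its boundary is the two halves minus the whole.\<close>

lemma path_chain_halves:
  assumes g: "continuous_map (top_of_set {0..1}) X g"
  shows "one_boundary X (path_chain g - (path_chain (\<lambda>t. g (t/2)) + path_chain (\<lambda>t. g (1/2 + t/2))))"
proof -
  let ?S = "standard_simplex 2"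
  define f where "f = restrict (\<lambda>s. g (s 1 / 2 + s 2)) ?S"
  have c: "continuous_map (subtopology (powertop_real UNIV) ?S) euclideanreal (\<lambda>s. s j)" for j
    by (metis UNIV_I continuous_map_from_subtopology continuous_map_product_projection)
  have sum: "s 1 / 2 + s 2 \<in> {0..1}" if "s \<in> ?S" for s
  proof -
    have "s 0 + s 1 + s 2 = 1" "s 0 \<ge> 0" "s 1 \<ge> 0" "s 2 \<ge> 0"
      using that by (simp_all add: standard_simplex_def numeral_2_eq_2)
    then show ?thesis by simp
  qed
  have "continuous_map (subtopology (powertop_real UNIV) ?S) (top_of_set {0..1}) (\<lambda>s. s 1 / 2 + s 2)"
    using continuous_map_add[OF continuous_map_real_divide[OF c[of 1], of "\<lambda>_. 2"] c[of 2]] sum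
    by (simp add: continuous_map_in_subtopology)
  from continuous_map_compose[OF this g] have "singular_simplex 2 X f"
    by (simp add: singular_simplex_def f_def o_def)
  then have "singular_chain 2 X (frag_of f)" by (simp add: singular_chain_of)
  moreover have "chain_boundary 2 (frag_of f)
      = (path_chain (\<lambda>t. g (t/2)) + path_chain (\<lambda>t. g (1/2 + t/2))) - path_chain g"
  proof -
    have e: "s 0 = 1 - s (Suc 0)" if "s \<in> standard_simplex (Suc 0)" for s
      using that by (auto simp: standard_simplex_def)
    have 2: "simplical_face k s \<in> ?S" if "k \<le> 2" "s \<in> standard_simplex 1" for k :: nat and s :: "nat \<Rightarrow> real"
      using simplical_face_in_standard_simplex[of 2 k s] that by simp
    have "singular_face 2 0 f = restrict (\<lambda>s. g (1/2 + s 1/2)) (standard_simplex 1)"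
    proof (rule ext)
      fix s :: "nat \<Rightarrow> real"
      show "singular_face 2 0 f s = restrict (\<lambda>s. g (1/2 + s 1/2)) (standard_simplex 1) s"
      proof (cases "s \<in> standard_simplex 1")
        case True
        have "s 0 / 2 + s 1 = 1/2 + s 1/2" using e[of s] True by (simp add: field_simps)
        then show ?thesis using True 2[OF _ True, of 0]
          by (simp add: singular_face_def f_def) (simp add: simplical_face_def)
      qed (simp add: singular_face_def)
    qed
    moreover have "singular_face 2 1 f = restrict (\<lambda>s. g (s 1)) (standard_simplex 1)"
    proof (rule ext)
      fix s :: "nat \<Rightarrow> real"
      show "singular_face 2 1 f s = restrict (\<lambda>s. g (s 1)) (standard_simplex 1) s"
      proof (cases "s \<in> standard_simplex 1")
        case True
        then show ?thesis using 2[OF _ True, of 1]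
          by (simp add: singular_face_def f_def) (simp add: simplical_face_def)
      qed (simp add: singular_face_def)
    qed
    moreover have "singular_face 2 2 f = restrict (\<lambda>s. g (s 1/2)) (standard_simplex 1)"
    proof (rule ext)
      fix s :: "nat \<Rightarrow> real"
      show "singular_face 2 2 f s = restrict (\<lambda>s. g (s 1/2)) (standard_simplex 1) s"
      proof (cases "s \<in> standard_simplex 1")
        case True
        then show ?thesis using 2[OF _ True, of 2]
          by (simp add: singular_face_def f_def) (simp add: simplical_face_def)
      qed (simp add: singular_face_def)
    qed
    ultimately show ?thesis
      by (simp add: path_chain_def chain_boundary_of numeral_2_eq_2)
  qed
  ultimately have "one_boundary X ((path_chain (\<lambda>t. g (t/2)) + path_chain (\<lambda>t. g (1/2 + t/2))) - path_chain g)"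
    unfolding one_boundary_def singular_boundary by (metis Suc_1)
  then show ?thesis by (rule one_boundary_swap)
qed

section \<open>Small chains\<close>

text \<open>\<open>excised_chain_exists\<close> applies with the complement of \<open>U\<close> as
  the excised set: it is closed and contained in the open set \<open>V\<close>, which is the
  closure-interior condition of excision.\<close>

lemma small_chains:
  assumes U: "openin X U" and V: "openin X V" and UV: "U \<union> V = topspace X"
    and c: "singular_chain p X c"
  obtains n d e where "singular_chain p (subtopology X U) d" "singular_chain p (subtopology X V) e"
    "(singular_subdivision p ^^ n) c = d + e"
proof -
  have "closedin X (topspace X - U)" using U by (simp add: closedin_def) (metis Diff_Diff_Int Int_absorb1 openin_subset)
  then have "X closure_of (topspace X - U) \<subseteq> X interior_of V"
    using V UV closure_of_closedin[of X "topspace X - U"] interior_of_openin[of X V] by auto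
  moreover have "topspace X - (topspace X - U) = U" using openin_subset[OF U] by auto
  ultimately show thesis
    using excised_chain_exists[of X "topspace X - U" V "topspace X" p c] openin_subset[OF V] c that
    by (metis subtopology_topspace)
qed

lemma homologous_iterated_subdivision:
  assumes "one_cycle X z"
  shows "one_boundary X ((singular_subdivision 1 ^^ n) z - z)"
proof -
  have "homologous_rel 1 X {} ((singular_subdivision 1 ^^ n) z) z
      \<and> singular_relcycle 1 X {} ((singular_subdivision 1 ^^ n) z)"
  proof (induction n)
    case 0
    then show ?case using assms by (simp add: one_cycle_def)
  next
    case (Suc n)
    then have "homologous_rel 1 X {} ((singular_subdivision 1 ^^ Suc n) z) ((singular_subdivision 1 ^^ n) z)"
      using homologous_rel_singular_subdivision[of 1 X "{}"] by simp
    then show ?case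
      using Suc homologous_rel_trans homologous_rel_singular_relcycle by metis
  qed
  then show ?thesis by (simp add: homologous_rel_def one_boundary_def)
qed

lemma chain_boundary_iterated_subdivision:
  assumes "singular_chain p X c"
  shows "chain_boundary p ((singular_subdivision p ^^ n) c)
       = (singular_subdivision (p - 1) ^^ n) (chain_boundary p c)
    \<and> singular_chain p X ((singular_subdivision p ^^ n) c)"
proof (induction n)
  case (Suc n)
  then show ?case
    using chain_boundary_singular_subdivision[of p X "(singular_subdivision p ^^ n) c"]
      singular_chain_singular_subdivision[of p X "(singular_subdivision p ^^ n) c"] by simp
qed (use assms in simp)

text \<open>The parts \<open>d\<close> and \<open>e\<close> need not be cycles. Their boundaries
  cancel, so \<open>chain_boundary 1 d\<close> lies in both \<open>U\<close> and \<open>V\<close>;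
  this 0-chain represents the image of \<open>z\<close> under the connecting homomorphism.\<close>

lemma one_cycle_small:
  assumes U: "openin X U" and V: "openin X V" and UV: "U \<union> V = topspace X" and z: "one_cycle X z"
  obtains d e where "singular_chain 1 (subtopology X U) d" "singular_chain 1 (subtopology X V) e"
    "chain_boundary 1 d + chain_boundary 1 e = 0" "one_boundary X (z - (d + e))"
proof -
  obtain n d e where de: "singular_chain 1 (subtopology X U) d" "singular_chain 1 (subtopology X V) e"
    "(singular_subdivision 1 ^^ n) z = d + e"
    using small_chains[OF U V UV, of 1 z] z one_cycle_iff by metis
  have *: "one_boundary X ((d + e) - z)" using homologous_iterated_subdivision[OF z, of n] de by simp
  have "one_cycle X (d + e)"
    using one_cycle_add[OF one_boundary_imp_cycle[OF *] z] by simp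
  then show thesis
    using that[OF de(1,2)] one_boundary_swap[OF *] by (simp add: one_cycle_iff chain_boundary_add)
qed

text \<open>Exactness of Mayer-Vietoris at the pair consisting of \<open>u\<close> and zero. A
  2-chain bounding \<open>u\<close> subdivides into \<open>d\<close> in \<open>U\<close> and
  \<open>e\<close> in \<open>V\<close>. The boundary of \<open>e\<close> is the subdivided
  \<open>u\<close> minus the boundary of \<open>d\<close>, hence lies in \<open>U\<close> as well,
  and it is the required \<open>c\<close>.\<close>

lemma one_boundary_push_down:
  assumes U: "openin X U" and V: "openin X V" and UV: "U \<union> V = topspace X"
    and u: "one_cycle (subtopology X U) u" and bd: "one_boundary X u"
  obtains c where "one_cycle (subtopology X (U \<inter> V)) c" "one_boundary (subtopology X U) (u - c)"
    "one_boundary (subtopology X V) c"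
proof -
  obtain b where b: "singular_chain 2 X b" "chain_boundary 2 b = u"
    using bd unfolding one_boundary_def singular_boundary by (metis Suc_1)
  obtain n d e where de: "singular_chain 2 (subtopology X U) d" "singular_chain 2 (subtopology X V) e"
    "(singular_subdivision 2 ^^ n) b = d + e"
    using small_chains[OF U V UV b(1)] .
  define c where "c = chain_boundary 2 e"
  have eq: "(singular_subdivision 1 ^^ n) u = chain_boundary 2 d + c"
    using chain_boundary_iterated_subdivision[OF b(1), of n] b(2) de(3)
    by (simp add: chain_boundary_add c_def)
  have bc: "one_boundary (subtopology X V) c"
    unfolding one_boundary_def singular_boundary c_def using de(2) by (metis Suc_1)
  have bd: "one_boundary (subtopology X U) (chain_boundary 2 d)"
    unfolding one_boundary_def singular_boundary using de(1) by (metis Suc_1)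
  have *: "one_boundary (subtopology X U) ((chain_boundary 2 d + c) - u)"
    using homologous_iterated_subdivision[OF u, of n] eq by simp
  from one_boundary_diff[OF bd *] have uc: "one_boundary (subtopology X U) (u - c)"
    by (simp add: algebra_simps)
  have "one_cycle (subtopology X U) c"
    using one_cycle_diff[OF u one_boundary_imp_cycle[OF uc]] by simp
  with one_boundary_imp_cycle[OF bc] have "one_cycle (subtopology X (U \<inter> V)) c"
    by (auto simp: one_cycle_iff singular_chain_subtopology)
  then show thesis using that uc bc by blast
qed

section \<open>Chains of dimension zero\<close>

text \<open>The sum of the coefficients, encoded as the image in the one-point space. It vanishes on
  boundaries because the two faces of a 1-simplex in a point cancel.\<close>

definition augmentation :: "'a chain \<Rightarrow> unit chain" where
  "augmentation = chain_map 0 (\<lambda>_. ())"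

lemma augmentation_boundary:
  assumes "singular_chain 1 X c" shows "augmentation (chain_boundary 1 c) = 0"
proof -
  have c: "singular_chain 1 (discrete_topology UNIV) (chain_map 1 (\<lambda>_. ()) c)"
    by (rule singular_chain_chain_map[OF assms]) simp
  have "topspace (discrete_topology UNIV) = {()}" by auto
  from chain_boundary_of_singleton[OF this c]
  show ?thesis using chain_boundary_chain_map[OF assms, of "\<lambda>_. ()"]
    by (simp add: augmentation_def)
qed

lemma augmentation_diff: "augmentation (a - b) = augmentation a - augmentation b"
  by (simp add: augmentation_def chain_map_diff)

lemma augmentation_add: "augmentation (a + b) = augmentation a + augmentation b"
  by (simp add: augmentation_def chain_map_add)

lemma augmentation_cmul: "augmentation (frag_cmul k a) = frag_cmul k (augmentation a)"
  by (simp add: augmentation_def)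

lemma augmentation_point_chain: "augmentation (point_chain a) = point_chain ()"
  by (simp add: augmentation_def point_chain_def simplex_map_def)

lemma point_chain_cmul_eq_0: "frag_cmul k (point_chain a) = 0 \<longleftrightarrow> k = 0"
  by (simp add: point_chain_def)

lemma singular_chain_point_chain: "a \<in> topspace X \<Longrightarrow> singular_chain 0 X (point_chain a)"
  by (simp add: point_chain_def singular_chain_of singular_simplex_def)

text \<open>Each point is joined to \<open>a\<close> by a path, so \<open>w\<close> is homologous to
  a multiple of \<open>a\<close>. Boundaries have augmentation zero, which identifies the multiple
  with the augmentation of \<open>w\<close>.\<close>

lemma zero_chain_path_connected:
  assumes X: "path_connected_space X" and a: "a \<in> topspace X" and w: "singular_chain 0 X w"
  obtains k b where "singular_chain 1 X b" "chain_boundary 1 b = w - frag_cmul k (point_chain a)"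
    "augmentation w = frag_cmul k (point_chain ())"
proof -
  have "\<exists>k b. singular_chain 1 X b \<and> chain_boundary 1 b = w - frag_cmul k (point_chain a)"
    using w unfolding singular_chain_def
  proof (induction w rule: frag_induction)
    case zero
    then show ?case by (intro exI[of _ 0]) auto
  next
    case (one x)
    have "singular_simplex 0 X (restrict (\<lambda>_. a) (standard_simplex 0))"
      using singular_chain_point_chain[OF a] by (simp add: point_chain_def singular_chain_of)
    with one have "homologous_rel 0 X {} (frag_of x) (point_chain a)"
      unfolding point_chain_def by (intro iso_integer_zeroth_homology_group_aux[OF X]) auto
    then obtain b where "singular_chain 1 X b" "chain_boundary 1 b = frag_of x - point_chain a"
      by (auto simp: homologous_rel_def singular_boundary)
    then show ?case by (intro exI[of _ 1] exI[of _ b]) (auto simp: singular_chain_def)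
  next
    case (diff u v)
    then obtain k b l c where "singular_chain 1 X b" "chain_boundary 1 b = u - frag_cmul k (point_chain a)"
      "singular_chain 1 X c" "chain_boundary 1 c = v - frag_cmul l (point_chain a)"
      by (auto simp: singular_chain_def)
    then have "singular_chain 1 X (b - c)"
      "chain_boundary 1 (b - c) = u - v - frag_cmul (k - l) (point_chain a)"
      by (auto simp: singular_chain_diff chain_boundary_diff frag_cmul_diff_distrib algebra_simps)
    then show ?case unfolding singular_chain_def by blast
  qed
  then obtain k b where b: "singular_chain 1 X b" "chain_boundary 1 b = w - frag_cmul k (point_chain a)"
    by blast
  from augmentation_boundary[OF b(1)] have "augmentation w = frag_cmul k (point_chain ())"
    unfolding b(2) augmentation_diff augmentation_cmul augmentation_point_chain by (rule eq_iff_diff_eq_0[THEN iffD2])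
  with b that show thesis by blast
qed

lemma zero_chain_bounds:
  assumes X: "path_connected_space X" and w: "singular_chain 0 X w" and "augmentation w = 0"
  obtains b where "singular_chain 1 X b" "chain_boundary 1 b = w"
proof (cases "topspace X = {}")
  case True
  then have "w = 0" using w by (simp add: singular_chain_empty)
  then show thesis using that[of 0] by simp
next
  case False
  then obtain a where "a \<in> topspace X" by blast
  from zero_chain_path_connected[OF X this w] obtain k b where
    "singular_chain 1 X b" "chain_boundary 1 b = w - frag_cmul k (point_chain a)" "k = 0"
    using assms(3) point_chain_cmul_eq_0 by metis
  then show thesis using that[of b] by simp
qed

text \<open>The common boundary of the two parts is a 0-chain of augmentation zero in the
  path-connected intersection, hence the boundary of some \<open>b\<close> there. Moving
  \<open>b\<close> from \<open>d\<close> to \<open>e\<close> turns both parts into cycles without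
  changing their sum.\<close>

lemma Mayer_Vietoris_onto:
  assumes U: "openin X U" and V: "openin X V" and UV: "U \<union> V = topspace X"
    and pc: "path_connected_space (subtopology X (U \<inter> V))" and z: "one_cycle X z"
  obtains u v where "one_cycle (subtopology X U) u" "one_cycle (subtopology X V) v"
    "one_boundary X (z - (u + v))"
proof -
  obtain d e where d: "singular_chain 1 (subtopology X U) d" and e: "singular_chain 1 (subtopology X V) e"
    and de: "chain_boundary 1 d + chain_boundary 1 e = 0" and z: "one_boundary X (z - (d + e))"
    using one_cycle_small[OF U V UV z] .
  have "chain_boundary 1 d = - chain_boundary 1 e" using de by (simp add: add_eq_0_iff)
  then have "singular_chain 0 (subtopology X (U \<inter> V)) (chain_boundary 1 d)"
    using singular_chain_boundary[OF d] singular_chain_boundary[OF e]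
    by (auto simp: singular_chain_subtopology)
  from zero_chain_bounds[OF pc this augmentation_boundary[OF d]]
  obtain b where b: "singular_chain 1 (subtopology X (U \<inter> V)) b" "chain_boundary 1 b = chain_boundary 1 d" .
  have "one_cycle (subtopology X U) (d - b)" "one_cycle (subtopology X V) (e + b)"
    using d e b de singular_chain_mono[OF b(1), of U] singular_chain_mono[OF b(1), of V]
    by (auto simp: one_cycle_iff singular_chain_diff singular_chain_add chain_boundary_diff
        chain_boundary_add algebra_simps)
  moreover have "d - b + (e + b) = d + e" by simp
  ultimately show thesis using that z by metis
qed

text \<open>The image of a simplex is connected, so it lies entirely in one of two disjoint open
  sets.\<close>

lemma singular_chain_split:
  assumes "singular_chain p (subtopology X (A \<union> B)) c" "openin X A" "openin X B" "A \<inter> B = {}"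
  obtains a b where "singular_chain p (subtopology X A) a" "singular_chain p (subtopology X B) b" "c = a + b"
proof -
  have "Poly_Mapping.keys c \<subseteq> singular_simplex_set p (subtopology X A) \<union> singular_simplex_set p (subtopology X B)"
  proof
    fix f assume "f \<in> Poly_Mapping.keys c"
    then have f: "singular_simplex p (subtopology X (A \<union> B)) f"
      using assms(1) by (auto simp: singular_chain_def)
    then have fX: "singular_simplex p X f" and im: "f ` standard_simplex p \<subseteq> A \<union> B"
      by (auto simp: singular_simplex_subtopology)
    have "connectedin X (f ` standard_simplex p)"
      using connectedin_continuous_map_image[of "subtopology (powertop_real UNIV) (standard_simplex p)" X f "standard_simplex p"]
        connectedin_standard_simplex[of p] fX
      by (auto simp: singular_simplex_def connectedin_subtopology)
    then have "f ` standard_simplex p \<subseteq> A \<or> f ` standard_simplex p \<subseteq> B"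
      using im assms(2-4) unfolding connectedin by blast
    then show "f \<in> singular_simplex_set p (subtopology X A) \<union> singular_simplex_set p (subtopology X B)"
      using fX by (auto simp: singular_simplex_subtopology)
  qed
  then show thesis
    using that unfolding singular_chain_def by (metis frag_split)
qed

section \<open>The circle and an explicit generator of its homology\<close>

section \<open>The circle\<close>

text \<open>For \<open>k = 0\<close> the set is an open hemisphere, for \<open>k = - 1\<close> the
  sphere without the antipode of \<open>b\<close>. Both contract to \<open>b\<close> along straight
  segments projected back to the sphere.\<close>

lemma contractible_sphere_cap:
  fixes b :: "'a::euclidean_space"
  assumes b: "norm b = 1" and k: "k = 0 \<or> k = - 1"
  shows "contractible {w. norm w = 1 \<and> w \<bullet> b > k}" (is "contractible ?S")
proof -
  let ?u = "\<lambda>t w. (1 - t) *\<^sub>R w + t *\<^sub>R b"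
  have bb: "b \<bullet> b = 1" using b by (simp add: norm_eq_1)
  have ne: "?u t w \<noteq> 0" and cap: "sgn (?u t w) \<bullet> b > k" if t: "0 \<le> t" "t \<le> 1" and w: "w \<in> ?S" for t w
  proof -
    have ip: "?u t w \<bullet> b = (1 - t) * (w \<bullet> b) + t" by (simp add: inner_add_left bb)
    \<comment> \<open>The segment from \<open>w\<close> to \<open>b\<close> misses the closed ray
      through \<open>- b\<close>. The case \<open>s = 0\<close> gives that the projection to the
      sphere is defined; \<open>s = norm (?u t w)\<close> gives that it avoids
      \<open>- b\<close>.\<close>
    have *: "\<not> (s \<ge> 0 \<and> ?u t w = - s *\<^sub>R b)" for s
    proof
      assume s: "s \<ge> 0 \<and> ?u t w = - s *\<^sub>R b"
      then have e: "(1 - t) *\<^sub>R w = - (s + t) *\<^sub>R b"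
        by (metis (no_types, lifting) add_diff_cancel_right' minus_add_distrib diff_conv_add_uminus scaleR_left_distrib scaleR_minus_left)
      then have "norm ((1 - t) *\<^sub>R w) = norm ((s + t) *\<^sub>R b)"
        by (metis norm_minus_cancel scaleR_minus_left)
      then have "1 - t = s + t" using t s w b by simp
      with e s t have "(1 - t) *\<^sub>R w = (1 - t) *\<^sub>R (- b)" "1 - t \<noteq> 0"
        by (metis scaleR_minus_left scaleR_minus_right, linarith)
      then have "w = - b" by (metis scaleR_cancel_left)
      then show False using w bb k by auto
    qed
    show n0: "?u t w \<noteq> 0" using *[of 0] by simp
    show "sgn (?u t w) \<bullet> b > k"
    proof (cases "k = 0")
      case True
      then have "?u t w \<bullet> b > 0" unfolding ip using w t
        by (cases "t = 1") (auto intro!: add_pos_nonneg)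
      then show ?thesis using True n0 by (simp add: sgn_div_norm)
    next
      case False
      have "norm (sgn (?u t w)) = 1" using n0 by (simp add: norm_sgn)
      then have "sgn (?u t w) \<bullet> (- b) \<le> 1" "sgn (?u t w) \<bullet> (- b) = 1 \<longleftrightarrow> sgn (?u t w) = - b"
        using norm_cauchy_schwarz[of "sgn (?u t w)" "- b"] norm_cauchy_schwarz_eq[of "sgn (?u t w)" "- b"] b
        by auto
      moreover have "sgn (?u t w) \<noteq> - b"
      proof
        assume "sgn (?u t w) = - b"
        moreover have "?u t w = norm (?u t w) *\<^sub>R sgn (?u t w)" using n0 by (simp add: sgn_div_norm)
        ultimately have "?u t w = - norm (?u t w) *\<^sub>R b" by (metis scaleR_minus_left scaleR_minus_right)
        then show False using *[of "norm (?u t w)"] by simp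
      qed
      ultimately show ?thesis using False k by auto
    qed
  qed
  have "homotopic_with (\<lambda>_. True) (top_of_set ?S) (top_of_set ?S) id (\<lambda>_. b)"
  proof (subst homotopic_with)
    let ?h = "\<lambda>(t, w). sgn (?u t w)"
    have "continuous_on ({0..1} \<times> ?S) ?h"
      unfolding case_prod_unfold using ne by (intro continuous_intros) auto
    moreover have "?h ` ({0..1} \<times> ?S) \<subseteq> ?S"
      using ne cap by (auto simp: norm_sgn)
    ultimately have "continuous_map (prod_topology (top_of_set {0..1}) (top_of_set ?S)) (top_of_set ?S) ?h"
      by auto
    then show "\<exists>h. continuous_map (prod_topology (top_of_set {0..1::real}) (top_of_set ?S)) (top_of_set ?S) h \<and>
       (\<forall>x\<in>topspace (top_of_set ?S). h (0, x) = id x) \<and>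
       (\<forall>x\<in>topspace (top_of_set ?S). h (1, x) = b) \<and> (\<forall>t\<in>{0..1::real}. True)"
      using b by - (rule exI[of _ ?h], auto simp: sgn_div_norm)
  qed simp
  then show ?thesis by (auto simp: contractible_def)
qed

abbreviation circle :: "complex topology" where
  "circle \<equiv> top_of_set (sphere 0 1)"

definition circle_loop :: "real \<Rightarrow> complex" where
  "circle_loop t = cis (2 * pi * t)"

lemma continuous_circle_loop: "continuous_on S circle_loop"
  unfolding circle_loop_def[abs_def] by (intro continuous_intros)

lemma norm_circle_loop [simp]: "norm (circle_loop t) = 1"
  by (simp add: circle_loop_def)

lemma one_cycle_circle_loop: "one_cycle circle (path_chain circle_loop)"
  by (rule one_cycle_path_chain) (auto simp: continuous_circle_loop, simp add: circle_loop_def)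

lemma openin_sphere_cap:
  fixes b :: "'a::euclidean_space"
  shows "openin (top_of_set (sphere 0 1)) {w. norm w = 1 \<and> w \<bullet> b > k}"
proof -
  have "{w. norm w = 1 \<and> w \<bullet> b > k} = sphere 0 1 \<inter> {w. w \<bullet> b > k}" by auto
  moreover have "open {w. w \<bullet> b > k}"
    using open_halfspace_gt[of k b] by (simp add: inner_commute)
  ultimately show ?thesis by (simp add: openin_open_Int)
qed

text \<open>\<open>U\<close> and \<open>V\<close> omit the points \<open>- \<i>\<close> and
  \<open>\<i>\<close>; they meet in the right half \<open>A\<close> and the left half
  \<open>B\<close>. The boundary of \<open>d\<close> splits into a part in \<open>A\<close>,
  homologous to \<open>k\<close> times the point 1, and a part in \<open>B\<close>, homologous to
  \<open>- k\<close> times the point -1, as the total augmentation is zero. Completing by half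
  circles then gives cycles in the contractible sets \<open>U\<close> and \<open>V\<close>.\<close>

lemma circle_cycle_multiple:
  assumes z: "one_cycle circle z"
  obtains k where "one_boundary circle (z - frag_cmul k (path_chain circle_loop))"
proof -
  let ?cap = "\<lambda>b k. {w::complex. norm w = 1 \<and> w \<bullet> b > k}"
  define U V where "U = ?cap \<i> (-1)" and "V = ?cap (-\<i>) (-1)"
  define A B where "A = ?cap 1 0" and "B = ?cap (-1) 0"
  have sub: "subtopology circle S = top_of_set S" if "S \<subseteq> sphere 0 1" for S :: "complex set"
    using that by (simp add: subtopology_subtopology Int_absorb1)
  have subs: "U \<subseteq> sphere 0 1" "V \<subseteq> sphere 0 1" "A \<subseteq> sphere 0 1" "B \<subseteq> sphere 0 1"
    by (auto simp: U_def V_def A_def B_def)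
  have op: "openin circle U" "openin circle V" "openin circle A" "openin circle B"
    unfolding U_def V_def A_def B_def by (rule openin_sphere_cap)+
  have con: "contractible U" "contractible V" "contractible A" "contractible B"
    unfolding U_def V_def A_def B_def by (rule contractible_sphere_cap; simp)+
  have sq: "norm w = 1 \<longleftrightarrow> (Re w)\<^sup>2 + (Im w)\<^sup>2 = 1" for w :: complex
    by (simp add: cmod_def)
  have UV: "U \<union> V = topspace circle" and AB: "U \<inter> V = A \<union> B"
  proof -
    show "U \<union> V = topspace circle"
      by (auto simp: U_def V_def inner_complex_def)
    have "(- 1 < Im w \<and> - 1 < - Im w) = (0 < Re w \<or> Re w < 0)" if w: "norm w = 1" for w
    proof -
      have "(- 1 < Im w \<and> - 1 < - Im w) \<longleftrightarrow> (Im w)\<^sup>2 < 1"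
        by (auto simp: abs_square_less_1 abs_less_iff)
      also have "\<dots> \<longleftrightarrow> (Re w)\<^sup>2 > 0" using w unfolding sq by linarith
      finally show ?thesis by (auto simp: neq_iff)
    qed
    then show "U \<inter> V = A \<union> B"
      unfolding U_def V_def A_def B_def by (auto simp: inner_complex_def)
  qed
  obtain d e where d: "singular_chain 1 (subtopology circle U) d" and e: "singular_chain 1 (subtopology circle V) e"
    and de: "chain_boundary 1 d + chain_boundary 1 e = 0" and zde: "one_boundary circle (z - (d + e))"
    using one_cycle_small[OF op(1,2) UV z] .
  have bde: "chain_boundary 1 d = - chain_boundary 1 e" using de by (simp add: add_eq_0_iff)
  then have "singular_chain 0 (subtopology circle (A \<union> B)) (chain_boundary 1 d)"
    unfolding AB[symmetric] using singular_chain_boundary[OF d] singular_chain_boundary[OF e]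
    by (auto simp: singular_chain_subtopology)
  then obtain a b where a: "singular_chain 0 (subtopology circle A) a"
    and b: "singular_chain 0 (subtopology circle B) b" and ab: "chain_boundary 1 d = a + b"
    by (rule singular_chain_split[OF _ op(3,4)]) (auto simp: A_def B_def)
  have pc: "path_connected_space (subtopology circle A)" "path_connected_space (subtopology circle B)"
    using con(3,4) by (auto simp: sub subs intro!: contractible_imp_path_connected)
  obtain k x where x: "singular_chain 1 (subtopology circle A) x"
      "chain_boundary 1 x = a - frag_cmul k (point_chain 1)" "augmentation a = frag_cmul k (point_chain ())"
    by (rule zero_chain_path_connected[OF pc(1) _ a, of 1]) (auto simp: A_def)
  obtain l y where y: "singular_chain 1 (subtopology circle B) y"
      "chain_boundary 1 y = b - frag_cmul l (point_chain (-1))" "augmentation b = frag_cmul l (point_chain ())"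
    by (rule zero_chain_path_connected[OF pc(2) _ b, of "-1"]) (auto simp: B_def)
  have "frag_cmul (k + l) (point_chain ()) = 0"
    using augmentation_boundary[OF d] unfolding ab augmentation_add x y frag_cmul_distrib .
  then have l: "l = - k" unfolding point_chain_cmul_eq_0 by simp
  define up lo where "up = path_chain (\<lambda>t. circle_loop (t/2))" and "lo = path_chain (\<lambda>t. circle_loop (1/2 + t/2))"
  have up: "singular_chain 1 (subtopology circle U) up"
    unfolding up_def
  proof (rule singular_chain_path_chain)
    have "-1 < sin (pi * t)" if "0 \<le> t" "t \<le> 1" for t
    proof -
      have "0 \<le> sin (pi * t)" using that mult_left_le[of t pi] by (intro sin_ge_zero) simp_all
      then show ?thesis by linarith
    qed
    then show "continuous_map (top_of_set {0..1}) (subtopology circle U) (\<lambda>t. circle_loop (t/2))"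
      unfolding sub[OF subs(1)]
      by (auto simp: sub subs U_def inner_complex_def circle_loop_def intro!: continuous_intros)
  qed
  have lo: "singular_chain 1 (subtopology circle V) lo"
    unfolding lo_def
  proof (rule singular_chain_path_chain)
    have "-1 < - sin (pi + pi * t)" if "0 \<le> t" "t \<le> 1" for t
    proof -
      have "0 \<le> sin (pi * t)" using that mult_left_le[of t pi] by (intro sin_ge_zero) simp_all
      then show ?thesis by (simp add: sin_add)
    qed
    moreover have "cis (2 * pi * (1/2 + t/2)) = cis (pi + pi * t)" for t
      by (simp add: algebra_simps)
    ultimately show "continuous_map (top_of_set {0..1}) (subtopology circle V) (\<lambda>t. circle_loop (1/2 + t/2))"
      unfolding sub[OF subs(2)]
      by (auto simp: sub subs V_def inner_complex_def circle_loop_def intro!: continuous_intros)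
  qed
  have bup: "chain_boundary 1 up = point_chain (-1) - point_chain 1"
    unfolding up_def chain_boundary_path_chain by (simp add: circle_loop_def)
  have blo: "chain_boundary 1 lo = point_chain 1 - point_chain (-1)"
    unfolding lo_def chain_boundary_path_chain by (simp add: circle_loop_def)
  have AUV: "A \<subseteq> U" "A \<subseteq> V" "B \<subseteq> U" "B \<subseteq> V" using AB by auto
  \<comment> \<open>\<open>x\<close> and \<open>y\<close> concentrate the boundary of
    \<open>d\<close> at 1 and -1. The upper half circle runs from 1 to -1 and cancels it in
    \<open>U\<close>, the lower one runs back and does so in \<open>V\<close>. The two halves
    together make up \<open>k\<close> full loops, whence the multiple \<open>- k\<close> for
    \<open>z\<close>.\<close>
  define d' e' where "d' = d - x - y + frag_cmul k up" and "e' = e + x + y + frag_cmul k lo"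
  have "one_cycle (subtopology circle U) d'"
    unfolding one_cycle_iff d'_def chain_boundary_add chain_boundary_diff chain_boundary_cmul ab x(2) y(2) bup l
    using singular_chain_mono[OF x(1) AUV(1)] singular_chain_mono[OF y(1) AUV(3)] d up
    by (intro conjI singular_chain_add singular_chain_diff singular_chain_cmul poly_mapping_eqI)
      (auto simp: lookup_add lookup_minus algebra_simps)
  then have d': "one_boundary circle d'"
    using con by - (rule one_boundary_subtopology[of _ U], rule one_boundary_contractible, simp_all add: sub subs)
  have bde': "chain_boundary 1 e = - (a + b)" using bde unfolding ab by simp
  have "one_cycle (subtopology circle V) e'"
    unfolding one_cycle_iff e'_def chain_boundary_add chain_boundary_diff chain_boundary_cmul x(2) y(2) blo l bde'
    using singular_chain_mono[OF x(1) AUV(2)] singular_chain_mono[OF y(1) AUV(4)] e lo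
    by (intro conjI singular_chain_add singular_chain_diff singular_chain_cmul poly_mapping_eqI)
      (auto simp: lookup_add lookup_minus algebra_simps)
  then have e': "one_boundary circle e'"
    using con by - (rule one_boundary_subtopology[of _ V], rule one_boundary_contractible, simp_all add: sub subs)
  have h: "one_boundary circle (path_chain circle_loop - (up + lo))"
    unfolding up_def lo_def by (rule path_chain_halves) (auto simp: continuous_circle_loop)
  have "one_boundary circle ((z - (d + e)) + (d' + e') + frag_cmul k (path_chain circle_loop - (up + lo)))"
    by (intro one_boundary_add zde d' e' one_boundary_cmul h)
  moreover have "(z - (d + e)) + (d' + e') + frag_cmul k (path_chain circle_loop - (up + lo))
      = z - frag_cmul (- k) (path_chain circle_loop)"
    unfolding d'_def e'_def
    by (intro poly_mapping_eqI) (simp add: lookup_add lookup_minus algebra_simps)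
  ultimately show thesis using that by metis
qed

section \<open>Classes in the first homology group\<close>

definition hclass :: "'a topology \<Rightarrow> 'a chain \<Rightarrow> 'a chain set" where
  "hclass X z = homologous_rel_set 1 X {} z"

lemma hclass_eq_iff: "hclass X a = hclass X b \<longleftrightarrow> one_boundary X (a - b)"
  unfolding hclass_def homologous_rel_set_eq by (simp add: one_boundary_def homologous_rel_def)

lemma carrier_homology_group_1: "carrier (homology_group 1 X) = hclass X ` Collect (one_cycle X)"
  using carrier_relative_homology_group[of 1 X "{}"] by (simp add: hclass_def image_def one_cycle_def)

lemma hclass_in_carrier: "one_cycle X a \<Longrightarrow> hclass X a \<in> carrier (homology_group 1 X)"
  by (simp add: carrier_homology_group_1)

lemma hclass_one: "\<one>\<^bsub>homology_group 1 X\<^esub> = hclass X 0"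
  using one_relative_homology_group[of 1 X "{}"] singular_relboundary_minus[of 1 X "{}"]
  by (simp add: hclass_def homologous_rel_def)

lemma hclass_mult: "hclass X a \<otimes>\<^bsub>homology_group 1 X\<^esub> hclass X b = hclass X (a + b)"
proof -
  have "(\<Union>r\<in>hclass X a. \<Union>s\<in>hclass X b. {r + s}) = hclass X (a + b)"
  proof (intro equalityI subsetI)
    fix c assume "c \<in> hclass X (a + b)"
    then have "c - b \<in> hclass X a" "b \<in> hclass X b"
      by (auto simp: hclass_def homologous_rel_def algebra_simps)
    then show "c \<in> (\<Union>r\<in>hclass X a. \<Union>s\<in>hclass X b. {r + s})" by force
  qed (auto simp: hclass_def homologous_rel_add)
  then show ?thesis using mult_relative_homology_group[of 1 X "{}"] by simp
qed

lemma hclass_int_pow: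
  assumes "one_cycle X a"
  shows "hclass X a [^]\<^bsub>homology_group 1 X\<^esub> (k::int) = hclass X (frag_cmul k a)"
proof -
  interpret group "homology_group 1 X" by simp
  note a = hclass_in_carrier[OF assms]
  show ?thesis
  proof (induction k rule: int_induct[where k=0])
    case base
    then show ?case using hclass_one by simp
  next
    case (step1 i)
    then show ?case
      using int_pow_mult[OF a, of i 1] a by (simp add: hclass_mult frag_cmul_distrib int_pow_1)
  next
    case (step2 i)
    have "hclass X (frag_cmul (i - 1) a) \<otimes>\<^bsub>homology_group 1 X\<^esub> hclass X a
        = hclass X a [^]\<^bsub>homology_group 1 X\<^esub> (i - 1) \<otimes>\<^bsub>homology_group 1 X\<^esub> hclass X a"
      using int_pow_mult[OF a, of "i - 1" 1] a step2
      by (simp add: hclass_mult frag_cmul_diff_distrib int_pow_1)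
    then show ?case
      using right_cancel[of "hclass X a"] a hclass_in_carrier[OF one_cycle_cmul[OF assms]]
        int_pow_closed by metis
  qed
qed

section \<open>The winding number of a cycle in the circle\<close>

text \<open>Points of \<open>nsphere 1\<close> are real sequences that vanish beyond index 1, so the
  first two coordinates identify it with the complex unit circle. In degree 1 reduced and unreduced
  homology agree.\<close>

lemma circle_homology: "homology_group 1 circle \<cong> integer_group"
proof -
  let ?f = "\<lambda>x::nat \<Rightarrow> real. Complex (x 0) (x 1)"
  let ?g = "\<lambda>w i. if i = 0 then Re w else if i = 1 then Im w else (0::real)"
  have "continuous_map euclidean euclidean (\<lambda>(a, b). Complex a b)"
    by (simp add: Complex_eq case_prod_unfold) (intro continuous_intros)
  moreover have "continuous_map (nsphere 1) (prod_topology euclideanreal euclideanreal) (\<lambda>x. (x 0, x 1))"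
    by (intro continuous_map_pairedI continuous_map_nsphere_projection)
  ultimately have "continuous_map (nsphere 1) euclidean ((\<lambda>(a, b). Complex a b) \<circ> (\<lambda>x. (x 0, x 1)))"
    unfolding prod_topology_euclidean by (rule continuous_map_compose[rotated])
  then have "continuous_map (nsphere 1) circle ?f"
    by (auto simp: continuous_map_in_subtopology o_def nsphere cmod_def)
  moreover have "continuous_map circle (powertop_real UNIV) ?g"
    unfolding continuous_map_componentwise_UNIV
  proof
    show "continuous_map circle euclideanreal (\<lambda>x. ?g x k)" for k
      by (cases "k = 0"; cases "k = 1") (auto intro!: continuous_intros)
  qed
  then have "continuous_map circle (nsphere 1) ?g"
    by (auto simp: nsphere continuous_map_in_subtopology cmod_def)
  ultimately have "homeomorphic_maps (nsphere 1) circle ?f ?g"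
    unfolding homeomorphic_maps_def by (auto simp: nsphere fun_eq_iff)
  then have "circle homeomorphic_space nsphere 1"
    by (meson homeomorphic_space_def homeomorphic_space_sym)
  then have "homology_group 1 circle \<cong> homology_group 1 (nsphere 1)"
    by (rule homeomorphic_space_imp_isomorphic_homology_groups)
  also have "homology_group 1 (nsphere 1) \<cong> integer_group"
    using reduced_homology_group_nsphere(1)[of 1] un_reduced_homology_group[of 1 "nsphere 1"] by simp
  finally show ?thesis .
qed

text \<open>An isomorphism with the integers sends the standard loop to some \<open>e\<close>. As
  the loop generates, \<open>e\<close> divides 1, so \<open>e = 1\<close> or \<open>e = - 1\<close>,
  and multiplying the isomorphism by \<open>e\<close> normalises the value on the loop to 1.\<close>

lemma winding_number_hom:
  obtains W :: "complex chain \<Rightarrow> int" where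
    "\<And>a b. one_cycle circle a \<Longrightarrow> one_cycle circle b \<Longrightarrow> W (a + b) = W a + W b"
    "\<And>a k. one_cycle circle a \<Longrightarrow> W (frag_cmul k a) = k * W a"
    "\<And>a. one_boundary circle a \<Longrightarrow> W a = 0"
    "W (path_chain circle_loop) = 1"
proof -
  let ?H = "homology_group 1 circle"
  obtain \<phi> where phi: "\<phi> \<in> iso ?H integer_group"
    using circle_homology by (auto simp: is_iso_def)
  then have hom: "\<phi> \<in> hom ?H integer_group" and bij: "bij_betw \<phi> (carrier ?H) UNIV"
    by (auto simp: iso_def)
  interpret group_hom ?H integer_group \<phi>
    using hom by (simp add: group_hom_def group_hom_axioms_def)
  define e where "e = \<phi> (hclass circle (path_chain circle_loop))"
  define W where "W a = e * \<phi> (hclass circle a)" for a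
  have add: "\<phi> (hclass circle (a + b)) = \<phi> (hclass circle a) + \<phi> (hclass circle b)"
    if "one_cycle circle a" "one_cycle circle b" for a b
    using hom_mult[OF hclass_in_carrier[OF that(1)] hclass_in_carrier[OF that(2)]]
    by (simp add: hclass_mult)
  have cmul: "\<phi> (hclass circle (frag_cmul k a)) = k * \<phi> (hclass circle a)" if "one_cycle circle a" for a k
    using hom_int_pow[OF hclass_in_carrier[OF that], of k]
    by (simp add: hclass_int_pow[OF that])
  have bd: "\<phi> (hclass circle a) = 0" if "one_boundary circle a" for a
  proof -
    have "hclass circle a = hclass circle 0" using that by (simp add: hclass_eq_iff)
    then show ?thesis using hom_one by (simp add: hclass_one)
  qed
  have "1 \<in> \<phi> ` carrier ?H" using bij by (simp add: bij_betw_def)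
  then obtain z where z: "one_cycle circle z" "\<phi> (hclass circle z) = 1"
    by (auto simp: carrier_homology_group_1)
  obtain k where "one_boundary circle (z - frag_cmul k (path_chain circle_loop))"
    using circle_cycle_multiple[OF z(1)] .
  then have "hclass circle z = hclass circle (frag_cmul k (path_chain circle_loop))"
    by (simp add: hclass_eq_iff)
  then have "k * e = 1" using z cmul[OF one_cycle_circle_loop] by (simp add: e_def)
  then have "e * e = 1" by (metis zmult_eq_1_iff mult_1 mult_minus1 minus_minus)
  then show thesis
    using that[of W] add cmul bd by (simp add: W_def algebra_simps e_def[symmetric])
qed

section \<open>Cycles in the punctured torus\<close>

section \<open>The punctured torus\<close>

text \<open>Sending \<open>z\<close> to the circle by \<open>g\<close> and back by \<open>f\<close>
  changes it only by a boundary, so \<open>circle_cycle_multiple\<close> carries over to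
  \<open>Y\<close>.\<close>

lemma cycle_multiple_of_circle:
  assumes f: "continuous_map circle Y f" and g: "continuous_map Y circle g"
    and h: "homotopic_with (\<lambda>_. True) Y Y id (f \<circ> g)" and z: "one_cycle Y z"
  obtains k where "one_boundary Y (z - frag_cmul k (path_chain (f \<circ> circle_loop)))"
proof -
  obtain k where "one_boundary circle (push g z - frag_cmul k (path_chain circle_loop))"
    using circle_cycle_multiple[OF one_cycle_push[OF z g]] .
  from one_boundary_push[OF this f]
  have 1: "one_boundary Y (push (f \<circ> g) z - frag_cmul k (path_chain (f \<circ> circle_loop)))"
    by (simp add: push_diff push_cmul push_push push_path_chain)
  have "one_boundary Y (z - push (f \<circ> g) z)"
    using one_boundary_homotopic[OF h z] push_ident[OF z, of id] by simp
  from one_boundary_trans[OF this 1] show thesis by (rule that)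
qed

lemma cycle_multiple_Times:
  fixes C :: "complex set"
  assumes C: "contractible C" "b \<in> C"
  shows "one_cycle (top_of_set (sphere 0 1 \<times> C)) z \<Longrightarrow>
      \<exists>k. one_boundary (top_of_set (sphere 0 1 \<times> C)) (z - frag_cmul k (path_chain (\<lambda>t. (circle_loop t, b))))"
    and "one_cycle (top_of_set (C \<times> sphere 0 1)) z \<Longrightarrow>
      \<exists>k. one_boundary (top_of_set (C \<times> sphere 0 1)) (z - frag_cmul k (path_chain (\<lambda>t. (b, circle_loop t))))"
proof -
  have h: "homotopic_with (\<lambda>_. True) (top_of_set C) (top_of_set C) id (\<lambda>_. b)"
    using C contractible_space_alt[of "top_of_set C"] by simp
  have i: "homotopic_with (\<lambda>_. True) circle circle id id" by simp
  have h1: "homotopic_with (\<lambda>_. True) (top_of_set (sphere (0::complex) 1 \<times> C)) (top_of_set (sphere 0 1 \<times> C))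
      id ((\<lambda>w. (w, b)) \<circ> fst)"
    using homotopic_with_prod_topology[OF i h, of "\<lambda>_. True"] by (simp add: id_def o_def)
  show "\<exists>k. one_boundary (top_of_set (sphere 0 1 \<times> C)) (z - frag_cmul k (path_chain (\<lambda>t. (circle_loop t, b))))"
    if z: "one_cycle (top_of_set (sphere 0 1 \<times> C)) z"
  proof -
    have "continuous_map circle (top_of_set (sphere 0 1 \<times> C)) (\<lambda>w. (w, b))"
      using C(2) by (auto intro!: continuous_intros)
    moreover have "continuous_map (top_of_set (sphere (0::complex) 1 \<times> C)) circle fst"
      by (auto intro!: continuous_intros)
    ultimately obtain k where "one_boundary (top_of_set (sphere 0 1 \<times> C))
        (z - frag_cmul k (path_chain ((\<lambda>w. (w, b)) \<circ> circle_loop)))"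
      using cycle_multiple_of_circle[OF _ _ h1 z] by metis
    then show ?thesis by (auto simp: o_def)
  qed
  have h2: "homotopic_with (\<lambda>_. True) (top_of_set (C \<times> sphere (0::complex) 1)) (top_of_set (C \<times> sphere 0 1))
      id ((\<lambda>w. (b, w)) \<circ> snd)"
    using homotopic_with_prod_topology[OF h i, of "\<lambda>_. True"] by (simp add: id_def o_def)
  show "\<exists>k. one_boundary (top_of_set (C \<times> sphere 0 1)) (z - frag_cmul k (path_chain (\<lambda>t. (b, circle_loop t))))"
    if z: "one_cycle (top_of_set (C \<times> sphere 0 1)) z"
  proof -
    have "continuous_map circle (top_of_set (C \<times> sphere 0 1)) (\<lambda>w. (b, w))"
      using C(2) by (auto intro!: continuous_intros)
    moreover have "continuous_map (top_of_set (C \<times> sphere (0::complex) 1)) circle snd"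
      by (auto intro!: continuous_intros)
    ultimately obtain k where "one_boundary (top_of_set (C \<times> sphere 0 1))
        (z - frag_cmul k (path_chain ((\<lambda>w. (b, w)) \<circ> circle_loop)))"
      using cycle_multiple_of_circle[OF _ _ h2 z] by metis
    then show ?thesis by (auto simp: o_def)
  qed
qed

text \<open>Two levels occur, for a unit vector \<open>b\<close>: \<open>cap b 0\<close> is the open
  half circle centred at \<open>b\<close>, and \<open>cap b (-1)\<close> is the circle without
  \<open>- b\<close>.\<close>

definition cap :: "complex \<Rightarrow> real \<Rightarrow> complex set" where
  "cap b k = {w. norm w = 1 \<and> w \<bullet> b > k}"

lemma contractible_cap: "norm b = 1 \<Longrightarrow> k = 0 \<or> k = - 1 \<Longrightarrow> contractible (cap b k)"
  unfolding cap_def by (rule contractible_sphere_cap)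

lemma openin_cap: "openin circle (cap b k)"
  unfolding cap_def by (rule openin_sphere_cap)

lemma cap_subset: "cap b k \<subseteq> sphere 0 1"
  by (auto simp: cap_def)

lemma alpha_eq: "alpha = (\<lambda>t. (circle_loop t, 1))"
  by (simp add: fun_eq_iff alpha_def torus_pt_def circle_loop_def)

lemma beta_eq: "beta = (\<lambda>t. (1, circle_loop t))"
  by (simp add: fun_eq_iff beta_def torus_pt_def circle_loop_def)

lemma gamma_eq: "gamma = (\<lambda>t. (- 1, circle_loop t))"
  by (simp add: fun_eq_iff gamma_def torus_pt_def circle_loop_def)

lemma punctures_eq: "punctures = {(\<i>, - 1), (- \<i>, - 1)}"
proof -
  have "2 * pi * (1/4) = pi / 2" "2 * pi * (3/4) = 3/2 * pi" by simp_all
  then have "cis (2 * pi * (1/4)) = \<i>" "cis (2 * pi * (3/4)) = - \<i>"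
    by (metis cis_pi_half, metis (no_types) complex_eq_iff cis.sel cos_3over2_pi sin_3over2_pi minus_complex.sel
        uminus_complex.sel imaginary_unit.sel minus_zero)
  then show ?thesis by (simp add: punctures_def torus_pt_def)
qed

lemma unit_complex_cases:
  assumes "norm (w::complex) = 1"
  shows "Re w = 0 \<longleftrightarrow> w = \<i> \<or> w = - \<i>" "Re w = - 1 \<longleftrightarrow> w = - 1"
proof -
  have e: "(Re w)\<^sup>2 + (Im w)\<^sup>2 = 1" using assms by (simp add: cmod_def)
  then show "Re w = 0 \<longleftrightarrow> w = \<i> \<or> w = - \<i>"
    by (auto simp: complex_eq_iff power2_eq_1_iff)
  show "Re w = - 1 \<longleftrightarrow> w = - 1" using e by (auto simp: complex_eq_iff)
qed

lemma unit_complex_Re_bounds: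
  assumes "norm (w::complex) = 1" shows "-1 \<le> Re w" "Re w \<le> 1"
  using abs_Re_le_cmod[of w] assms by auto

text \<open>The punctured torus is the union of an annulus around \<^term>\<open>alpha\<close> and of disjoint annuli
  around \<^term>\<open>beta\<close> and \<^term>\<open>gamma\<close>, each of which meets the first one in a disc.\<close>

lemma torus_cover:
  "sphere 0 1 \<times> cap 1 (-1) \<union> (cap 1 0 \<times> sphere 0 1 \<union> cap (-1) 0 \<times> sphere 0 1) = torus - punctures"
  "(sphere 0 1 \<times> cap 1 (-1)) \<inter> (cap 1 0 \<times> sphere 0 1 \<union> cap (-1) 0 \<times> sphere 0 1)
    = cap 1 0 \<times> cap 1 (-1) \<union> cap (-1) 0 \<times> cap 1 (-1)"
proof -
  have "Re z > - 1 \<longleftrightarrow> z \<noteq> - 1" if "norm z = 1" for z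
    using unit_complex_cases(2)[OF that] unit_complex_Re_bounds[OF that] by linarith
  then have 1: "cap 1 (-1) = sphere 0 1 - {- 1}"
    by (auto simp: cap_def inner_complex_def)
  have "Re w > 0 \<or> - Re w > 0 \<longleftrightarrow> w \<noteq> \<i> \<and> w \<noteq> - \<i>" if "norm w = 1" for w
    using unit_complex_cases(1)[OF that] by linarith
  moreover have "cap 1 0 \<union> cap (-1) 0 = {w. norm w = 1 \<and> (Re w > 0 \<or> - Re w > 0)}"
    by (auto simp: cap_def inner_complex_def)
  ultimately have "cap 1 0 \<union> cap (-1) 0 = {w. norm w = 1 \<and> w \<noteq> \<i> \<and> w \<noteq> - \<i>}"
    by (simp cong: conj_cong)
  also have "\<dots> = sphere 0 1 - {\<i>, - \<i>}" by auto
  finally have 2: "cap 1 0 \<union> cap (-1) 0 = sphere 0 1 - {\<i>, - \<i>}" .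
  show "sphere 0 1 \<times> cap 1 (-1) \<union> (cap 1 0 \<times> sphere 0 1 \<union> cap (-1) 0 \<times> sphere 0 1) = torus - punctures"
    unfolding Sigma_Un_distrib1[symmetric] 1 2 by (auto simp: punctures_eq torus_def)
  show "(sphere 0 1 \<times> cap 1 (-1)) \<inter> (cap 1 0 \<times> sphere 0 1 \<union> cap (-1) 0 \<times> sphere 0 1)
    = cap 1 0 \<times> cap 1 (-1) \<union> cap (-1) 0 \<times> cap 1 (-1)"
    using cap_subset by auto
qed

lemma openin_punctured_torus:
  assumes "openin circle A" "openin circle B" "A \<times> B \<subseteq> torus - punctures"
  shows "openin punctured_torus (A \<times> B)"
proof -
  have "openin (top_of_set torus) (A \<times> B)"
    using assms(1,2) openin_prod_Times_iff[of circle circle A B] by (simp add: torus_def)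
  then show ?thesis
    unfolding punctured_torus_def using assms(3) by (meson Diff_subset openin_subset_trans)
qed

lemma subtopology_punctured_torus:
  "S \<subseteq> torus - punctures \<Longrightarrow> subtopology punctured_torus S = top_of_set S"
  by (simp add: punctured_torus_def subtopology_subtopology Int_absorb1)

lemma path_connected_sphere_complex: "path_connected (sphere (0::complex) 1)"
  by (rule path_connected_sphere) simp

lemma path_connected_cap: "norm b = 1 \<Longrightarrow> k = 0 \<or> k = - 1 \<Longrightarrow> path_connected (cap b k)"
  by (intro contractible_imp_path_connected contractible_cap)

lemma path_connected_punctured_torus: "path_connected (torus - punctures)"
proof -
  let ?U = "sphere (0::complex) 1 \<times> cap 1 (-1)" and ?V1 = "cap 1 0 \<times> sphere (0::complex) 1"
    and ?V2 = "cap (-1) 0 \<times> sphere (0::complex) 1"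
  have p: "path_connected ?U" "path_connected ?V1" "path_connected ?V2"
    by (intro path_connected_Times path_connected_sphere_complex path_connected_cap; simp)+
  have "(1, 1) \<in> ?U \<inter> ?V1" "(-1, 1) \<in> (?U \<union> ?V1) \<inter> ?V2"
    by (auto simp: cap_def)
  then have "path_connected (?U \<union> ?V1 \<union> ?V2)"
    using path_connected_Un[OF path_connected_Un[OF p(1,2)] p(3)] by blast
  then show ?thesis unfolding torus_cover(1)[symmetric] by (simp add: Un_assoc)
qed

text \<open>\<open>a = - b\<close> is a chain in \<open>A\<close> and in \<open>B\<close>, hence in
  the empty space.\<close>

lemma disjoint_chains_sum_0:
  assumes X: "openin X A" "openin X B" "A \<inter> B = {}"
    and a: "singular_chain p (subtopology X A) a" and b: "singular_chain p (subtopology X B) b"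
    and "a + b = 0"
  shows "a = 0"
proof -
  have "a = - b" using assms(6) by (simp add: add_eq_0_iff2)
  then have "singular_chain p (subtopology X (A \<inter> B)) a"
    using a b by (auto simp: singular_chain_subtopology)
  then show ?thesis using X(3) by (simp add: singular_chain_empty)
qed

text \<open>The overlap \<open>R1 \<union> R2\<close> is disconnected, so
  \<open>Mayer_Vietoris_onto\<close> does not apply. But \<open>R1\<close> and \<open>R2\<close> lie
  in different components \<open>V1\<close> and \<open>V2\<close> of the second open set, so the
  boundaries match separately over each. Both parts of the boundary of \<open>d\<close> then have
  augmentation zero and bound within their discs.\<close>

proposition punctured_torus_cycles:
  assumes z: "one_cycle punctured_torus z"
  obtains k l m where "one_boundary punctured_torus (z -
    (frag_cmul k (path_chain alpha) + frag_cmul l (path_chain beta) + frag_cmul m (path_chain gamma)))"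
proof -
  define U V1 V2 where "U = sphere (0::complex) 1 \<times> cap 1 (-1)" and "V1 = cap 1 0 \<times> sphere (0::complex) 1"
    and "V2 = cap (-1) 0 \<times> sphere (0::complex) 1"
  define R1 R2 where "R1 = cap 1 0 \<times> cap 1 (-1)" and "R2 = cap (-1) 0 \<times> cap 1 (-1)"
  note cover = torus_cover[folded U_def V1_def V2_def R1_def R2_def]
  let ?X = "punctured_torus"
  have subs: "U \<subseteq> torus - punctures" "V1 \<subseteq> torus - punctures" "V2 \<subseteq> torus - punctures"
    "R1 \<subseteq> torus - punctures" "R2 \<subseteq> torus - punctures"
    using cover by blast+
  note sub = subs[THEN subtopology_punctured_torus]
  have s: "openin circle (sphere 0 1)" by simp
  have op: "openin ?X U" "openin ?X V1" "openin ?X V2" "openin ?X R1" "openin ?X R2"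
    using subs unfolding U_def V1_def V2_def R1_def R2_def
    by (auto intro!: openin_punctured_torus openin_cap s)
  have base: "1 \<in> cap 1 (-1)" "1 \<in> cap 1 0" "-1 \<in> cap (-1) 0"
    by (simp_all add: cap_def)
  have disj: "V1 \<inter> V2 = {}" "R1 \<inter> R2 = {}"
    by (auto simp: V1_def V2_def R1_def R2_def cap_def)
  have incl: "R1 \<subseteq> V1" "R2 \<subseteq> V2" "R1 \<subseteq> U" "R2 \<subseteq> U"
    using cap_subset by (auto simp: V1_def V2_def U_def R1_def R2_def)
  have "U \<union> (V1 \<union> V2) = topspace ?X" using cover by (simp add: punctured_torus_def)
  then obtain d e where d: "singular_chain 1 (subtopology ?X U) d"
    and e: "singular_chain 1 (subtopology ?X (V1 \<union> V2)) e"
    and de: "chain_boundary 1 d + chain_boundary 1 e = 0" and zde: "one_boundary ?X (z - (d + e))"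
    using one_cycle_small[OF op(1) openin_Un[OF op(2,3)] _ z] by metis
  have bde: "chain_boundary 1 d = - chain_boundary 1 e" using de by (simp add: add_eq_0_iff)
  then have "singular_chain 0 (subtopology ?X (R1 \<union> R2)) (chain_boundary 1 d)"
    unfolding cover(2)[symmetric] using singular_chain_boundary[OF d] singular_chain_boundary[OF e]
    by (auto simp: singular_chain_subtopology)
  then obtain w1 w2 where w1: "singular_chain 0 (subtopology ?X R1) w1"
    and w2: "singular_chain 0 (subtopology ?X R2) w2" and w: "chain_boundary 1 d = w1 + w2"
    by (rule singular_chain_split[OF _ op(4,5) disj(2)])
  obtain e1 e2 where e1: "singular_chain 1 (subtopology ?X V1) e1"
    and e2: "singular_chain 1 (subtopology ?X V2) e2" and e12: "e = e1 + e2"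
    by (rule singular_chain_split[OF e op(2,3) disj(1)])
  \<comment> \<open>The two summands in parentheses-free and bracketed form live in the disjoint
    open sets \<open>V1\<close> and \<open>V2\<close>, so each of them must vanish.\<close>
  have "chain_boundary 1 e1 + w1 + (chain_boundary 1 e2 + w2) = 0"
    using de unfolding e12 w chain_boundary_add by (simp add: algebra_simps)
  moreover have "singular_chain 0 (subtopology ?X V1) (chain_boundary 1 e1 + w1)"
    "singular_chain 0 (subtopology ?X V2) (chain_boundary 1 e2 + w2)"
    using singular_chain_boundary[OF e1] singular_chain_boundary[OF e2]
      singular_chain_mono[OF w1 incl(1)] singular_chain_mono[OF w2 incl(2)]
    by (auto intro!: singular_chain_add)
  ultimately have z1: "chain_boundary 1 e1 + w1 = 0"
    using disjoint_chains_sum_0[OF op(2,3) disj(1)] by blast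
  with \<open>chain_boundary 1 e1 + w1 + (chain_boundary 1 e2 + w2) = 0\<close>
  have z2: "chain_boundary 1 e2 + w2 = 0" by simp
  have aug: "augmentation w1 = 0" "augmentation w2 = 0"
    using arg_cong[OF z1, of augmentation] arg_cong[OF z2, of augmentation]
      augmentation_boundary[OF e1] augmentation_boundary[OF e2]
    by (simp_all add: augmentation_add) (simp_all add: augmentation_def)
  have pc: "path_connected_space (subtopology ?X R1)" "path_connected_space (subtopology ?X R2)"
    unfolding sub unfolding R1_def R2_def
    by (simp_all add: path_connected_Times path_connected_cap)
  obtain b1 where b1: "singular_chain 1 (subtopology ?X R1) b1" "chain_boundary 1 b1 = w1"
    by (rule zero_chain_bounds[OF pc(1) w1 aug(1)])
  obtain b2 where b2: "singular_chain 1 (subtopology ?X R2) b2" "chain_boundary 1 b2 = w2"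
    by (rule zero_chain_bounds[OF pc(2) w2 aug(2)])
  have "one_cycle (subtopology ?X U) (d - b1 - b2)"
    using d singular_chain_mono[OF b1(1) incl(3)] singular_chain_mono[OF b2(1) incl(4)]
    by (auto simp: one_cycle_iff chain_boundary_diff w[simplified] b1(2)[simplified] b2(2)[simplified] intro!: singular_chain_diff)
  then have "\<exists>k. one_boundary (subtopology ?X U) (d - b1 - b2 - frag_cmul k (path_chain alpha))"
    unfolding sub(1) alpha_eq unfolding U_def
    by (intro cycle_multiple_Times(1) contractible_cap) (simp_all add: base)
  then obtain k where k: "one_boundary ?X (d - b1 - b2 - frag_cmul k (path_chain alpha))"
    using one_boundary_subtopology by blast
  have "one_cycle (subtopology ?X V1) (e1 + b1)"
    using e1 singular_chain_mono[OF b1(1) incl(1)] z1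
    by (auto simp: one_cycle_iff chain_boundary_add b1(2)[simplified] intro!: singular_chain_add)
  then have "\<exists>l. one_boundary (subtopology ?X V1) (e1 + b1 - frag_cmul l (path_chain beta))"
    unfolding sub(2) beta_eq unfolding V1_def
    by (intro cycle_multiple_Times(2) contractible_cap) (simp_all add: base)
  then obtain l where l: "one_boundary ?X (e1 + b1 - frag_cmul l (path_chain beta))"
    using one_boundary_subtopology by blast
  have "one_cycle (subtopology ?X V2) (e2 + b2)"
    using e2 singular_chain_mono[OF b2(1) incl(2)] z2
    by (auto simp: one_cycle_iff chain_boundary_add b2(2)[simplified] intro!: singular_chain_add)
  then have "\<exists>m. one_boundary (subtopology ?X V2) (e2 + b2 - frag_cmul m (path_chain gamma))"
    unfolding sub(3) gamma_eq unfolding V2_def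
    by (intro cycle_multiple_Times(2) contractible_cap) (simp_all add: base)
  then obtain m where m: "one_boundary ?X (e2 + b2 - frag_cmul m (path_chain gamma))"
    using one_boundary_subtopology by blast
  show thesis
  proof (rule that[of k l m])
    have "z - (frag_cmul k (path_chain alpha) + frag_cmul l (path_chain beta) + frag_cmul m (path_chain gamma))
      = (d - b1 - b2 - frag_cmul k (path_chain alpha)) + (e1 + b1 - frag_cmul l (path_chain beta))
        + (e2 + b2 - frag_cmul m (path_chain gamma)) + (z - (d + e))"
      unfolding e12 by (simp add: algebra_simps)
    then show "one_boundary ?X (z - (frag_cmul k (path_chain alpha) + frag_cmul l (path_chain beta) + frag_cmul m (path_chain gamma)))"
      by (simp only: one_boundary_add[OF one_boundary_add[OF one_boundary_add[OF k l] m] zde])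
  qed
qed

section \<open>Deforming complements in the solid torus onto its boundary\<close>

section \<open>Radial flows in the solid torus\<close>

text \<open>The ray from \<open>c\<close> through a point \<open>z\<close> of the closed unit disc leaves the disc at
  \<open>z + exit_time c z *\<^sub>R (z - c)\<close>; the exit time is the nonnegative root of a quadratic equation.\<close>

definition exit_time :: "complex \<Rightarrow> complex \<Rightarrow> real" where
  "exit_time c z =
    (sqrt ((z \<bullet> (z - c))\<^sup>2 + (norm (z - c))\<^sup>2 * (1 - (norm z)\<^sup>2)) - z \<bullet> (z - c)) / (norm (z - c))\<^sup>2"

lemma exit_time_nonneg:
  assumes "norm z \<le> 1" shows "exit_time c z \<ge> 0"
proof -
  have "(norm z)\<^sup>2 \<le> 1" using assms by (simp add: power_le_one)
  then have "sqrt ((z \<bullet> (z - c))\<^sup>2) \<le> sqrt ((z \<bullet> (z - c))\<^sup>2 + (norm (z - c))\<^sup>2 * (1 - (norm z)\<^sup>2))"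
    by (intro real_sqrt_le_mono) simp
  then show ?thesis by (simp add: exit_time_def)
qed

lemma norm_exit_point:
  assumes z: "norm z \<le> 1" and "z \<noteq> c"
  shows "norm (z + exit_time c z *\<^sub>R (z - c)) = 1"
proof -
  \<comment> \<open>Meeting the unit circle at time \<open>s\<close> means
    \<open>A * s^2 + 2 * B * s = C\<close>; \<open>r\<close> is the square root of a quarter of the
    discriminant.\<close>
  define A B C r where "A = (norm (z - c))\<^sup>2" and "B = z \<bullet> (z - c)" and "C = 1 - (norm z)\<^sup>2"
    and "r = sqrt (B\<^sup>2 + A * C)"
  have A: "A > 0" using assms(2) by (simp add: A_def)
  have "C \<ge> 0" using z by (simp add: C_def power_le_one)
  then have r: "r\<^sup>2 = B\<^sup>2 + A * C" using A by (simp add: r_def)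
  have s: "exit_time c z = (r - B) / A" by (simp add: exit_time_def A_def B_def C_def r_def)
  have gen: "(norm (z + s *\<^sub>R v))\<^sup>2 = (norm z)\<^sup>2 + 2 * s * (z \<bullet> v) + s\<^sup>2 * (norm v)\<^sup>2" for s v
    unfolding power2_norm_eq_inner
    by (simp add: inner_add_left inner_add_right inner_commute[of v z] power2_eq_square algebra_simps)
  have "(norm (z + exit_time c z *\<^sub>R (z - c)))\<^sup>2 = (norm z)\<^sup>2 + 2 * exit_time c z * B + (exit_time c z)\<^sup>2 * A"
    unfolding A_def B_def by (rule gen)
  also have "\<dots> = (norm z)\<^sup>2 + (r\<^sup>2 - B\<^sup>2) / A"
    unfolding s using A by (simp add: field_simps power2_eq_square)
  also have "\<dots> = 1" unfolding r using A by (simp add: C_def)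
  finally show ?thesis by (intro power2_eq_imp_eq[where y=1]) simp_all
qed

text \<open>For a centre in the closed disc, \<open>z \<bullet> (z - c)\<close> is nonnegative at a
  boundary point \<open>z\<close>, so the larger root is zero. For a centre outside, the ray through
  a boundary point may still have to cross the disc.\<close>

lemma exit_time_sphere:
  assumes "norm z = 1" "norm c \<le> 1" shows "exit_time c z = 0"
proof -
  have "z \<bullet> c \<le> 1" using norm_cauchy_schwarz[of z c] assms by simp
  then have "z \<bullet> (z - c) \<ge> 0" using assms(1) by (simp add: inner_diff_right norm_eq_1)
  then show ?thesis using assms(1) by (simp add: exit_time_def)
qed

text \<open>Time is rescaled by the exit time, so that all points arrive on the boundary torus
  together at \<open>t = 1\<close>.\<close>

definition ray_flow :: "(complex \<Rightarrow> complex) \<Rightarrow> real \<Rightarrow> complex \<times> complex \<Rightarrow> complex \<times> complex" where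
  "ray_flow c t p =
    (fst p, snd p + (t * exit_time (c (fst p)) (snd p)) *\<^sub>R (snd p - c (fst p)))"

definition off :: "(complex \<Rightarrow> complex) \<Rightarrow> (complex \<times> complex) set" where
  "off c = {p \<in> solid_torus. snd p \<noteq> c (fst p)}"

lemma ray_flow_0 [simp]: "ray_flow c 0 p = p"
  by (simp add: ray_flow_def)

text \<open>The moving point is a convex combination of the start and the exit point, hence stays in
  the disc. Its displacement from the centre is multiplied by the positive number
  \<open>1 + t * s\<close>, hence never vanishes.\<close>

lemma ray_flow_off:
  assumes t: "0 \<le> t" "t \<le> 1" and p: "p \<in> off c"
  shows "ray_flow c t p \<in> off c"
proof -
  obtain w z where wz: "p = (w, z)" by (cases p)
  have w: "norm w = 1" "norm z \<le> 1" "z \<noteq> c w" using p by (auto simp: wz off_def solid_torus_def)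
  define s where "s = exit_time (c w) z"
  have s: "s \<ge> 0" "norm (z + s *\<^sub>R (z - c w)) = 1"
    using w by (simp_all add: s_def exit_time_nonneg norm_exit_point)
  have "z + (t * s) *\<^sub>R (z - c w) = (1 - t) *\<^sub>R z + t *\<^sub>R (z + s *\<^sub>R (z - c w))"
    by (simp add: algebra_simps)
  moreover have "norm \<dots> \<le> (1 - t) * norm z + t * 1"
    using norm_triangle_ineq[of "(1 - t) *\<^sub>R z" "t *\<^sub>R (z + s *\<^sub>R (z - c w))"] t s(2) by simp
  moreover have "(1 - t) * norm z \<le> (1 - t) * 1" using t w by (intro mult_left_mono) auto
  ultimately have "norm (z + (t * s) *\<^sub>R (z - c w)) \<le> 1" by simp
  moreover have "z + (t * s) *\<^sub>R (z - c w) \<noteq> c w"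
  proof
    assume "z + (t * s) *\<^sub>R (z - c w) = c w"
    then have "(1 + t * s) *\<^sub>R (z - c w) = 0" by (simp add: algebra_simps)
    moreover have "1 + t * s > 0" using t s(1) by (simp add: add_pos_nonneg)
    ultimately show False using w by simp
  qed
  ultimately show ?thesis using w by (simp add: wz ray_flow_def off_def solid_torus_def s_def)
qed

lemma ray_flow_1:
  assumes p: "p \<in> off c" shows "ray_flow c 1 p \<in> torus"
  using p norm_exit_point[of "snd p" "c (fst p)"]
  by (auto simp: ray_flow_def torus_def off_def solid_torus_def)

lemma continuous_on_ray_flow:
  assumes c: "continuous_on (sphere 0 1) c"
  shows "continuous_on ({0..1} \<times> off c) (\<lambda>(t, p). ray_flow c t p)"
proof -
  have "continuous_on ({0..1::real} \<times> off c) (\<lambda>x. c (fst (snd x)))"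
    by (rule continuous_on_compose2[OF c]) (auto intro!: continuous_intros simp: off_def solid_torus_def)
  then show ?thesis
    unfolding ray_flow_def exit_time_def case_prod_unfold
    by (intro continuous_intros) (auto simp: off_def)
qed

lemma homotopic_ray_flow:
  assumes c: "continuous_on (sphere 0 1) c"
  shows "homotopic_with (\<lambda>_. True) (top_of_set (off c)) (top_of_set (off c)) id (ray_flow c 1)"
  using continuous_on_ray_flow[OF c] ray_flow_off[of _ _ c]
  by (subst homotopic_with) (auto intro!: exI[of _ "\<lambda>(t, p). ray_flow c t p"])

section \<open>The complement of the trivial arc\<close>

text \<open>The formula of the trivial arc with \<open>Re w\<close> in place of
  \<open>cos (2 * pi * x)\<close>, extended to the whole circle. The value lies in the closed disc
  exactly when \<open>Re w \<le> 0\<close>, so over the remaining half circle nothing is removed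
  from the solid torus.\<close>

definition arc_center :: "complex \<Rightarrow> complex" where
  "arc_center w = - of_real (1 + Re w / 2)"

text \<open>Unlike \<^const>\<open>arc_center\<close>, the following centre stays in the closed disc,
  so that the flow away from it fixes the boundary torus.\<close>

definition core_center :: "complex \<Rightarrow> complex" where
  "core_center w = - of_real (1 - \<bar>Re w\<bar> / 2)"

lemma continuous_on_centers: "continuous_on S arc_center" "continuous_on S core_center"
  unfolding arc_center_def[abs_def] core_center_def[abs_def]
  by (intro continuous_intros; simp)+

lemma trivial_arc_eq: "trivial_arc = {p \<in> solid_torus. snd p = arc_center (fst p)}"
proof (intro equalityI subsetI)
  fix p assume "p \<in> trivial_arc"
  then show "p \<in> {p \<in> solid_torus. snd p = arc_center (fst p)}"
    using trivial_arc_subset by (auto simp: trivial_arc_def arc_center_def)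
next
  fix p assume "p \<in> {p \<in> solid_torus. snd p = arc_center (fst p)}"
  then obtain w where p: "p = (w, arc_center w)" and w: "norm w = 1" "norm (arc_center w) \<le> 1"
    by (cases p) (auto simp: solid_torus_def)
  have "\<bar>1 + Re w / 2\<bar> \<le> 1"
    using w(2) unfolding arc_center_def cmod_minus_of_real .
  then have Re: "Re w \<le> 0" by linarith
  have sq: "(Re w)\<^sup>2 + (Im w)\<^sup>2 = 1" using w(1) by (simp add: cmod_def)
  \<comment> \<open>As \<open>Re w \<le> 0\<close>, the angle of \<open>w\<close> is
    \<open>pi - a\<close> with \<open>a\<close> between \<open>- pi/2\<close> and
    \<open>pi/2\<close>; dividing by \<open>2 * pi\<close> gives a parameter in
    \<open>{1/4..3/4}\<close>.\<close>
  define a where "a = arcsin (Im w)"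
  have im: "-1 \<le> Im w" "Im w \<le> 1" using abs_Im_le_cmod[of w] w(1) by auto
  have a: "- (pi/2) \<le> a" "a \<le> pi/2" "sin a = Im w"
    using arcsin[OF im] by (auto simp: a_def)
  have "cos a = sqrt (1 - (Im w)\<^sup>2)" using im by (simp add: a_def cos_arcsin)
  also have "1 - (Im w)\<^sup>2 = (- Re w)\<^sup>2" using sq by simp
  finally have "cos a = - Re w" using Re by simp
  then have "cis (pi - a) = w" using a by (simp add: complex_eq_iff cos_diff sin_diff)
  moreover define x where "x = (pi - a) / (2 * pi)"
  ultimately have cis: "cis (2 * pi * x) = w" by simp
  then have "Re w = cos (2 * pi * x)" by auto
  moreover have "x \<in> {1/4..3/4}" using a by (auto simp: x_def field_simps)
  ultimately show "p \<in> trivial_arc"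
    unfolding trivial_arc_def p arc_center_def using cis by force
qed

lemma off_arc_center: "off arc_center = solid_torus - trivial_arc"
  by (auto simp: off_def trivial_arc_eq)

lemma norm_core_center: "norm w = 1 \<Longrightarrow> norm (core_center w) \<le> 1"
  using unit_complex_Re_bounds[of w] unfolding core_center_def cmod_minus_of_real by linarith

text \<open>The centres agree for \<open>Re w \<le> 0\<close>. For \<open>Re w > 0\<close> the graph
  of \<open>core_center\<close> is a second arc with the same endpoints, the mirror image of the
  first; removing both arcs leaves a set that flows onto the punctured torus with the boundary
  fixed.\<close>

lemma off_core_center_subset: "off core_center \<subseteq> off arc_center"
proof
  fix p assume p: "p \<in> off core_center"
  have "arc_center w = core_center w \<or> norm (arc_center w) > 1" if "norm w = 1" for w
    using unit_complex_Re_bounds[OF that] unfolding arc_center_def core_center_def cmod_minus_of_real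
    by (cases "Re w \<le> 0") auto
  then show "p \<in> off arc_center"
    using p by (force simp: off_def solid_torus_def)
qed

text \<open>A boundary point can equal a centre only where that centre has norm 1, that is, for
  \<open>Re w = 0\<close>. Both centres are then -1, and these points are the punctures.\<close>

lemma torus_off:
  "torus \<inter> off arc_center = torus - punctures" "torus \<inter> off core_center = torus - punctures"
proof -
  have sub: "torus \<subseteq> solid_torus" by (auto simp: torus_def solid_torus_def)
  then show 1: "torus \<inter> off arc_center = torus - punctures"
    using trivial_arc_boundary by (auto simp: off_arc_center)
  have "z = arc_center w" if "norm w = 1" "norm z = 1" "z = core_center w" for w z
    using that unit_complex_Re_bounds[of w] unfolding that(3) arc_center_def core_center_def cmod_minus_of_real
    by auto
  then have "torus \<inter> off arc_center \<subseteq> off core_center"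
    using sub by (auto simp: off_def torus_def)
  then show "torus \<inter> off core_center = torus - punctures"
    using off_core_center_subset 1 by auto
qed

lemma ray_flow_core_fixed:
  assumes "p \<in> torus" shows "ray_flow core_center t p = p"
  using assms exit_time_sphere[of "snd p" "core_center (fst p)"] norm_core_center[of "fst p"]
  by (auto simp: ray_flow_def torus_def)

abbreviation arc_complement :: "(complex \<times> complex) topology" where
  "arc_complement \<equiv> top_of_set (solid_torus - trivial_arc)"

lemma punctured_torus_subset: "torus - punctures \<subseteq> off core_center" "torus - punctures \<subseteq> solid_torus - trivial_arc"
  using torus_off by (auto simp: off_arc_center)

lemma continuous_map_ray_flow_1:
  assumes c: "c = arc_center \<or> c = core_center"
  shows "continuous_map (top_of_set (off c)) punctured_torus (ray_flow c 1)"
proof -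
  have cont: "continuous_on (sphere 0 1) c" using c continuous_on_centers by metis
  have "ray_flow c 1 p \<in> torus - punctures" if "p \<in> off c" for p
    using ray_flow_off[OF _ _ that, of 1] ray_flow_1[OF that] torus_off c by auto
  moreover have "continuous_map (top_of_set (off c)) (top_of_set (off c)) (ray_flow c 1)"
    using homotopic_with_imp_continuous_maps[OF homotopic_ray_flow[OF cont]] by simp
  ultimately show ?thesis by (auto simp: punctured_torus_def)
qed

lemma off_cycle_from_torus:
  assumes c: "c = arc_center \<or> c = core_center" and z: "one_cycle (top_of_set (off c)) z"
  shows "one_cycle punctured_torus (push (ray_flow c 1) z)"
    and "one_boundary (top_of_set (off c)) (z - push (ray_flow c 1) z)"
proof -
  have "continuous_on (sphere 0 1) c" using c continuous_on_centers by metis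
  from one_boundary_homotopic[OF homotopic_ray_flow[OF this] z]
  show "one_boundary (top_of_set (off c)) (z - push (ray_flow c 1) z)"
    using push_ident[OF z, of id] by simp
  show "one_cycle punctured_torus (push (ray_flow c 1) z)"
    using z continuous_map_ray_flow_1[OF c] by (rule one_cycle_push)
qed

lemma punctured_torus_cycle_mono:
  assumes "torus - punctures \<subseteq> S"
  shows "one_cycle punctured_torus z \<Longrightarrow> one_cycle (top_of_set S) z"
    and "one_boundary punctured_torus z \<Longrightarrow> one_boundary (top_of_set S) z"
  using assms one_cycle_mono[of euclidean "torus - punctures" z S] one_boundary_mono[of euclidean "torus - punctures" z S]
  by (auto simp: punctured_torus_def)

lemma one_cycle_curves:
  "one_cycle punctured_torus (path_chain alpha)" "one_cycle punctured_torus (path_chain beta)"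
  "one_cycle punctured_torus (path_chain gamma)"
  unfolding alpha_eq beta_eq gamma_eq punctured_torus_def
  by (rule one_cycle_path_chain;
      force simp: torus_def punctures_eq complex_eq_iff circle_loop_def intro!: continuous_intros continuous_circle_loop)+

lemma beta_bounds: "one_boundary arc_complement (path_chain beta)"
proof -
  have "(1, z) \<notin> trivial_arc" if "norm z \<le> 1" for z
  proof -
    have "(1, z) \<in> {1} \<times> cball 0 1" using that by simp
    then show ?thesis using beta_disc_trivial_arc by blast
  qed
  then have f: "continuous_map (top_of_set (cball 0 1)) arc_complement (\<lambda>z. (1, z))"
    by (auto simp: solid_torus_def intro!: continuous_intros)
  have "one_cycle (top_of_set (cball (0::complex) 1)) (path_chain circle_loop)"
    by (rule one_cycle_path_chain) (auto simp: continuous_circle_loop, simp add: circle_loop_def)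
  then have "one_boundary (top_of_set (cball (0::complex) 1)) (path_chain circle_loop)"
    by (intro one_boundary_contractible) (simp add: convex_imp_contractible)
  from one_boundary_push[OF this f] show ?thesis
    by (simp add: push_path_chain beta_eq o_def)
qed

text \<open>The classes of \<^term>\<open>alpha\<close> and \<^term>\<open>gamma\<close> are detected by the winding numbers of the first coordinate
  and of the vector pointing from the centre of the arc.\<close>

lemma arc_complement_independent:
  assumes "one_boundary arc_complement (frag_cmul k (path_chain alpha) + frag_cmul l (path_chain gamma))"
  shows "k = 0" "l = 0"
proof -
  obtain W :: "complex chain \<Rightarrow> int" where
    W: "\<And>a b. one_cycle circle a \<Longrightarrow> one_cycle circle b \<Longrightarrow> W (a + b) = W a + W b"
    "\<And>a k. one_cycle circle a \<Longrightarrow> W (frag_cmul k a) = k * W a"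
    "\<And>a. one_boundary circle a \<Longrightarrow> W a = 0"
    "W (path_chain circle_loop) = 1"
    by (rule winding_number_hom) blast
  have cyc: "one_cycle arc_complement (path_chain alpha)" "one_cycle arc_complement (path_chain gamma)"
    using punctured_torus_cycle_mono(1)[OF punctured_torus_subset(2)] one_cycle_curves by blast+
  have eq: "k * W (push f (path_chain alpha)) + l * W (push f (path_chain gamma)) = 0"
    if f: "continuous_map arc_complement circle f" for f
    using W(3)[OF one_boundary_push[OF assms f]]
      one_cycle_push[OF cyc(1) f] one_cycle_push[OF cyc(2) f]
    by (simp add: push_add push_cmul W one_cycle_cmul)
  have const: "W (path_chain (\<lambda>_. a)) = 0" if "norm a = 1" for a
  proof (rule W(3))
    have "one_boundary circle (push (\<lambda>_. a) (path_chain circle_loop))"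
      using that by (intro one_boundary_push_const[OF one_cycle_circle_loop]) simp
    then show "one_boundary circle (path_chain (\<lambda>_. a))" by (simp add: push_path_chain o_def)
  qed
  have "continuous_map arc_complement circle fst"
    by (auto simp: solid_torus_def intro!: continuous_intros)
  from eq[OF this] show k: "k = 0"
    by (simp add: push_path_chain alpha_eq gamma_eq o_def const W(4))
  define g where "g = (\<lambda>p. sgn (snd p - arc_center (fst p)))"
  have "continuous_on (off arc_center) g"
    unfolding g_def by (intro continuous_intros continuous_on_compose2[OF continuous_on_centers(1)[of UNIV]])
      (auto simp: off_def)
  then have "continuous_map arc_complement circle g"
    unfolding off_arc_center[symmetric] by (auto simp: g_def norm_sgn off_def)
  \<comment> \<open>Since \<open>k = 0\<close> is already known, the winding of \<open>g\<close>
    along \<open>alpha\<close> drops out of the equation.\<close>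
  from eq[OF this] have "l * W (path_chain (g \<circ> gamma)) = 0"
    by (simp add: k push_path_chain)
  moreover have "W (path_chain (g \<circ> gamma)) = 1"
  proof -
    \<comment> \<open>On \<open>gamma\<close> the first coordinate is -1 and
      \<open>arc_center (- 1) = - 1/2\<close>, so \<open>gamma\<close> is viewed from the point
      where the arc crosses its disc. The family \<open>z + t/2\<close> below moves the viewpoint
      from 0 to this point inside the disc, which keeps the winding number.\<close>
    have gg: "g \<circ> gamma = (\<lambda>z. sgn (z + 1/2)) \<circ> circle_loop"
      by (simp add: fun_eq_iff g_def gamma_eq arc_center_def)
    have ne: "z + of_real (t/2) \<noteq> 0" if "norm z = 1" "0 \<le> t" "t \<le> 1" for z :: complex and t :: real
    proof
      assume "z + of_real (t/2) = 0"
      then have "z = of_real (- (t/2))" by (metis add_eq_0_iff2 of_real_minus)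
      then have "norm z = \<bar>- (t/2)\<bar>" by (metis norm_of_real)
      then show False using that by simp
    qed
    have "continuous_on ({0..1} \<times> sphere 0 1) (\<lambda>(t, z). sgn (z + complex_of_real (t/2)))"
      unfolding case_prod_unfold using ne by (intro continuous_intros) auto
    then have "homotopic_with (\<lambda>_. True) circle circle id (\<lambda>z. sgn (z + 1/2))"
      using ne by (subst homotopic_with)
        (auto intro!: exI[of _ "\<lambda>(t, z). sgn (z + complex_of_real (t/2))"] simp: norm_sgn sgn_div_norm)
    from one_boundary_homotopic[OF this one_cycle_circle_loop]
    have *: "one_boundary circle (path_chain circle_loop - path_chain (g \<circ> gamma))"
      by (simp add: push_path_chain gg)
    then have gc: "one_cycle circle (path_chain (g \<circ> gamma))"
      using one_cycle_diff[OF one_cycle_circle_loop one_boundary_imp_cycle[OF *]] by simp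
    then show ?thesis
      using W(1)[OF one_boundary_imp_cycle[OF *] gc] W(3)[OF *] W(4) by simp
  qed
  ultimately show "l = 0" by simp
qed

lemma arc_complement_kernel:
  assumes z: "one_cycle punctured_torus z" and b: "one_boundary arc_complement z"
  obtains k where "one_boundary punctured_torus (z - frag_cmul k (path_chain beta))"
proof -
  obtain k l m where klm: "one_boundary punctured_torus (z -
    (frag_cmul k (path_chain alpha) + frag_cmul l (path_chain beta) + frag_cmul m (path_chain gamma)))"
    using punctured_torus_cycles[OF z] .
  have "one_boundary arc_complement (frag_cmul k (path_chain alpha) + frag_cmul l (path_chain beta) + frag_cmul m (path_chain gamma))"
    using one_boundary_cong[OF punctured_torus_cycle_mono(2)[OF punctured_torus_subset(2) klm]] b by blast
  from one_boundary_diff[OF this one_boundary_cmul[OF beta_bounds, of l]]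
  have "one_boundary arc_complement (frag_cmul k (path_chain alpha) + frag_cmul m (path_chain gamma))"
    by (simp add: algebra_simps)
  then have "k = 0" "m = 0" by (rule arc_complement_independent)+
  with klm show thesis using that[of l] by simp
qed

text \<open>The flow away from \<open>arc_center\<close> is defined on the whole arc complement and
  moves the cycle into the punctured torus; there \<open>punctured_torus_cycles\<close> applies, and
  the \<open>beta\<close> part bounds.\<close>

lemma arc_complement_cycles:
  assumes z: "one_cycle arc_complement z"
  obtains k m where "one_boundary arc_complement (z - (frag_cmul k (path_chain alpha) + frag_cmul m (path_chain gamma)))"
proof -
  define y where "y = push (ray_flow arc_center 1) z"
  have y: "one_cycle punctured_torus y" "one_boundary arc_complement (z - y)"
    using off_cycle_from_torus[of arc_center z] z by (auto simp: off_arc_center y_def)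
  obtain k l m where klm: "one_boundary punctured_torus (y -
    (frag_cmul k (path_chain alpha) + frag_cmul l (path_chain beta) + frag_cmul m (path_chain gamma)))"
    using punctured_torus_cycles[OF y(1)] .
  have "one_boundary arc_complement ((z - y) + (y - (frag_cmul k (path_chain alpha) + frag_cmul l (path_chain beta)
     + frag_cmul m (path_chain gamma))) + frag_cmul l (path_chain beta))"
    by (intro one_boundary_add y one_boundary_cmul beta_bounds punctured_torus_cycle_mono(2)[OF punctured_torus_subset(2) klm])
  then show thesis using that[of k m] by (simp add: algebra_simps)
qed

section \<open>The quotient topology of the glued space\<close>

section \<open>The glued manifold\<close>

text \<open>With the disjoint union written as a product with a discrete factor, openness and
  continuity on it reduce to facts about product topologies.\<close>

lemma sum_topology_const: "sum_topology (\<lambda>_. Y) UNIV = prod_topology (discrete_topology UNIV) Y"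
proof (rule topology_eq[THEN iffD2], intro allI)
  fix U :: "('a \<times> 'b) set"
  show "openin (sum_topology (\<lambda>_. Y) UNIV) U \<longleftrightarrow> openin (prod_topology (discrete_topology UNIV) Y) U"
  proof
    assume U: "openin (sum_topology (\<lambda>_. Y) UNIV) U"
    show "openin (prod_topology (discrete_topology UNIV) Y) U"
      unfolding openin_prod_topology_alt
    proof (intro allI impI)
      fix i x assume "(i, x) \<in> U"
      with U show "\<exists>V W. openin (discrete_topology UNIV) V \<and> openin Y W \<and> i \<in> V \<and> x \<in> W \<and> V \<times> W \<subseteq> U"
        by (intro exI[of _ "{i}"] exI[of _ "{x. (i, x) \<in> U}"]) (auto simp: openin_sum_topology)
    qed
  next
    assume U: "openin (prod_topology (discrete_topology UNIV) Y) U"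
    have "openin Y {x. (i, x) \<in> U}" for i
    proof (subst openin_subopen, intro ballI)
      fix x assume "x \<in> {x. (i, x) \<in> U}"
      then have "(i, x) \<in> U" by simp
      from openin_prod_topology_alt[THEN iffD1, OF U, rule_format, OF this]
      obtain V W where "openin Y W" "i \<in> V" "x \<in> W" "V \<times> W \<subseteq> U" by metis
      then show "\<exists>T. openin Y T \<and> x \<in> T \<and> T \<subseteq> {x. (i, x) \<in> U}" by blast
    qed
    then show "openin (sum_topology (\<lambda>_. Y) UNIV) U"
      using openin_subset[OF U] by (auto simp: openin_sum_topology)
  qed
qed

definition two_tori :: "(bool \<times> complex \<times> complex) topology" where
  "two_tori = prod_topology (discrete_topology UNIV) (top_of_set solid_torus)"

definition pieces :: "(complex \<times> complex) set \<Rightarrow> (complex \<times> complex) set \<Rightarrow> (bool \<times> complex \<times> complex) set" where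
  "pieces A B = {False} \<times> A \<union> {True} \<times> B"

text \<open>Containing the whole punctured torus makes a pair of such sets saturated for the gluing,
  and openness then passes to the image in the quotient.\<close>

definition collared :: "(complex \<times> complex) set \<Rightarrow> bool" where
  "collared A \<longleftrightarrow> torus - punctures \<subseteq> A \<and> A \<subseteq> solid_torus - trivial_arc \<and> openin (top_of_set solid_torus) A"

lemma openin_off:
  assumes "continuous_on (sphere 0 1) c" shows "openin (top_of_set solid_torus) (off c)"
proof -
  have "continuous_on solid_torus (\<lambda>p. c (fst p))"
    by (rule continuous_on_compose2[OF assms]) (auto intro!: continuous_intros simp: solid_torus_def)
  then have "continuous_on solid_torus (\<lambda>p. snd p - c (fst p))"
    by (intro continuous_intros)
  then have "openin (top_of_set solid_torus) (solid_torus \<inter> (\<lambda>p. snd p - c (fst p)) -` (- {0}))"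
    by (rule continuous_openin_preimage_gen) auto
  also have "solid_torus \<inter> (\<lambda>p. snd p - c (fst p)) -` (- {0}) = off c"
    by (auto simp: off_def)
  finally show ?thesis .
qed

lemma collared_off: "collared (off core_center)" "collared (solid_torus - trivial_arc)"
  using off_core_center_subset punctured_torus_subset openin_off[OF continuous_on_centers(1)]
    openin_off[OF continuous_on_centers(2)]
  by (auto simp: collared_def off_arc_center)

lemma collared_torus: "collared A \<Longrightarrow> p \<in> A \<Longrightarrow> p \<in> torus \<Longrightarrow> p \<in> torus - punctures"
  using trivial_arc_boundary by (auto simp: collared_def)

text \<open>The inverse \<open>g\<close> is a parameter because collapsing a collar of the first
  copy into the second copy moves boundary points by \<open>g\<close>.\<close>

locale torus_gluing =
  fixes h g :: "complex \<times> complex \<Rightarrow> complex \<times> complex"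
  assumes hg: "homeomorphic_maps (top_of_set torus) (top_of_set torus) h g"
    and fix_punctures: "\<And>z. z \<in> punctures \<Longrightarrow> h z = z"
begin

lemma h_torus: "z \<in> torus \<Longrightarrow> h z \<in> torus" "z \<in> torus \<Longrightarrow> g z \<in> torus"
  "z \<in> torus \<Longrightarrow> g (h z) = z" "z \<in> torus \<Longrightarrow> h (g z) = z"
  using hg by (auto simp: homeomorphic_maps_def)

lemma punctures_torus: "punctures \<subseteq> torus"
  using trivial_arc_boundary by auto

lemma h_punctures: "z \<in> torus \<Longrightarrow> h z \<in> punctures \<longleftrightarrow> z \<in> punctures"
    "z \<in> torus \<Longrightarrow> g z \<in> punctures \<longleftrightarrow> z \<in> punctures"
  using fix_punctures punctures_torus h_torus by (metis subsetD)+

lemma h_punctured_torus: "z \<in> torus - punctures \<Longrightarrow> h z \<in> torus - punctures"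
  "z \<in> torus - punctures \<Longrightarrow> g z \<in> torus - punctures"
  using h_torus h_punctures by auto

lemma continuous_h: "continuous_map punctured_torus punctured_torus h"
  "continuous_map punctured_torus punctured_torus g"
proof -
  have "continuous_on torus h" "continuous_on torus g" using hg by (auto simp: homeomorphic_maps_def)
  then show "continuous_map punctured_torus punctured_torus h"
    "continuous_map punctured_torus punctured_torus g"
    using h_punctured_torus by (auto simp: punctured_torus_def intro: continuous_on_subset)
qed

abbreviation M where "M \<equiv> link_complement (ambient h) (knot h)"

lemma quotient_map_glue: "quotient_map two_tori (ambient h) (glue h)"
  unfolding ambient_def two_tori_def sum_topology_const by (rule quotient_map_quotient_topology)

lemma topspace_two_tori: "topspace two_tori = UNIV \<times> solid_torus"
  by (simp add: two_tori_def)

lemma glue_simps: "glue h (False, z) = (False, z)" "z \<in> torus \<Longrightarrow> glue h (True, z) = (False, h z)"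
  "z \<notin> torus \<Longrightarrow> glue h (True, z) = (True, z)"
  by (auto simp: glue_def)

text \<open>Distinct points with the same image are \<open>z\<close> on the boundary of the second
  copy and \<open>h z\<close> on that of the first. If one lies in its collared set, it is not a
  puncture; neither is the other, which therefore lies in its collared set too.\<close>

lemma glue_saturated:
  assumes A: "collared A" and B: "collared B"
  shows "{x \<in> topspace two_tori. glue h x \<in> glue h ` pieces A B} = pieces A B"
proof (intro equalityI subsetI)
  fix x assume "x \<in> pieces A B"
  then show "x \<in> {x \<in> topspace two_tori. glue h x \<in> glue h ` pieces A B}"
    using A B by (auto simp: topspace_two_tori pieces_def collared_def)
next
  fix x assume "x \<in> {x \<in> topspace two_tori. glue h x \<in> glue h ` pieces A B}"
  then obtain y where x: "x \<in> UNIV \<times> solid_torus" and y: "y \<in> pieces A B" and xy: "glue h x = glue h y"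
    unfolding topspace_two_tori by blast
  obtain i z j w where ij: "x = (i, z)" "y = (j, w)" by (cases x, cases y)
  have T: "torus - punctures \<subseteq> A" "torus - punctures \<subseteq> B" using A B by (auto simp: collared_def)
  consider "i \<and> z \<in> torus" "j \<and> w \<in> torus" | "i \<and> z \<in> torus" "\<not> (j \<and> w \<in> torus)"
    | "\<not> (i \<and> z \<in> torus)" "j \<and> w \<in> torus" | "\<not> (i \<and> z \<in> torus)" "\<not> (j \<and> w \<in> torus)" by blast
  then show "x \<in> pieces A B"
  proof cases
    case 1
    then have "h z = h w" using xy ij by (auto simp: glue_def)
    then have "z = w" using 1 h_torus(3) by metis
    then show ?thesis using 1 y ij by auto
  next
    case 2
    then have "j = False" "w = h z" using xy ij by (auto simp: glue_def)
    then have "h z \<in> A" using y ij by (auto simp: pieces_def)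
    then have "h z \<in> torus - punctures" using 2 h_torus(1) collared_torus[OF A] by blast
    then have "z \<in> torus - punctures" using 2 h_punctures(1) by blast
    then show ?thesis using T 2 ij by (auto simp: pieces_def)
  next
    case 3
    then have i: "i = False" "z = h w" using xy ij by (auto simp: glue_def)
    have "w \<in> B" using y ij 3 by (auto simp: pieces_def)
    then have "w \<in> torus - punctures" using 3 collared_torus[OF B] by blast
    then have "h w \<in> A" using h_punctured_torus(1) T by blast
    then show ?thesis using i ij by (auto simp: pieces_def)
  next
    case 4
    then have "x = y" using xy ij by (auto simp: glue_def)
    then show ?thesis using y by simp
  qed
qed

lemma openin_pieces:
  assumes "openin (top_of_set solid_torus) A" "openin (top_of_set solid_torus) B"
  shows "openin two_tori (pieces A B)"
  unfolding pieces_def two_tori_def using assms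
  by (intro openin_Un) (auto simp: openin_prod_Times_iff)

lemma openin_glue_pieces:
  assumes A: "collared A" and B: "collared B"
  shows "openin (ambient h) (glue h ` pieces A B)"
proof -
  have "pieces A B \<subseteq> topspace two_tori"
    using A B by (auto simp: topspace_two_tori pieces_def collared_def)
  then have "glue h ` pieces A B \<subseteq> topspace (ambient h)"
    using quotient_imp_surjective_map[OF quotient_map_glue] by blast
  moreover have "openin two_tori {x \<in> topspace two_tori. glue h x \<in> glue h ` pieces A B}"
    unfolding glue_saturated[OF A B] using A B by (intro openin_pieces) (auto simp: collared_def)
  ultimately show ?thesis
    using quotient_map_glue unfolding quotient_map_def by blast
qed

text \<open>Saturation shows that the gluing identifies no point off the arcs with a point on
  them.\<close>

lemma topspace_M: "topspace M = glue h ` pieces (solid_torus - trivial_arc) (solid_torus - trivial_arc)"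
proof -
  let ?S = "solid_torus - trivial_arc"
  have p: "pieces ?S ?S = UNIV \<times> ?S" by (auto simp: pieces_def)
  have top: "topspace (ambient h) = glue h ` (UNIV \<times> solid_torus)"
    using quotient_imp_surjective_map[OF quotient_map_glue] by (simp add: topspace_two_tori)
  note sat = glue_saturated[OF collared_off(2) collared_off(2), unfolded p topspace_two_tori]
  have "glue h ` (UNIV \<times> solid_torus) - knot h = glue h ` (UNIV \<times> ?S)"
  proof (intro equalityI subsetI)
    fix y assume "y \<in> glue h ` (UNIV \<times> solid_torus) - knot h"
    then show "y \<in> glue h ` (UNIV \<times> ?S)" by (auto simp: knot_def)
  next
    fix y assume y: "y \<in> glue h ` (UNIV \<times> ?S)"
    have "y \<notin> knot h"
    proof
      assume "y \<in> knot h"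
      then obtain x where x: "x \<in> UNIV \<times> trivial_arc" "y = glue h x" by (auto simp: knot_def)
      then have "x \<in> {x \<in> UNIV \<times> solid_torus. glue h x \<in> glue h ` (UNIV \<times> ?S)}"
        using y trivial_arc_subset by auto
      then show False using x unfolding sat by auto
    qed
    then show "y \<in> glue h ` (UNIV \<times> solid_torus) - knot h" using y by auto
  qed
  then show ?thesis by (auto simp: link_complement_def top p)
qed

lemma glue_pieces_subset:
  assumes "collared A" "collared B" shows "glue h ` pieces A B \<subseteq> topspace M"
  using assms unfolding topspace_M by - (rule image_mono, auto simp: pieces_def collared_def)

lemma subtopology_M:
  assumes "collared A" "collared B"
  shows "subtopology M (glue h ` pieces A B) = subtopology (ambient h) (glue h ` pieces A B)"
proof -
  have "topspace M \<subseteq> topspace (ambient h) - knot h"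
    unfolding link_complement_def topspace_subtopology by blast
  then have "glue h ` pieces A B \<subseteq> topspace (ambient h) - knot h"
    using glue_pieces_subset[OF assms] by blast
  then show ?thesis
    unfolding link_complement_def subtopology_subtopology by (simp only: Int_absorb1)
qed

lemma openin_M_glue_pieces:
  assumes "collared A" "collared B" shows "openin M (glue h ` pieces A B)"
  using openin_glue_pieces[OF assms] glue_pieces_subset[OF assms]
  unfolding link_complement_def by (auto simp: openin_subtopology)

text \<open>The product of the gluing with the interval is again a quotient map, because the
  interval is compact Hausdorff. So continuity can be checked before gluing, on the two open pieces
  separately, once the two formulas agree at identified points.\<close>

lemma continuous_map_glue:
  fixes \<alpha> \<beta> :: "real \<times> complex \<times> complex \<Rightarrow> 'c"
  assumes A: "collared A" and B: "collared B"
    and a: "continuous_map (prod_topology (top_of_set {0..1}) (top_of_set A)) Y \<alpha>"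
    and b: "continuous_map (prod_topology (top_of_set {0..1}) (top_of_set B)) Y \<beta>"
    and eq: "\<And>t z. 0 \<le> t \<Longrightarrow> t \<le> 1 \<Longrightarrow> z \<in> torus - punctures \<Longrightarrow> \<beta> (t, z) = \<alpha> (t, h z)"
  shows "continuous_map (prod_topology (top_of_set {0..1}) (subtopology M (glue h ` pieces A B))) Y
           (\<lambda>(t, i, z). if i then \<beta> (t, z) else \<alpha> (t, z))"
proof -
  let ?I = "top_of_set {0..1::real}"
  let ?G = "pieces A B"
  let ?F = "\<lambda>(t, i, z). if i then \<beta> (t, z) else \<alpha> (t, z)"
  let ?q = "\<lambda>(t, x). (t, glue h x)"
  let ?P = "prod_topology ?I (subtopology two_tori ?G)"
  have "quotient_map (subtopology two_tori ?G) (subtopology (ambient h) (glue h ` ?G)) (glue h)"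
    using quotient_map_restriction[OF quotient_map_glue glue_saturated[OF A B]] openin_glue_pieces[OF A B] by blast
  then have q: "quotient_map ?P (prod_topology ?I (subtopology M (glue h ` ?G))) ?q"
    unfolding subtopology_M[OF A B]
    by (intro quotient_map_prod_right disjI1 compact_imp_locally_compact_space Hausdorff_space_subtopology
        Hausdorff_space_euclidean) (simp_all add: compact_space_subtopology)
  define T where "T i = {0..1::real} \<times> ({i} \<times> (if i then B else A))" for i
  have G: "?G \<subseteq> topspace two_tori" using A B by (auto simp: topspace_two_tori pieces_def collared_def)
  have "continuous_map ?P Y ?F"
  proof (rule pasting_lemma[where I=UNIV and T=T and f="\<lambda>i (t, j, z). if i then \<beta> (t, z) else \<alpha> (t, z)"])
    fix i
    let ?A = "if i then B else A"
    have "openin two_tori ({i} \<times> ?A)"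
      using A B unfolding two_tori_def openin_prod_Times_iff by (auto simp: collared_def)
    moreover have "{i} \<times> ?A \<subseteq> ?G" by (auto simp: pieces_def)
    ultimately have "openin (subtopology two_tori ?G) ({i} \<times> ?A)"
      by (metis inf.absorb_iff1 openin_subtopology)
    then show "openin ?P (T i)"
      unfolding T_def openin_prod_Times_iff by (auto simp: openin_subtopology_self)
    have "continuous_map (subtopology ?P (T i)) (prod_topology ?I (top_of_set ?A)) (\<lambda>x. (fst x, snd (snd x)))"
    proof (rule continuous_map_pairedI)
      show "continuous_map (subtopology ?P (T i)) ?I fst"
        by (intro continuous_map_from_subtopology continuous_map_fst)
      have "continuous_map two_tori (top_of_set solid_torus) snd"
        unfolding two_tori_def by (rule continuous_map_snd)
      then have "continuous_map ?P (top_of_set solid_torus) (snd \<circ> snd)"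
        using continuous_map_compose[OF continuous_map_snd continuous_map_from_subtopology] by blast
      then have "continuous_map (subtopology ?P (T i)) (top_of_set solid_torus) (\<lambda>x. snd (snd x))"
        unfolding o_def by (rule continuous_map_from_subtopology)
      then show "continuous_map (subtopology ?P (T i)) (top_of_set ?A) (\<lambda>x. snd (snd x))"
        by (auto simp: continuous_map_in_subtopology T_def)
    qed
    from continuous_map_compose[OF this, of Y "if i then \<beta> else \<alpha>"] a b
    show "continuous_map (subtopology ?P (T i)) Y (\<lambda>(t, j, z). if i then \<beta> (t, z) else \<alpha> (t, z))"
      by (cases i) (auto simp: o_def case_prod_unfold)
  next
    fix i j x assume "x \<in> topspace ?P \<inter> T i \<inter> T j"
    then have "i = j" by (auto simp: T_def)
    then show "(case x of (t, j, z) \<Rightarrow> if i then \<beta> (t, z) else \<alpha> (t, z))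
        = (case x of (t, ja, z) \<Rightarrow> if j then \<beta> (t, z) else \<alpha> (t, z))" by simp
  next
    fix x assume x: "x \<in> topspace ?P"
    obtain t i z where tiz: "x = (t, i, z)" by (cases x)
    have "x \<in> T i" using x by (cases i) (auto simp: tiz T_def pieces_def)
    then show "\<exists>j. j \<in> UNIV \<and> x \<in> T j \<and> ?F x = (case x of (t, ja, z) \<Rightarrow> if j then \<beta> (t, z) else \<alpha> (t, z))"
      by (intro exI[of _ i]) (simp add: tiz)
  qed
  \<comment> \<open>\<open>?F\<close> is read off the canonical representative, which for a glued
    boundary point has the tag \<open>False\<close>; the hypothesis \<open>eq\<close> says that the
    other representative gives the same value.\<close>
  moreover have "(?F \<circ> ?q) x = ?F x" if "x \<in> topspace ?P" for x
  proof -
    obtain t i z where x: "x = (t, i, z)" by (cases x)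
    with that have t: "0 \<le> t" "t \<le> 1" and z: "(i, z) \<in> ?G" using G by auto
    show ?thesis
    proof (cases "i \<and> z \<in> torus")
      case True
      then have "z \<in> torus - punctures" using z collared_torus[OF B] by (auto simp: pieces_def)
      then show ?thesis using True x eq[OF t] by (simp add: glue_simps)
    next
      case False
      then have "glue h (i, z) = (i, z)" by (auto simp: glue_def)
      then show ?thesis by (simp add: x)
    qed
  qed
  ultimately have "continuous_map ?P Y (?F \<circ> ?q)"
    using continuous_map_eq by (metis (no_types, lifting))
  then show ?thesis by (rule continuous_compose_quotient_map[OF q])
qed

end

lemma continuous_map_ray_flow:
  "continuous_map (prod_topology (top_of_set {0..1}) (top_of_set (off core_center))) (top_of_set (off core_center))
    (\<lambda>x. ray_flow core_center (fst x) (snd x))"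
  using continuous_on_ray_flow[OF continuous_on_centers(2)] ray_flow_off[of _ _ core_center]
  by (auto simp: case_prod_unfold)

text \<open>Flow lines join every point to the path-connected punctured torus.\<close>

lemma path_connected_off_core: "path_connected (off core_center)"
proof -
  let ?N = "off core_center"
  have *: "path_component ?N p (ray_flow core_center 1 p)" if p: "p \<in> ?N" for p
  proof -
    have "continuous_on {0..1} (\<lambda>t. (\<lambda>(t, p). ray_flow core_center t p) (t, p))"
      using p by (intro continuous_on_compose2[OF continuous_on_ray_flow[OF continuous_on_centers(2)]])
        (auto intro!: continuous_intros)
    then show ?thesis
      unfolding path_component_def path_def path_image_def pathstart_def pathfinish_def
      using p ray_flow_off[OF _ _ p] by (intro exI[of _ "\<lambda>t. ray_flow core_center t p"]) auto
  qed
  show ?thesis unfolding path_connected_component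
  proof (intro ballI)
    fix p q assume p: "p \<in> ?N" and q: "q \<in> ?N"
    have "ray_flow core_center 1 r \<in> torus - punctures" if "r \<in> ?N" for r
      using ray_flow_off[OF _ _ that, of 1] ray_flow_1[OF that] torus_off by auto
    with p q have "path_component (torus - punctures) (ray_flow core_center 1 p) (ray_flow core_center 1 q)"
      using path_connected_punctured_torus unfolding path_connected_component by blast
    then have "path_component ?N (ray_flow core_center 1 p) (ray_flow core_center 1 q)"
      using punctured_torus_subset(1) path_component_of_subset by blast
    then show "path_component ?N p q"
      using *[OF p] *[OF q] path_component_trans path_component_sym by metis
  qed
qed

section \<open>Collapsing the collars, and Mayer-Vietoris for the knot complement\<close>

context torus_gluing
begin

abbreviation S where "S \<equiv> solid_torus - trivial_arc"
abbreviation N where "N \<equiv> off core_center"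
abbreviation ray where "ray \<equiv> ray_flow core_center"

lemma ray_torus: "z \<in> torus \<Longrightarrow> ray t z = z"
  by (rule ray_flow_core_fixed)

lemma ray_1_torus: "z \<in> N \<Longrightarrow> ray 1 z \<in> torus"
  by (rule ray_flow_1)

text \<open>\<open>glue h\<close> picks representatives among the points themselves and fixes them,
  so the image of \<open>pieces A B\<close> is a subset of \<open>pieces A B\<close> and maps on it
  can be defined by cases on the tag.\<close>

lemma glued_pieces:
  assumes A: "collared A" and B: "collared B" and y: "y \<in> glue h ` pieces A B"
  shows "y \<in> pieces A B" "glue h y = y"
proof -
  obtain i z where x: "(i, z) \<in> pieces A B" "y = glue h (i, z)" using y by auto
  have "y \<in> pieces A B \<and> glue h y = y"
  proof (cases "i \<and> z \<in> torus")
    case True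
    then have "z \<in> torus - punctures" using x collared_torus[OF B] by (auto simp: pieces_def)
    then have "h z \<in> A" using h_punctured_torus(1)[of z] A unfolding collared_def by blast
    then show ?thesis using True x by (simp add: glue_simps pieces_def)
  next
    case False
    then have "glue h (i, z) = (i, z)" by (auto simp: glue_def)
    then show ?thesis using x by simp
  qed
  then show "y \<in> pieces A B" "glue h y = y" by auto
qed

lemma glue_Int:
  assumes "collared A" "collared B" "collared A'" "collared B'"
  shows "glue h ` pieces A B \<inter> glue h ` pieces A' B' = glue h ` pieces (A \<inter> A') (B \<inter> B')"
proof (intro equalityI subsetI)
  fix y assume y: "y \<in> glue h ` pieces A B \<inter> glue h ` pieces A' B'"
  then have "y \<in> pieces A B" "y \<in> pieces A' B'" and e: "glue h y = y"
    using glued_pieces[OF assms(1,2), of y] glued_pieces[OF assms(3,4), of y] by blast+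
  then have "y \<in> pieces (A \<inter> A') (B \<inter> B')" unfolding pieces_def by blast
  then show "y \<in> glue h ` pieces (A \<inter> A') (B \<inter> B')" using e by (metis imageI)
qed (auto simp: pieces_def)

lemma N_Int: "S \<inter> N = N" "N \<inter> S = N"
  using off_core_center_subset off_arc_center by auto

lemma topspace_collar:
  "collared A \<Longrightarrow> collared B \<Longrightarrow> topspace (subtopology M (glue h ` pieces A B)) = glue h ` pieces A B"
  using glue_pieces_subset[of A B] unfolding topspace_subtopology by blast

lemma homotopic_glue:
  fixes \<alpha> \<beta> :: "real \<times> complex \<times> complex \<Rightarrow> 'c"
  assumes A: "collared A" and B: "collared B"
    and a: "continuous_map (prod_topology (top_of_set {0..1}) (top_of_set A)) Y \<alpha>"
    and b: "continuous_map (prod_topology (top_of_set {0..1}) (top_of_set B)) Y \<beta>"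
    and eq: "\<And>t z. 0 \<le> t \<Longrightarrow> t \<le> 1 \<Longrightarrow> z \<in> torus - punctures \<Longrightarrow> \<beta> (t, z) = \<alpha> (t, h z)"
    and p: "\<And>z. z \<in> A \<Longrightarrow> p (False, z) = \<alpha> (0, z)" "\<And>z. z \<in> B \<Longrightarrow> p (True, z) = \<beta> (0, z)"
    and q: "\<And>z. z \<in> A \<Longrightarrow> q (False, z) = \<alpha> (1, z)" "\<And>z. z \<in> B \<Longrightarrow> q (True, z) = \<beta> (1, z)"
  shows "homotopic_with (\<lambda>_. True) (subtopology M (glue h ` pieces A B)) Y p q"
proof (subst homotopic_with)
  let ?H = "\<lambda>(t, i, z). if i then \<beta> (t, z) else \<alpha> (t, z)"
  have "?H (0, x) = p x \<and> ?H (1, x) = q x" if "x \<in> topspace (subtopology M (glue h ` pieces A B))" for x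
  proof -
    have "x \<in> pieces A B" using that glued_pieces(1)[OF A B] unfolding topspace_collar[OF A B] by blast
    then show ?thesis using p q by (auto simp: pieces_def)
  qed
  then show "\<exists>k. continuous_map (prod_topology (top_of_set {0..1::real}) (subtopology M (glue h ` pieces A B))) Y k \<and>
      (\<forall>x\<in>topspace (subtopology M (glue h ` pieces A B)). k (0, x) = p x) \<and>
      (\<forall>x\<in>topspace (subtopology M (glue h ` pieces A B)). k (1, x) = q x) \<and> (\<forall>t\<in>{0..1::real}. True)"
    using continuous_map_glue[OF A B a b eq] by blast
qed simp

lemma continuous_map_inclusion: "continuous_map arc_complement M (\<lambda>z. glue h (i, z))"
proof -
  have "continuous_map arc_complement two_tori (\<lambda>z. (i, z))"
    unfolding two_tori_def by (intro continuous_map_pairedI) auto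
  from continuous_map_compose[OF this quotient_imp_continuous_map[OF quotient_map_glue]]
  have c: "continuous_map arc_complement (ambient h) (\<lambda>z. glue h (i, z))" by (simp add: o_def)
  have "glue h (i, z) \<in> topspace M" if "z \<in> S" for z
    using that unfolding topspace_M by (cases i) (auto simp: pieces_def)
  then have "(\<lambda>z. glue h (i, z)) \<in> topspace arc_complement \<rightarrow> topspace (ambient h) - knot h"
    unfolding link_complement_def topspace_subtopology by auto
  with c show ?thesis
    unfolding link_complement_def continuous_map_in_subtopology by blast
qed

text \<open>The knot complement is covered by \<open>glue h ` pieces S N\<close> and \<open>glue h ` pieces N S\<close>, that is, by each arc
  complement thickened by a collar inside the other one. The maps below collapse these two sets onto
  the arc complements and their intersection onto the punctured torus, the latter seen from the second
  solid torus.\<close>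

definition ret_False where "ret_False = (\<lambda>(i, z). if i then h (ray 1 z) else z)"
definition ret_True where "ret_True = (\<lambda>(i, z). if i then z else g (ray 1 z))"
definition ret_both where "ret_both = (\<lambda>(i, z). if i then ray 1 z else g (ray 1 z))"

lemma collared_NS: "collared N" "collared S"
  by (rule collared_off)+

lemma continuous_map_const_time:
  assumes "continuous_map (top_of_set A) Y f"
  shows "continuous_map (prod_topology (top_of_set {0..1::real}) (top_of_set A)) Y (\<lambda>x. f (snd x))"
  using continuous_map_compose[OF continuous_map_snd assms] unfolding o_def .

lemma continuous_ray_1:
  "continuous_map (top_of_set N) punctured_torus (ray 1)"
  "continuous_map (top_of_set N) punctured_torus (\<lambda>z. h (ray 1 z))"
  "continuous_map (top_of_set N) punctured_torus (\<lambda>z. g (ray 1 z))"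
proof -
  show r: "continuous_map (top_of_set N) punctured_torus (ray 1)"
    by (rule continuous_map_ray_flow_1) simp
  show "continuous_map (top_of_set N) punctured_torus (\<lambda>z. h (ray 1 z))"
    "continuous_map (top_of_set N) punctured_torus (\<lambda>z. g (ray 1 z))"
    using continuous_map_compose[OF r continuous_h(1)] continuous_map_compose[OF r continuous_h(2)]
    by (simp_all add: o_def)
qed

lemma continuous_into_arc_complement:
  assumes "continuous_map X punctured_torus f" shows "continuous_map X arc_complement f"
  using assms punctured_torus_subset(2) unfolding punctured_torus_def continuous_map_in_subtopology by auto

lemma continuous_ray:
  "continuous_map (prod_topology (top_of_set {0..1}) (top_of_set N)) arc_complement (\<lambda>x. ray (fst x) (snd x))"
  using continuous_map_ray_flow off_core_center_subset off_arc_center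
  unfolding continuous_map_in_subtopology by auto

lemma continuous_arc_complement_id: "continuous_map (top_of_set S) arc_complement (\<lambda>z. z)"
  using continuous_map_id[of arc_complement] by (simp add: id_def)

text \<open>These supply the compatibility of the collapsing maps with the gluing. They rest on the
  flow fixing the boundary at every time \<open>t\<close>, not only at its end.\<close>

lemma ray_gluing: "z \<in> torus - punctures \<Longrightarrow> g (ray t (h z)) = z" "z \<in> torus - punctures \<Longrightarrow> h (ray t z) = h z"
   "z \<in> torus - punctures \<Longrightarrow> ray t (h z) = h z"
  using h_torus by (auto simp: ray_torus)

lemma continuous_ret_False: "continuous_map (subtopology M (glue h ` pieces S N)) arc_complement ret_False"
proof -
  \<comment> \<open>A homotopy that is constant in time; only the continuity of its end is
    extracted.\<close>
  have "homotopic_with (\<lambda>_. True) (subtopology M (glue h ` pieces S N)) arc_complement ret_False ret_False"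
    by (rule homotopic_glue[OF collared_NS(2,1) continuous_map_const_time[OF continuous_arc_complement_id] continuous_map_const_time[OF continuous_into_arc_complement[OF continuous_ray_1(2)]]])
      (auto simp: ret_False_def ray_gluing)
  then show ?thesis using homotopic_with_imp_continuous_maps by blast
qed

lemma continuous_ret_True: "continuous_map (subtopology M (glue h ` pieces N S)) arc_complement ret_True"
proof -
  have "homotopic_with (\<lambda>_. True) (subtopology M (glue h ` pieces N S)) arc_complement ret_True ret_True"
    by (rule homotopic_glue[OF collared_NS(1,2) continuous_map_const_time[OF continuous_into_arc_complement[OF continuous_ray_1(3)]] continuous_map_const_time[OF continuous_arc_complement_id]])
      (simp_all add: ret_True_def ray_torus h_torus)
  then show ?thesis using homotopic_with_imp_continuous_maps by blast
qed

lemma continuous_ret_both: "continuous_map (subtopology M (glue h ` pieces N N)) punctured_torus ret_both"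
proof -
  have "homotopic_with (\<lambda>_. True) (subtopology M (glue h ` pieces N N)) punctured_torus ret_both ret_both"
    by (rule homotopic_glue[OF collared_NS(1,1) continuous_map_const_time[OF continuous_ray_1(3)] continuous_map_const_time[OF continuous_ray_1(1)]])
      (simp_all add: ret_both_def ray_torus h_torus)
  then show ?thesis using homotopic_with_imp_continuous_maps by blast
qed

text \<open>The flow pushes the collar in the second copy to the boundary, whose points the gluing
  already identifies with points of the first copy; meanwhile the first copy stays fixed.\<close>

lemma collapse_False:
  assumes u: "one_cycle (subtopology M (glue h ` pieces S N)) u"
  shows "one_boundary M (u - push (\<lambda>z. glue h (False, z)) (push ret_False u))"
proof -
  have h: "homotopic_with (\<lambda>_. True) (subtopology M (glue h ` pieces S N)) M (glue h) ((\<lambda>z. glue h (False, z)) \<circ> ret_False)"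
  proof (rule homotopic_glue[OF collared_NS(2,1)])
    show "continuous_map (prod_topology (top_of_set {0..1::real}) (top_of_set S)) M (\<lambda>x. glue h (False, snd x))"
      by (rule continuous_map_const_time[OF continuous_map_inclusion])
    show "continuous_map (prod_topology (top_of_set {0..1::real}) (top_of_set N)) M (\<lambda>x. glue h (True, ray (fst x) (snd x)))"
      using continuous_map_compose[OF continuous_ray continuous_map_inclusion] by (simp add: o_def)
  qed (use ray_1_torus h_torus in \<open>auto simp: ret_False_def ray_gluing ray_torus glue_simps\<close>)
  \<comment> \<open>The homotopy starts at \<open>glue h\<close>, which is the identity on
    representatives.\<close>
  have "push (glue h) u = u"
    using glued_pieces(2)[OF collared_NS(2,1)] topspace_collar[OF collared_NS(2,1)]
    by (intro push_ident[OF u]) blast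
  then show ?thesis using one_boundary_homotopic[OF h u] by (simp add: push_push)
qed

lemma collapse_True:
  assumes u: "one_cycle (subtopology M (glue h ` pieces N S)) u"
  shows "one_boundary M (u - push (\<lambda>z. glue h (True, z)) (push ret_True u))"
proof -
  have h: "homotopic_with (\<lambda>_. True) (subtopology M (glue h ` pieces N S)) M (glue h) ((\<lambda>z. glue h (True, z)) \<circ> ret_True)"
  proof (rule homotopic_glue[OF collared_NS(1,2)])
    show "continuous_map (prod_topology (top_of_set {0..1::real}) (top_of_set S)) M (\<lambda>x. glue h (True, snd x))"
      by (rule continuous_map_const_time[OF continuous_map_inclusion])
    show "continuous_map (prod_topology (top_of_set {0..1::real}) (top_of_set N)) M (\<lambda>x. glue h (False, ray (fst x) (snd x)))"
      using continuous_map_compose[OF continuous_ray continuous_map_inclusion] by (simp add: o_def)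
  qed (use ray_1_torus h_torus in \<open>auto simp: ret_True_def ray_gluing ray_torus glue_simps\<close>)
  have "push (glue h) u = u"
    using glued_pieces(2)[OF collared_NS(1,2)] topspace_collar[OF collared_NS(1,2)]
    by (intro push_ident[OF u]) blast
  then show ?thesis using one_boundary_homotopic[OF h u] by (simp add: push_push)
qed

text \<open>On one copy the two maps agree, on the other they differ by the flow, which provides the
  homotopy. The map \<open>h\<close> enters for the first arc complement because
  \<open>ret_both\<close> uses the coordinates of the second copy.\<close>

lemma collapse_both:
  assumes c: "one_cycle (subtopology M (glue h ` pieces N N)) c"
  shows "one_boundary arc_complement (push ret_False c - push h (push ret_both c))"
    and "one_boundary arc_complement (push ret_True c - push ret_both c)"
proof -
  have h1: "homotopic_with (\<lambda>_. True) (subtopology M (glue h ` pieces N N)) arc_complement ret_False (h \<circ> ret_both)"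
    by (rule homotopic_glue[OF collared_NS(1,1) continuous_ray continuous_map_const_time[OF continuous_into_arc_complement[OF continuous_ray_1(2)]]])
      (use ray_1_torus h_torus in \<open>auto simp: ret_False_def ret_both_def ray_gluing\<close>)
  show "one_boundary arc_complement (push ret_False c - push h (push ret_both c))"
    using one_boundary_homotopic[OF h1 c] by (simp add: push_push)
  have h2: "homotopic_with (\<lambda>_. True) (subtopology M (glue h ` pieces N N)) arc_complement ret_True ret_both"
    by (rule homotopic_glue[OF collared_NS(1,1) continuous_map_const_time[OF continuous_into_arc_complement[OF continuous_ray_1(3)]] continuous_ray])
      (use ray_1_torus h_torus in \<open>auto simp: ret_True_def ret_both_def ray_gluing ray_torus\<close>)
  show "one_boundary arc_complement (push ret_True c - push ret_both c)"
    by (rule one_boundary_homotopic[OF h2 c])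
qed

lemma knot_complement_cover:
  "openin M (glue h ` pieces S N)" "openin M (glue h ` pieces N S)"
  "glue h ` pieces S N \<union> glue h ` pieces N S = topspace M"
  "glue h ` pieces S N \<inter> glue h ` pieces N S = glue h ` pieces N N"
proof -
  show "openin M (glue h ` pieces S N)" "openin M (glue h ` pieces N S)"
    by (intro openin_M_glue_pieces collared_NS)+
  have "pieces S N \<union> pieces N S = pieces S S" using N_Int by (auto simp: pieces_def)
  then show "glue h ` pieces S N \<union> glue h ` pieces N S = topspace M"
    unfolding topspace_M by (simp add: image_Un[symmetric])
  show "glue h ` pieces S N \<inter> glue h ` pieces N S = glue h ` pieces N N"
    by (simp add: glue_Int[OF collared_NS(2,1,1,2)] N_Int)
qed

text \<open>The images of the two collars share the glued boundary point that comes from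
  \<open>(1, 1)\<close>.\<close>

lemma path_connected_collar: "path_connected_space (subtopology M (glue h ` pieces N N))"
proof -
  have "path_connectedin arc_complement N"
    using path_connected_off_core N_Int by (auto simp: path_connectedin_subtopology)
  then have "path_connectedin M ((\<lambda>z. glue h (i, z)) ` N)" for i
    using path_connectedin_continuous_map_image[OF continuous_map_inclusion] by blast
  moreover have "(1, 1) \<in> torus - punctures" by (auto simp: torus_def punctures_eq complex_eq_iff)
  then have "(1, 1) \<in> N" "h (1, 1) \<in> N" "glue h (True, (1, 1)) = glue h (False, h (1, 1))"
    using punctured_torus_subset(1) h_punctured_torus(1)[of "(1, 1)"] by (blast, blast, simp add: glue_simps)
  then have "(\<lambda>z. glue h (False, z)) ` N \<inter> (\<lambda>z. glue h (True, z)) ` N \<noteq> {}" by (metis IntI empty_iff imageI)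
  ultimately have "path_connectedin M ((\<lambda>z. glue h (False, z)) ` N \<union> (\<lambda>z. glue h (True, z)) ` N)"
    by (intro path_connectedin_Un) auto
  moreover have "(\<lambda>z. glue h (False, z)) ` N \<union> (\<lambda>z. glue h (True, z)) ` N = glue h ` pieces N N"
    by (auto simp: pieces_def image_def)
  ultimately show ?thesis by (simp add: path_connectedin_def)
qed

lemma push_glue_True:
  assumes "one_cycle punctured_torus y"
  shows "push (\<lambda>z. glue h (True, z)) y = push (\<lambda>z. glue h (False, z)) (push h y)"
  unfolding push_push by (rule push_cong[OF assms]) (auto simp: punctured_torus_def glue_simps)

text \<open>The part of a cycle in the second copy can be moved to the boundary torus, which
  \<open>h\<close> carries into the first copy. So the first arc complement alone accounts for all
  classes.\<close>

proposition knot_complement_cycles: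
  assumes z: "one_cycle M z"
  obtains k m where "one_boundary M (z - push (\<lambda>z. glue h (False, z))
    (frag_cmul k (path_chain alpha) + frag_cmul m (path_chain gamma)))"
proof -
  let ?i = "\<lambda>z. glue h (False, z)" and ?j = "\<lambda>z. glue h (True, z)"
  obtain u v where u: "one_cycle (subtopology M (glue h ` pieces S N)) u"
    and v: "one_cycle (subtopology M (glue h ` pieces N S)) v" and zuv: "one_boundary M (z - (u + v))"
    using Mayer_Vietoris_onto[OF knot_complement_cover(1-3) _ z] path_connected_collar unfolding knot_complement_cover(4) by metis
  define s t where "s = push ret_False u" and "t = push ret_True v"
  have s: "one_cycle arc_complement s" "one_boundary M (u - push ?i s)"
    using one_cycle_push[OF u continuous_ret_False] collapse_False[OF u] by (simp_all add: s_def)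
  have t: "one_cycle arc_complement t" "one_boundary M (v - push ?j t)"
    using one_cycle_push[OF v continuous_ret_True] collapse_True[OF v] by (simp_all add: t_def)
  define y where "y = push (ray_flow arc_center 1) t"
  have y: "one_cycle punctured_torus y" "one_boundary arc_complement (t - y)"
    using off_cycle_from_torus[of arc_center t] t(1) by (auto simp: off_arc_center y_def)
  have ty: "one_boundary M (push ?j t - push ?i (push h y))"
    using one_boundary_push[OF y(2) continuous_map_inclusion[of True]]
    by (simp add: push_diff push_glue_True[OF y(1)])
  have "one_cycle arc_complement (s + push h y)"
    using one_cycle_push[OF y(1) continuous_h(1)] punctured_torus_cycle_mono(1)[OF punctured_torus_subset(2)]
    by (intro one_cycle_add s) blast
  then obtain k m where "one_boundary arc_complement (s + push h y -
      (frag_cmul k (path_chain alpha) + frag_cmul m (path_chain gamma)))"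
    by (rule arc_complement_cycles)
  from one_boundary_push[OF this continuous_map_inclusion[of False]]
  have 1: "one_boundary M (push ?i s + push ?i (push h y) -
      push ?i (frag_cmul k (path_chain alpha) + frag_cmul m (path_chain gamma)))"
    by (simp add: push_diff push_add)
  show thesis
  proof (rule that[of k m])
    have "z - push ?i (frag_cmul k (path_chain alpha) + frag_cmul m (path_chain gamma))
      = (z - (u + v)) + (u - push ?i s) + (v - push ?j t) + (push ?j t - push ?i (push h y))
        + (push ?i s + push ?i (push h y) - push ?i (frag_cmul k (path_chain alpha) + frag_cmul m (path_chain gamma)))"
      by (simp add: algebra_simps)
    then show "one_boundary M (z - push ?i (frag_cmul k (path_chain alpha) + frag_cmul m (path_chain gamma)))"
      by (simp only: one_boundary_add zuv s t ty 1)
  qed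
qed

text \<open>\<open>one_boundary_push_down\<close> replaces \<open>s\<close> by a cycle
  \<open>c\<close> in the overlap that bounds on the side of the second copy. Its collapse
  \<open>y\<close> is then a multiple of \<open>beta\<close> by
  \<open>arc_complement_kernel\<close>, and seen from the first copy it becomes the same multiple of
  \<open>h \<circ> beta\<close>.\<close>

proposition knot_complement_kernel:
  assumes s: "one_cycle arc_complement s" and bd: "one_boundary M (push (\<lambda>z. glue h (False, z)) s)"
  obtains k where "one_boundary arc_complement (s - frag_cmul k (path_chain (h \<circ> beta)))"
proof -
  let ?i = "\<lambda>z. glue h (False, z)"
  let ?U = "subtopology M (glue h ` pieces S N)"
  have "continuous_map arc_complement ?U ?i"
    unfolding continuous_map_in_subtopology using continuous_map_inclusion[of False] by (auto simp: pieces_def)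
  then have u: "one_cycle ?U (push ?i s)" using s one_cycle_push by blast
  obtain c where c: "one_cycle (subtopology M (glue h ` pieces N N)) c"
    and uc: "one_boundary ?U (push ?i s - c)" and vc: "one_boundary (subtopology M (glue h ` pieces N S)) c"
    using one_boundary_push_down[OF knot_complement_cover(1-3) u bd] unfolding knot_complement_cover(4) by blast
  define y where "y = push ret_both c"
  have y: "one_cycle punctured_torus y"
    unfolding y_def using c continuous_ret_both by (rule one_cycle_push)
  have "push ret_False (push ?i s) = s"
    unfolding push_push by (rule push_ident[OF s]) (simp add: ret_False_def glue_simps)
  then have sc: "one_boundary arc_complement (s - push ret_False c)"
    using one_boundary_push[OF uc continuous_ret_False] by (simp add: push_diff)
  have "one_boundary arc_complement (push ret_True c)"
    using one_boundary_push[OF vc continuous_ret_True] .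
  then have "one_boundary arc_complement y"
    using one_boundary_cong[OF collapse_both(2)[OF c]] by (simp add: y_def)
  then obtain k where "one_boundary punctured_torus (y - frag_cmul k (path_chain beta))"
    by (rule arc_complement_kernel[OF y])
  from one_boundary_push[OF this continuous_h(1)]
  have "one_boundary punctured_torus (push h y - frag_cmul k (path_chain (h \<circ> beta)))"
    by (simp add: push_diff push_cmul push_path_chain)
  then have "one_boundary arc_complement (push h y - frag_cmul k (path_chain (h \<circ> beta)))"
    by (rule punctured_torus_cycle_mono(2)[OF punctured_torus_subset(2)])
  with one_boundary_trans[OF sc collapse_both(1)[OF c], folded y_def]
  show thesis using one_boundary_trans that by blast
qed

end

section \<open>Counting homomorphisms into a finite cyclic group\<close>

section \<open>Homomorphisms from a two-generated abelian group to a finite cyclic group\<close>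

text \<open>After division by \<open>d\<close> the coefficient \<open>p'\<close> is invertible
  modulo \<open>n'\<close>, so there is one solution \<open>x0\<close> modulo \<open>n'\<close>. It
  has \<open>d\<close> lifts \<open>x0 + k * n'\<close> in the range below
  \<open>n = d * n'\<close>.\<close>

lemma card_linear_congruence:
  fixes p q :: int and n :: nat
  assumes n: "n > 0" and d: "gcd p (int n) dvd q"
  shows "int (card {x \<in> {0..<int n}. int n dvd p * x + q}) = gcd p (int n)"
proof -
  define d where "d = gcd p (int n)"
  have d0: "d > 0" using n by (simp add: d_def)
  have "d dvd p" "d dvd int n" "d dvd q" using assms(2) by (simp_all add: d_def)
  then obtain p' n' q' where p': "p = d * p'" and n': "int n = d * n'" and q': "q = d * q'"
    by (meson dvdE)
  have n'0: "n' > 0" using n n' d0 by (metis of_nat_0_less_iff zero_less_mult_pos)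
  have cop: "coprime p' n'"
    using gcd_coprime[of p "int n" p' n'] d0 p' n' unfolding d_def[symmetric] by (simp add: mult.commute)
  then obtain y where y: "[p' * y = 1] (mod n')" using cong_solve_coprime_int by blast
  define x0 where "x0 = (- q' * y) mod n'"
  have x0: "0 \<le> x0" "x0 < n'" using n'0 by (simp_all add: x0_def)
  have iff: "int n dvd p * x + q \<longleftrightarrow> n' dvd x - x0" for x
  proof -
    have "int n dvd p * x + q \<longleftrightarrow> n' dvd p' * x + q'"
      using d0 unfolding n' p' q' by (simp add: mult.assoc distrib_left[symmetric])
    also have "\<dots> \<longleftrightarrow> n' dvd p' * (x - x0)"
    proof -
      have "[p' * x0 = p' * (- q' * y)] (mod n')" by (simp add: x0_def cong_def mod_mult_right_eq)
      also have "p' * (- q' * y) = (p' * y) * (- q')" by (simp add: mult_ac)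
      also have "[(p' * y) * (- q') = 1 * (- q')] (mod n')" by (rule cong_scalar_right[OF y])
      finally have "n' dvd p' * x0 + q'" by (simp add: cong_iff_dvd_diff)
      moreover have "p' * x + q' = p' * (x - x0) + (p' * x0 + q')" by (simp add: algebra_simps)
      ultimately show ?thesis by (metis dvd_add_left_iff)
    qed
    also have "\<dots> \<longleftrightarrow> n' dvd x - x0"
      using cop by (simp add: coprime_commute coprime_dvd_mult_right_iff)
    finally show ?thesis .
  qed
  have "bij_betw (\<lambda>k. x0 + k * n') {0..<d} {x \<in> {0..<int n}. int n dvd p * x + q}"
  proof (rule bij_betwI')
    show "x0 + k * n' = x0 + l * n' \<longleftrightarrow> k = l" for k l using n'0 by simp
  next
    fix k assume k: "k \<in> {0..<d}"
    then have "(k + 1) * n' \<le> d * n'" using n'0 by (intro mult_right_mono) auto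
    then show "x0 + k * n' \<in> {x \<in> {0..<int n}. int n dvd p * x + q}"
      using x0 k n'0 unfolding mem_Collect_eq iff unfolding n' by (auto simp: algebra_simps intro: add_nonneg_nonneg)
  next
    fix x assume x: "x \<in> {x \<in> {0..<int n}. int n dvd p * x + q}"
    then have "n' dvd x - x0" unfolding iff by simp
    then obtain k where "x - x0 = n' * k" by (rule dvdE)
    then have k: "x = x0 + k * n'" by (simp add: algebra_simps)
    have "0 \<le> x" "x < d * n'" using x unfolding n'[symmetric] by auto
    then have "- 1 * n' < k * n'" "k * n' < d * n'" using k x0 by linarith+
    then have "k > - 1" "k < d" using n'0 mult_less_cancel_right_pos by blast+
    then show "\<exists>k\<in>{0..<d}. x = x0 + k * n'" using k by (intro bexI[of _ k]) auto
  qed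
  then have "card {0..<d} = card {x \<in> {0..<int n}. int n dvd p * x + q}" by (rule bij_betw_same_card)
  moreover have "int (card {0..<d}) = d" using d0 by simp
  ultimately show ?thesis unfolding d_def by metis
qed

lemma linear_congruence_solvable:
  fixes p q :: int and n :: nat
  assumes n: "n > 0"
  shows "{x \<in> {0..<int n}. int n dvd p * x + q} \<noteq> {} \<longleftrightarrow> gcd p (int n) dvd q"
proof
  assume "{x \<in> {0..<int n}. int n dvd p * x + q} \<noteq> {}"
  then obtain x where "int n dvd p * x + q" by blast
  then have "gcd p (int n) dvd p * x + q" using gcd_dvd2 dvd_trans by blast
  then show "gcd p (int n) dvd q" by (simp add: dvd_add_right_iff)
next
  assume "gcd p (int n) dvd q"
  moreover have "gcd p (int n) \<noteq> 0" using n by simp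
  ultimately have "card {x \<in> {0..<int n}. int n dvd p * x + q} \<noteq> 0"
    using card_linear_congruence[OF n] by (metis of_nat_0)
  then show "{x \<in> {0..<int n}. int n dvd p * x + q} \<noteq> {}" by (metis card.empty)
qed

lemma generate_integer_mod_group:
  assumes n: "n > 0" and m: "m \<in> carrier (integer_mod_group n)"
  shows "generate (integer_mod_group n) {m} = carrier (integer_mod_group n) \<longleftrightarrow> coprime m (int n)"
proof -
  have gen: "generate (integer_mod_group n) {m} = {(k * m) mod int n | k. k \<in> UNIV}"
    using group.generate_pow[OF group_integer_mod_group m] by (simp add: int_pow_integer_mod_group)
  have car: "carrier (integer_mod_group n) = {0..<int n}" using n by (simp add: carrier_integer_mod_group)
  show ?thesis
  proof
    assume "generate (integer_mod_group n) {m} = carrier (integer_mod_group n)"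
    \<comment> \<open>Writing \<open>1 mod int n\<close> covers \<open>n = 1\<close>, where the
      residue of 1 is 0.\<close>
    moreover have "1 mod int n \<in> {0..<int n}" using n by simp
    ultimately have "1 mod int n \<in> {(k * m) mod int n | k. k \<in> UNIV}" using gen car by simp
    then obtain k where "1 mod int n = (k * m) mod int n" by blast
    then have "[m * k = 1] (mod int n)" by (simp add: cong_def mult.commute)
    then show "coprime m (int n)" by (metis coprime_iff_invertible_int)
  next
    assume "coprime m (int n)"
    then obtain y where y: "[m * y = 1] (mod int n)" using cong_solve_coprime_int by blast
    have "x \<in> {(k * m) mod int n | k. k \<in> UNIV}" if "x \<in> {0..<int n}" for x
    proof -
      have "[x * y * m = x] (mod int n)"
        using cong_scalar_left[OF y, of x] by (simp add: mult_ac)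
      then have "x = (x * y * m) mod int n" using that by (simp add: cong_def)
      then show ?thesis by blast
    qed
    then show "generate (integer_mod_group n) {m} = carrier (integer_mod_group n)"
      unfolding gen car using n by auto
  qed
qed

text \<open>Presentation by two generators and one relator, stated through words; \<open>q\<close>
  plays the part of the coefficient of \<open>gamma\<close>.\<close>

locale one_relator = comm_group G for G (structure) +
  fixes A B :: 'a and p q :: int and n :: nat
  assumes AB: "A \<in> carrier G" "B \<in> carrier G"
    and span: "\<And>x. x \<in> carrier G \<Longrightarrow> \<exists>(a::int) (b::int). x = A [^] a \<otimes> B [^] b"
    and rel: "\<And>(a::int) (b::int). A [^] a \<otimes> B [^] b = \<one> \<longleftrightarrow> (\<exists>k. a = k * p \<and> b = k * q)"
    and n: "n > 0"
begin

abbreviation Zn where "Zn \<equiv> integer_mod_group n"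

definition word :: "int \<Rightarrow> int \<Rightarrow> 'a" where
  "word a b = A [^] a \<otimes> B [^] b"

lemma word_closed: "word a b \<in> carrier G"
  using AB by (simp add: word_def)

lemma span_word: "x \<in> carrier G \<Longrightarrow> \<exists>a b. x = word a b"
  unfolding word_def by (rule span)

lemma word_mult: "word a b \<otimes> word a' b' = word (a + a') (b + b')"
proof -
  have "word a b \<otimes> word a' b' = (A [^] a \<otimes> A [^] a') \<otimes> (B [^] b \<otimes> B [^] b')"
    unfolding word_def using AB by (simp add: m_ac)
  then show ?thesis using AB by (simp add: word_def int_pow_mult)
qed

lemma word_AB: "word 1 0 = A" "word 0 1 = B"
  using AB by (simp_all add: word_def int_pow_1)

lemma word_eq:
  assumes "word a b = word a' b'" obtains k where "a = a' + k * p" "b = b' + k * q"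
proof -
  have "word (a - a') (b - b') \<otimes> word a' b' = \<one> \<otimes> word a' b'"
    using assms word_closed by (simp add: word_mult)
  then have "word (a - a') (b - b') = \<one>" using word_closed by (metis one_closed right_cancel)
  then obtain k where "a - a' = k * p" "b - b' = k * q" using rel by (auto simp: word_def)
  then show thesis using that[of k] by (simp add: algebra_simps)
qed

lemma hom_word:
  assumes f: "f \<in> hom G Zn" shows "f (word a b) = (a * f A + b * f B) mod int n"
proof -
  have "f (word a b) = f (A [^] a) \<otimes>\<^bsub>Zn\<^esub> f (B [^] b)"
    unfolding word_def using AB by (intro hom_mult[OF f]) auto
  then show ?thesis
    using hom_int_pow[OF f AB(1) is_group group_integer_mod_group, of a]
      hom_int_pow[OF f AB(2) is_group group_integer_mod_group, of b]
    by (simp add: int_pow_integer_mod_group mod_simps)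
qed

lemma hom_relation:
  assumes f: "f \<in> hom G Zn" shows "int n dvd p * f A + q * f B"
proof -
  have "word p q = \<one>" using rel[of p q] by (auto simp: word_def intro: exI[of _ 1])
  then have "f (word p q) = 0"
    using hom_one[OF f is_group group_integer_mod_group] by simp
  then show ?thesis using hom_word[OF f, of p q] by (simp add: dvd_eq_mod_eq_0)
qed

lemma hom_exists:
  assumes d: "int n dvd p * x + q * y"
  obtains f where "f \<in> hom G Zn" "f A = x mod int n" "f B = y mod int n"
proof -
  \<comment> \<open>An arbitrary word for \<open>X\<close> is chosen. Two words for the same element
    differ by a multiple of the relator, whose prescribed value is divisible by \<open>n\<close>, so
    the choice does not matter.\<close>
  define f where "f X = (let (a, b) = (SOME (a, b). X = word a b) in (a * x + b * y) mod int n)" for X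
  have fw: "f (word a b) = (a * x + b * y) mod int n" for a b
  proof -
    obtain a' b' where ab: "(SOME (a', b'). word a b = word a' b') = (a', b')" by fastforce
    have "case (SOME (a', b'). word a b = word a' b') of (a', b') \<Rightarrow> word a b = word a' b'"
      by (rule someI[of _ "(a, b)"]) simp
    then have "word a b = word a' b'" unfolding ab by simp
    then obtain k where k: "a = a' + k * p" "b = b' + k * q" by (rule word_eq)
    have "f (word a b) = (a' * x + b' * y) mod int n" by (simp add: f_def ab)
    moreover have "int n dvd (a * x + b * y) - (a' * x + b' * y)"
    proof -
      have "(a * x + b * y) - (a' * x + b' * y) = k * (p * x + q * y)"
        unfolding k by (simp add: algebra_simps)
      then show ?thesis using d by simp
    qed
    ultimately show ?thesis by (metis mod_eq_dvd_iff)
  qed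
  have "f \<in> hom G Zn"
  proof (rule homI)
    fix X assume "X \<in> carrier G"
    then obtain a b where "X = word a b" using span_word by blast
    then show "f X \<in> carrier Zn" using n by (simp add: fw carrier_integer_mod_group)
  next
    fix X Y assume "X \<in> carrier G" "Y \<in> carrier G"
    then obtain a b a' b' where X: "X = word a b" and Y: "Y = word a' b'"
      using span_word by blast
    show "f (X \<otimes> Y) = f X \<otimes>\<^bsub>Zn\<^esub> f Y"
      unfolding X Y word_mult fw mult_integer_mod_group mod_add_eq by (simp add: algebra_simps)
  qed
  moreover have "f A = x mod int n" "f B = y mod int n"
    using fw[of 1 0] fw[of 0 1] unfolding word_AB by simp_all
  ultimately show thesis by (rule that)
qed

text \<open>Mirrors \<open>covering_equiv\<close> for an abstract group. Homomorphisms are arbitrary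
  off the carrier, so each has infinitely many variants when there are points outside; comparing
  values on the carrier only removes this ambiguity from the classes.\<close>

definition unit_equiv where
  "unit_equiv = {(f, f'). f \<in> epi G Zn \<and> f' \<in> epi G Zn \<and>
     (\<exists>u\<in>carrier Zn. gcd u (int n) = 1 \<and> (\<forall>c\<in>carrier G. f' c = (u * f c) mod int n))}"

definition generating_epis where
  "generating_epis = {f \<in> epi G Zn. generate Zn {f B} = carrier Zn}"

lemma carrier_Zn: "carrier Zn = {0..<int n}"
  using n by (simp add: carrier_integer_mod_group)

lemma epi_closed: "f \<in> epi G Zn \<Longrightarrow> c \<in> carrier G \<Longrightarrow> f c \<in> {0..<int n}"
  unfolding carrier_Zn[symmetric] by (auto simp: epi_def hom_def)

text \<open>Allows any integer \<open>u\<close> prime to \<open>n\<close>; its residue is the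
  witness in the carrier.\<close>

lemma unit_equivI:
  assumes "f \<in> epi G Zn" "f' \<in> epi G Zn" "coprime u (int n)"
    and "\<And>c. c \<in> carrier G \<Longrightarrow> f' c = (u * f c) mod int n"
  shows "(f, f') \<in> unit_equiv"
proof -
  have "gcd (u mod int n) (int n) = 1" using assms(3) by (metis coprime_iff_gcd_eq_1 gcd_red_int gcd.commute)
  moreover have "u mod int n \<in> carrier Zn" using n by (simp add: carrier_Zn)
  ultimately show ?thesis using assms unfolding unit_equiv_def
    by (auto simp: mod_mult_left_eq intro!: bexI[of _ "u mod int n"])
qed

lemma unit_equivE:
  assumes "(f, f') \<in> unit_equiv"
  obtains u where "coprime u (int n)" "\<And>c. c \<in> carrier G \<Longrightarrow> f' c = (u * f c) mod int n"
  using assms unfolding unit_equiv_def by (auto simp: coprime_iff_gcd_eq_1)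

lemma equiv_unit_equiv: "equiv (epi G Zn) unit_equiv"
proof (rule equivI)
  show "unit_equiv \<subseteq> epi G Zn \<times> epi G Zn" by (auto simp: unit_equiv_def)
  show "refl_on (epi G Zn) unit_equiv"
  proof (rule refl_onI)
    fix f assume f: "f \<in> epi G Zn"
    show "(f, f) \<in> unit_equiv" using f epi_closed[OF f] by (intro unit_equivI[of f f 1]) auto
  qed
  show "sym unit_equiv"
  proof (rule symI)
    fix f f' assume ff: "(f, f') \<in> unit_equiv"
    then have ep: "f \<in> epi G Zn" "f' \<in> epi G Zn" by (auto simp: unit_equiv_def)
    obtain u where u: "coprime u (int n)" and eq: "\<And>c. c \<in> carrier G \<Longrightarrow> f' c = (u * f c) mod int n"
      by (rule unit_equivE[OF ff]) blast
    obtain v where v: "[u * v = 1] (mod int n)" using cong_solve_coprime_int[OF u] by blast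
    have "coprime v (int n)" using v by (metis coprime_iff_invertible_int mult.commute)
    moreover have "f c = (v * f' c) mod int n" if c: "c \<in> carrier G" for c
    proof -
      have "[v * (u * f c) = f c] (mod int n)" using cong_scalar_right[OF v, of "f c"] by (simp add: mult_ac)
      then show ?thesis using epi_closed[OF ep(1) c] eq[OF c] by (simp add: cong_def mod_mult_right_eq)
    qed
    ultimately show "(f', f) \<in> unit_equiv" using ep by (intro unit_equivI)
  qed
  show "trans unit_equiv"
  proof (rule transI)
    fix f f' f'' assume a: "(f, f') \<in> unit_equiv" "(f', f'') \<in> unit_equiv"
    then have ep: "f \<in> epi G Zn" "f'' \<in> epi G Zn" by (auto simp: unit_equiv_def)
    obtain u where u: "coprime u (int n)" "\<And>c. c \<in> carrier G \<Longrightarrow> f' c = (u * f c) mod int n"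
      by (rule unit_equivE[OF a(1)]) blast
    obtain v where v: "coprime v (int n)" "\<And>c. c \<in> carrier G \<Longrightarrow> f'' c = (v * f' c) mod int n"
      by (rule unit_equivE[OF a(2)]) blast
    show "(f, f'') \<in> unit_equiv"
      using u v ep by (intro unit_equivI[of f f'' "v * u"]) (auto simp: mod_mult_right_eq mult.assoc)
  qed
qed

text \<open>The powers of \<open>B\<close> alone already reach every residue.\<close>

lemma epi_if_coprime:
  assumes f: "f \<in> hom G Zn" and c: "coprime (f B) (int n)"
  shows "f \<in> generating_epis"
proof -
  have fB: "f B \<in> carrier Zn" using f AB by (auto simp: hom_def)
  have gen: "generate Zn {f B} = carrier Zn" using generate_integer_mod_group[OF n fB] c by simp
  have "carrier Zn \<subseteq> f ` carrier G"
  proof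
    fix y assume "y \<in> carrier Zn"
    then obtain k where "y = (k * f B) mod int n"
      using group.generate_pow[OF group_integer_mod_group fB] unfolding gen
      by (auto simp: int_pow_integer_mod_group)
    then have "y = f (word 0 k)" using hom_word[OF f, of 0 k] by simp
    then show "y \<in> f ` carrier G" using word_closed by blast
  qed
  then show ?thesis using f gen by (auto simp: generating_epis_def epi_def hom_def)
qed

lemma normal_form_exists:
  assumes "x \<in> {0..<int n}" "int n dvd p * x + q"
  obtains f where "f \<in> generating_epis" "f A = x" "f B = 1 mod int n"
proof -
  obtain f where f: "f \<in> hom G Zn" "f A = x mod int n" "f B = 1 mod int n"
    using hom_exists[of x 1] assms(2) by auto
  \<comment> \<open>For \<open>n = 1\<close> this residue is 0, which is prime to 1.\<close>
  moreover have "coprime (1 mod int n) (int n)" using n by (simp add: coprime_mod_left_iff)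
  ultimately show thesis using that[of f] epi_if_coprime assms(1) by simp
qed

lemma generating_epis_normalize:
  assumes f: "f \<in> generating_epis"
  obtains f' where "f' \<in> generating_epis" "(f, f') \<in> unit_equiv" "f' B = 1 mod int n" "f' A \<in> {0..<int n}" "int n dvd p * f' A + q"
proof -
  have ep: "f \<in> epi G Zn" and hom: "f \<in> hom G Zn" using f by (auto simp: generating_epis_def epi_def)
  have "f B \<in> carrier Zn" using hom AB by (auto simp: hom_def)
  then have "coprime (f B) (int n)" using f generate_integer_mod_group[OF n] by (auto simp: generating_epis_def)
  then obtain v where v: "[f B * v = 1] (mod int n)" using cong_solve_coprime_int by blast
  then have cv: "coprime v (int n)" by (metis coprime_iff_invertible_int mult.commute)
  define x where "x = (v * f A) mod int n"
  have x: "x \<in> {0..<int n}" using n by (simp add: x_def)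
  \<comment> \<open>Multiplying the relation satisfied by \<open>f\<close> by \<open>v\<close> gives
    the normalised congruence, as \<open>v * f B\<close> is 1 modulo \<open>n\<close>.\<close>
  have "[p * x + q = v * (p * f A + q * f B)] (mod int n)"
  proof -
    have "[p * x = v * (p * f A)] (mod int n)"
      by (simp add: x_def cong_def mod_mult_right_eq mult_ac)
    moreover have "[q = v * (q * f B)] (mod int n)"
      using cong_sym[OF cong_scalar_left[OF v, of q]] by (simp add: mult_ac)
    ultimately show ?thesis unfolding distrib_left by (rule cong_add)
  qed
  then have dx: "int n dvd p * x + q"
    using hom_relation[OF hom] by (metis cong_dvd_iff dvd_mult)
  obtain f' where f': "f' \<in> generating_epis" "f' A = x" "f' B = 1 mod int n" by (rule normal_form_exists[OF x dx])
  have hom': "f' \<in> hom G Zn" "f' \<in> epi G Zn" using f'(1) by (auto simp: generating_epis_def epi_def)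
  have "f' c = (v * f c) mod int n" if cG: "c \<in> carrier G" for c
  proof -
    obtain a b where c: "c = word a b" using span_word[OF cG] by blast
    have "[a * x + b * (1 mod int n) = v * (a * f A + b * f B)] (mod int n)"
    proof -
      have "[a * x = v * (a * f A)] (mod int n)"
        by (simp add: x_def cong_def mod_mult_right_eq mult_ac)
      moreover have "[b * (1 mod int n) = v * (b * f B)] (mod int n)"
        using cong_sym[OF cong_scalar_left[OF v, of b]] by (simp add: mult_ac cong_def mod_mult_right_eq)
      ultimately show ?thesis unfolding distrib_left by (rule cong_add)
    qed
    then show ?thesis
      unfolding c hom_word[OF hom] hom_word[OF hom'(1)] f' by (simp add: cong_def mod_mult_right_eq)
  qed
  then have "(f, f') \<in> unit_equiv" using ep hom'(2) cv by (intro unit_equivI)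
  then show thesis using that f' x dx by simp
qed

lemma generating_epis_nonempty_iff: "generating_epis \<noteq> {} \<longleftrightarrow> gcd p (int n) dvd q"
proof -
  have "generating_epis \<noteq> {} \<longleftrightarrow> {x \<in> {0..<int n}. int n dvd p * x + q} \<noteq> {}"
  proof
    assume "generating_epis \<noteq> {}"
    then obtain f where "f \<in> generating_epis" by blast
    from generating_epis_normalize[OF this] show "{x \<in> {0..<int n}. int n dvd p * x + q} \<noteq> {}" by blast
  next
    assume "{x \<in> {0..<int n}. int n dvd p * x + q} \<noteq> {}"
    then obtain x where "x \<in> {0..<int n}" "int n dvd p * x + q" by blast
    from normal_form_exists[OF this] show "generating_epis \<noteq> {}" by blast
  qed
  then show ?thesis using linear_congruence_solvable[OF n] by simp
qed

lemma card_generating_epis_classes: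
  assumes "gcd p (int n) dvd q"
  shows "int (card (generating_epis // unit_equiv)) = gcd p (int n)"
proof -
  define X where "X = {x \<in> {0..<int n}. int n dvd p * x + q}"
  have "\<forall>x\<in>X. \<exists>f. f \<in> generating_epis \<and> f A = x \<and> f B = 1 mod int n"
    using normal_form_exists unfolding X_def by (metis (no_types, lifting) mem_Collect_eq)
  then obtain F where F: "\<And>x. x \<in> X \<Longrightarrow> F x \<in> generating_epis \<and> F x A = x \<and> F x B = 1 mod int n" by metis
  have epi: "f \<in> generating_epis \<Longrightarrow> f \<in> epi G Zn" for f by (simp add: generating_epis_def)
  have inj: "x = y" if x: "x \<in> X" and y: "y \<in> X" and xy: "(F x, F y) \<in> unit_equiv" for x y
  proof -
    obtain u where u: "\<And>c. c \<in> carrier G \<Longrightarrow> F y c = (u * F x c) mod int n" using unit_equivE[OF xy] by metis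
    \<comment> \<open>Both homomorphisms take the value 1 at \<open>B\<close>, which forces the unit
      to be 1; the values at \<open>A\<close> then agree.\<close>
    from u[OF AB(2)] F[OF x] F[OF y] have "[u = 1] (mod int n)"
      by (simp add: cong_def mod_mult_right_eq)
    then have "[u * x = 1 * x] (mod int n)" by (rule cong_scalar_right)
    then show "x = y" using u[OF AB(1)] F[OF x] F[OF y] x by (simp add: X_def cong_def)
  qed
  have "bij_betw (\<lambda>x. unit_equiv `` {F x}) X (generating_epis // unit_equiv)"
  proof (rule bij_betwI')
    fix x y assume x: "x \<in> X" and y: "y \<in> X"
    show "unit_equiv `` {F x} = unit_equiv `` {F y} \<longleftrightarrow> x = y"
      using inj[OF x y] eq_equiv_class_iff[OF equiv_unit_equiv] epi F x y by blast
  next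
    fix x assume "x \<in> X" then show "unit_equiv `` {F x} \<in> generating_epis // unit_equiv" using F by (intro quotientI) blast
  next
    fix C assume "C \<in> generating_epis // unit_equiv"
    then obtain f where f: "f \<in> generating_epis" "C = unit_equiv `` {f}" by (auto elim: quotientE)
    obtain f' where f': "f' \<in> generating_epis" "(f, f') \<in> unit_equiv" "f' B = 1 mod int n" "f' A \<in> {0..<int n}" "int n dvd p * f' A + q"
      by (rule generating_epis_normalize[OF f(1)])
    define x where "x = f' A"
    have x: "x \<in> X" using f' by (simp add: X_def x_def)
    \<comment> \<open>Equal values at \<open>A\<close> and \<open>B\<close> give equality on the
      carrier only, so \<open>f'\<close> and the chosen \<open>F x\<close> are equivalent by the
      unit 1 rather than equal.\<close>
    have "(f', F x) \<in> unit_equiv"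
    proof (rule unit_equivI[of _ _ 1])
      show "f' \<in> epi G Zn" "F x \<in> epi G Zn" using f'(1) F[OF x] epi by auto
      then have h: "f' \<in> hom G Zn" "F x \<in> hom G Zn" by (auto simp: epi_def)
      fix c assume "c \<in> carrier G"
      then obtain a b where c: "c = word a b" using span_word by blast
      show "F x c = (1 * f' c) mod int n"
        unfolding c hom_word[OF h(1)] hom_word[OF h(2)] using F[OF x] f'(3) by (simp add: x_def)
    qed simp
    then have "(f, F x) \<in> unit_equiv" using f'(2) equiv_unit_equiv by (meson equivE transE)
    then have "C = unit_equiv `` {F x}" using f(2) equiv_class_eq[OF equiv_unit_equiv] by blast
    then show "\<exists>x\<in>X. C = unit_equiv `` {F x}" using x by blast
  qed
  then have "card (generating_epis // unit_equiv) = card X" by (metis bij_betw_same_card)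
  then show ?thesis using card_linear_congruence[OF n assms] by (simp add: X_def)
qed

end

section \<open>The presentation of the first homology of the knot complement\<close>

section \<open>The homology of the knot complement\<close>

context torus_gluing
begin

text \<open>In the arc complement \<open>beta\<close> bounds, so \<open>h \<circ> beta\<close>
  reduces to \<open>p\<close> times \<open>alpha\<close> plus \<open>q''\<close> times
  \<open>gamma\<close>. The kernel consists of its multiples, and the independence of
  \<open>alpha\<close> and \<open>gamma\<close> allows comparing coefficients.\<close>

lemma knot_complement_boundary_iff:
  assumes hyp: "one_boundary punctured_torus (path_chain (h \<circ> beta) -
      (frag_cmul p (path_chain alpha) + frag_cmul q' (path_chain beta) + frag_cmul q'' (path_chain gamma)))"
  shows "one_boundary M (push (\<lambda>z. glue h (False, z)) (frag_cmul a (path_chain alpha) + frag_cmul b (path_chain gamma)))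
    \<longleftrightarrow> (\<exists>k. a = k * p \<and> b = k * q'')"
proof -
  let ?i = "\<lambda>z. glue h (False, z)"
  let ?al = "path_chain alpha" and ?be = "path_chain beta" and ?ga = "path_chain gamma"
    and ?hb = "path_chain (h \<circ> beta)"
  have cyc: "one_cycle arc_complement ?al" "one_cycle arc_complement ?ga"
    using punctured_torus_cycle_mono(1)[OF punctured_torus_subset(2)] one_cycle_curves by blast+
  have "one_boundary arc_complement (?hb - (frag_cmul p ?al + frag_cmul q' ?be + frag_cmul q'' ?ga))"
    by (rule punctured_torus_cycle_mono(2)[OF punctured_torus_subset(2) hyp])
  from one_boundary_add[OF this one_boundary_cmul[OF beta_bounds, of q']]
  have hb: "one_boundary arc_complement (?hb - (frag_cmul p ?al + frag_cmul q'' ?ga))"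
    by (simp add: algebra_simps)
  have lin: "frag_cmul a ?al + frag_cmul b ?ga - frag_cmul k ?hb =
      (frag_cmul (a - k * p) ?al + frag_cmul (b - k * q'') ?ga) - frag_cmul k (?hb - (frag_cmul p ?al + frag_cmul q'' ?ga))"
    for k
    by (intro poly_mapping_eqI) (simp add: lookup_add lookup_minus algebra_simps)
  show ?thesis
  proof
    assume "one_boundary M (push ?i (frag_cmul a ?al + frag_cmul b ?ga))"
    then obtain k where k: "one_boundary arc_complement (frag_cmul a ?al + frag_cmul b ?ga - frag_cmul k ?hb)"
      using knot_complement_kernel[of "frag_cmul a ?al + frag_cmul b ?ga"] cyc one_cycle_add one_cycle_cmul by metis
    from one_boundary_add[OF this one_boundary_cmul[OF hb, of k]]
    have "one_boundary arc_complement (frag_cmul (a - k * p) ?al + frag_cmul (b - k * q'') ?ga)"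
      unfolding lin by simp
    from arc_complement_independent[OF this] show "\<exists>k. a = k * p \<and> b = k * q''" by auto
  next
    assume "\<exists>k. a = k * p \<and> b = k * q''"
    then obtain k where k: "a = k * p" "b = k * q''" by blast
    \<comment> \<open>In the glued space \<open>h \<circ> beta\<close> in the first copy is the
      curve \<open>beta\<close> of the second copy, which bounds a disc there.\<close>
    have "push ?i ?hb = push (\<lambda>z. glue h (True, z)) ?be"
      using push_glue_True[OF one_cycle_curves(2)] by (simp add: push_path_chain)
    then have "one_boundary M (push ?i ?hb)"
      using one_boundary_push[OF beta_bounds continuous_map_inclusion[of True]] by simp
    from one_boundary_diff[OF one_boundary_cmul[OF this, of k]
        one_boundary_cmul[OF one_boundary_push[OF hb continuous_map_inclusion[of False]], of k]]
    have "one_boundary M (push ?i (frag_cmul k ?hb - frag_cmul k (?hb - (frag_cmul p ?al + frag_cmul q'' ?ga))))"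
      by (simp add: push_diff push_cmul)
    moreover have "frag_cmul k ?hb - frag_cmul k (?hb - (frag_cmul p ?al + frag_cmul q'' ?ga))
        = frag_cmul a ?al + frag_cmul b ?ga"
      unfolding k by (intro poly_mapping_eqI) (simp add: lookup_add lookup_minus algebra_simps)
    ultimately show "one_boundary M (push ?i (frag_cmul a ?al + frag_cmul b ?ga))" by simp
  qed
qed

lemma one_relator_knot_complement:
  assumes hyp: "one_boundary punctured_torus (path_chain (h \<circ> beta) -
      (frag_cmul p (path_chain alpha) + frag_cmul q' (path_chain beta) + frag_cmul q'' (path_chain gamma)))"
    and n: "n > 0"
  shows "one_relator (homology_group 1 M) (loop_class M (\<lambda>t. glue h (False, alpha t))) (meridian_class h) p q'' n"
proof -
  let ?i = "\<lambda>z. glue h (False, z)" and ?H = "homology_group 1 M"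
  let ?a = "push ?i (path_chain alpha)" and ?c = "push ?i (path_chain gamma)"
  have cls: "loop_class M (\<lambda>t. glue h (False, alpha t)) = hclass M ?a" "meridian_class h = hclass M ?c"
    by (simp_all add: meridian_class_def loop_class_path_chain hclass_def push_path_chain o_def)
  have cyc: "one_cycle M ?a" "one_cycle M ?c"
    using punctured_torus_cycle_mono(1)[OF punctured_torus_subset(2)] one_cycle_curves
      one_cycle_push[OF _ continuous_map_inclusion] by blast+
  have word: "hclass M ?a [^]\<^bsub>?H\<^esub> (a::int) \<otimes>\<^bsub>?H\<^esub> hclass M ?c [^]\<^bsub>?H\<^esub> (b::int) =
      hclass M (push ?i (frag_cmul a (path_chain alpha) + frag_cmul b (path_chain gamma)))" for a b
    by (simp add: hclass_int_pow cyc hclass_mult push_add push_cmul)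
  interpret comm_group ?H by simp
  show ?thesis unfolding cls
  proof unfold_locales
    show "hclass M ?a \<in> carrier ?H" "hclass M ?c \<in> carrier ?H"
      using cyc by (simp_all add: hclass_in_carrier)
    fix x assume "x \<in> carrier ?H"
    then obtain z where z: "one_cycle M z" "x = hclass M z" by (auto simp: carrier_homology_group_1)
    obtain k m where "one_boundary M (z - push ?i (frag_cmul k (path_chain alpha) + frag_cmul m (path_chain gamma)))"
      by (rule knot_complement_cycles[OF z(1)])
    then show "\<exists>(a::int) (b::int). x = hclass M ?a [^]\<^bsub>?H\<^esub> a \<otimes>\<^bsub>?H\<^esub> hclass M ?c [^]\<^bsub>?H\<^esub> b"
      unfolding word z(2) hclass_eq_iff by blast
  next
    fix a b :: int
    show "hclass M ?a [^]\<^bsub>?H\<^esub> a \<otimes>\<^bsub>?H\<^esub> hclass M ?c [^]\<^bsub>?H\<^esub> b = \<one>\<^bsub>?H\<^esub> \<longleftrightarrow> (\<exists>k. a = k * p \<and> b = k * q'')"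
      unfolding word hclass_one hclass_eq_iff using knot_complement_boundary_iff[OF hyp, of a b] by simp
  qed (rule n)
qed

end

lemma pure_homeos_gluing:
  assumes "\<psi> \<in> pure_homeos" obtains g where "torus_gluing \<psi> g"
  using assms unfolding pure_homeos_def homeomorphic_map_maps by (auto simp: torus_gluing_def)

theorem theorem4:
  fixes \<Psi> :: "(complex \<times> complex \<Rightarrow> complex \<times> complex) set"
    and \<psi> :: "complex \<times> complex \<Rightarrow> complex \<times> complex"
    and p q' q'' :: int and n :: nat
  assumes "\<Psi> \<in> PMCG" and "\<psi> \<in> \<Psi>"
    and "loop_class punctured_torus (\<psi> \<circ> beta) =
           loop_class punctured_torus alpha [^]\<^bsub>homology_group 1 punctured_torus\<^esub> p
           \<otimes>\<^bsub>homology_group 1 punctured_torus\<^esub>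
           loop_class punctured_torus beta [^]\<^bsub>homology_group 1 punctured_torus\<^esub> q'
           \<otimes>\<^bsub>homology_group 1 punctured_torus\<^esub>
           loop_class punctured_torus gamma [^]\<^bsub>homology_group 1 punctured_torus\<^esub> q''"
    and "n > 0"
  shows "(strongly_cyclic_coverings n \<psi> \<noteq> {} \<longleftrightarrow> gcd p (int n) dvd q'') \<and>
         (gcd p (int n) dvd q'' \<longrightarrow>
            int (card (strongly_cyclic_coverings n \<psi> // covering_equiv n (ambient \<psi>) (knot \<psi>)))
              = gcd p (int n))"
proof -
  have "\<psi> \<in> pure_homeos"
    \<comment> \<open>Isotopy relates pure homeomorphisms only, so every member of a class is
      one.\<close>
    using assms(1,2) unfolding PMCG_def by (auto elim!: quotientE simp: pure_isotopy_def)
  then obtain g where "torus_gluing \<psi> g" by (rule pure_homeos_gluing)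
  then interpret torus_gluing \<psi> g .
  have "one_boundary punctured_torus (path_chain (\<psi> \<circ> beta) -
      (frag_cmul p (path_chain alpha) + frag_cmul q' (path_chain beta) + frag_cmul q'' (path_chain gamma)))"
    using assms(3) unfolding loop_class_path_chain hclass_def[symmetric]
    by (simp only: hclass_int_pow one_cycle_curves hclass_mult hclass_eq_iff)
  from one_relator_knot_complement[OF this assms(4)]
  interpret H: one_relator "homology_group 1 M" "loop_class M (\<lambda>t. glue \<psi> (False, alpha t))" "meridian_class \<psi>" p q'' n .
  have "strongly_cyclic_coverings n \<psi> = H.generating_epis" "covering_equiv n (ambient \<psi>) (knot \<psi>) = H.unit_equiv"
    by (simp_all add: strongly_cyclic_coverings_def covering_equiv_def cyclic_coverings_def H.generating_epis_def H.unit_equiv_def)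
  then show ?thesis using H.generating_epis_nonempty_iff H.card_generating_epis_classes by simp
qed

end
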